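(* Let $(G_r)_{r\ge0}=(G_0<G_1<G_2<\cdots)$ be a family of discrete groups and let $\gamma,\tau:\mathbb N\to\mathbb N\cup\{\pm\infty\}$ be functions. For every $r\ge0$, let $X(r)$ be a $\gamma(r)$-acyclic $\Delta$-complex with a $\tau(r)$-transitive simplicial $G_r$-action and with stabilizers $H_{r,q}=G_{r-q-1}$ which are compatible (in the sense specified in the context). (i) If $\gamma,\tau$ are proper, then $(G_r)_{r\ge0}$ is homologically stable. (ii) If, moreover, rational $\gamma(r)$-acyclicity of $X(r)$ is witnessed by a rational $\ell^1$-homotopy (for every $r$), then $(G_r)_{r\ge0}$ is also bc-stable.
   Context: Conventions: $0\in\mathbb N$. A function $\mathbb N\to\mathbb N\cup\{\pm\infty\}$ is proper if it tends to $+\infty$ as $r\to\infty$ (value $+\infty$ allowed). A $\Delta$-complex is a semi-simplicial set $X=(X_k)_{k\ge0}$ with face maps $\delta_i:X_{k+1}\to X_k$, $0\le i\le k+1$, satisfying $\delta_i\delta_j=\delta_{j-1}\delta_i$ for $i<j$; a simplicial $G$-action is an action on each $X_k$ commuting with the face maps. A simplex $x$ is a face of $y$ if it is obtained from $y$ by applying finitely many face maps. $X_{-1}$ denotes a singleton, $o_{-1}$ its element. $X(r)$ is $\gamma(r)$-acyclic if its reduced homology $\tilde{\mathrm H}_\bullet(X(r))$ vanishes up to degree $\gamma(r)$. The action is $\tau(r)$-transitive if there is exactly one $G_r$-orbit of $l$-simplices for every integer $0\le l\le\tau(r)$. Both conditions are void for the value $-\infty$. Compatibility: set $G_k:=\{1\}$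 for $k<0$ and let $\iota_k:G_k\hookrightarrow G_{k+1}$ be the inclusion. There are, for each $r$, simplices $o_{r,p}\in X(r)_p$ ($0\le p\le\tau(r)$) with $o_{r,p}$ a face of $o_{r,p+1}$, with stabilizers $H_{r,p}=\mathrm{Stab}_{G_r}(o_{r,p})$, $H_{r,-1}:=G_r$, such that $H_{r,p}=G_{r-p-1}$ for all $-1\le p\le\tau(r)$; and there are elements $w_{r,p,i}\in G_r$ with $\delta_i(o_{r,p+1})=w_{r,p,i}^{-1}\cdot o_{r,p}$ such that the conjugation $H_{r,p+1}\to H_{r,p}$, $h\mapsto w_{r,p,i}hw_{r,p,i}^{-1}$, equals the inclusion $\iota_{r-p-2}:G_{r-p-2}\hookrightarrow G_{r-p-1}$ for all $r$, all $-1\le p\le\tau(r)-1$ and all $0\le i\le p+1$. Rational $\ell^1$-homotopy: consider the augmented rational chain complex $\cdots\to\mathbb QX(r)_1\xrightarrow{d_0}\mathbb QX(r)_0\xrightarrow{d_{-1}}\mathbb Q\to0$ (so $d_k:\mathbb QX(r)_{k+1}\to\mathbb QX(r)_k$ with $\mathbb QX(r)_{-1}=\mathbb Q$). A partial contracting chain homotopy witnessing rational $\gamma(r)$-acyclicity consists of linear maps $h_k:\mathbb QX(r)_k\to\mathbb QX(r)_{k+1}$, $-1\le k\le\gamma(r)$, with $d_k\circ h_k+h_{k-1}\circ d_{k-1}=1$ for $0\le k\le\gamma(r)$ and $d_{-1}\circ h_{-1}=1$. It is a rational $\ell^1$-homotopy if for every such $k\ge0$ there is a constant $C_k>0$ such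 that for every $k$-simplex $\sigma$ one has $\|h_k(\sigma)\|_1\le C_k$, where $\|\sum_i\alpha_i\tau_i\|_1=\sum_i|\alpha_i|$ for distinct simplices $\tau_i$. Homologically stable: there is a function $\rho:\mathbb N\to\mathbb N$ such that for all $q$ the inclusions induce isomorphisms $\mathrm H_q(G_{\rho(q)})\cong\mathrm H_q(G_{\rho(q)+1})\cong\cdots$ in group homology. bc-stable: there is $\rho:\mathbb N\to\mathbb N$ such that for all $q$ the inclusions induce isomorphisms $\mathrm H_{\mathrm b}^q(G_{\rho(q)})\cong\mathrm H_{\mathrm b}^q(G_{\rho(q)+1})\cong\cdots$ in bounded cohomology with trivial real coefficients (cohomology of the complex of $G$-invariant bounded functions $G^{\bullet+1}\to\mathbb R$ with the homogeneous differential). *)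

theory Defs
  imports
    Complex_Main
    "HOL-Library.Extended"
    "HOL-Library.Poly_Mapping"
    "HOL-Algebra.Group_Action"
    "HOL-Algebra.Elementary_Groups"
begin

section \<open>\<open>\<Delta>\<close>-complexes\<close>

text \<open>\<open>face X k i\<close> is the face map \<open>\<delta>\<^sub>i\<close> from the \<open>(k+1)\<close>-simplices to the \<open>k\<close>-simplices.
  The sets of simplices of different dimensions need not be disjoint; a simplex always
  comes with its dimension.\<close>

record 'x semisimplicial =
  simplices :: "nat \<Rightarrow> 'x set"
  face :: "nat \<Rightarrow> nat \<Rightarrow> 'x \<Rightarrow> 'x"

definition delta_complex :: "'x semisimplicial \<Rightarrow> bool" where
  "delta_complex X \<longleftrightarrow>
     (\<forall>k. \<forall>i \<le> Suc k. face X k i \<in> simplices X (Suc k) \<rightarrow> simplices X k) \<and>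
     (\<forall>k i j. i < j \<and> j \<le> Suc (Suc k) \<longrightarrow>
        (\<forall>x \<in> simplices X (Suc (Suc k)).
           face X k i (face X (Suc k) j x) = face X k (j - 1) (face X (Suc k) i x)))"

text \<open>\<open>is_face X k x l y\<close>: the \<open>k\<close>-simplex \<open>x\<close> is a face of the \<open>l\<close>-simplex \<open>y\<close>.\<close>

inductive is_face :: "'x semisimplicial \<Rightarrow> nat \<Rightarrow> 'x \<Rightarrow> nat \<Rightarrow> 'x \<Rightarrow> bool"
  for X :: "'x semisimplicial" where
  refl: "y \<in> simplices X l \<Longrightarrow> is_face X l y l y"
| step: "is_face X (Suc k) x l y \<Longrightarrow> i \<le> Suc k \<Longrightarrow> is_face X k (face X k i x) l y"


section \<open>Chains and homology\<close>

definition chains :: "'x semisimplicial \<Rightarrow> nat \<Rightarrow> ('x \<Rightarrow>\<^sub>0 'r::comm_ring_1) set" where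
  "chains X k = {c. Poly_Mapping.keys c \<subseteq> simplices X k}"

text \<open>\<open>boundary X k\<close> goes from degree \<open>k+1\<close> to degree \<open>k\<close>.\<close>

definition boundary :: "'x semisimplicial \<Rightarrow> nat \<Rightarrow> ('x \<Rightarrow>\<^sub>0 'r::comm_ring_1) \<Rightarrow> ('x \<Rightarrow>\<^sub>0 'r)" where
  "boundary X k c =
     (\<Sum>x\<in>Poly_Mapping.keys c. \<Sum>i\<le>Suc k.
        Poly_Mapping.single (face X k i x) ((- 1) ^ i * Poly_Mapping.lookup c x))"

definition augmentation :: "('x \<Rightarrow>\<^sub>0 'r::comm_ring_1) \<Rightarrow> 'r" where
  "augmentation c = (\<Sum>x\<in>Poly_Mapping.keys c. Poly_Mapping.lookup c x)"

definition additive_group :: "'c::ab_group_add set \<Rightarrow> 'c monoid" where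
  "additive_group C = \<lparr>carrier = C, mult = (+), one = 0\<rparr>"

definition cycles :: "'x semisimplicial \<Rightarrow> nat \<Rightarrow> ('x \<Rightarrow>\<^sub>0 int) set" where
  "cycles X q = {c \<in> chains X q. case q of 0 \<Rightarrow> True | Suc k \<Rightarrow> boundary X k c = 0}"

definition reduced_cycles :: "'x semisimplicial \<Rightarrow> nat \<Rightarrow> ('x \<Rightarrow>\<^sub>0 int) set" where
  "reduced_cycles X q =
     {c \<in> chains X q. case q of 0 \<Rightarrow> augmentation c = 0 | Suc k \<Rightarrow> boundary X k c = 0}"

definition boundaries :: "'x semisimplicial \<Rightarrow> nat \<Rightarrow> ('x \<Rightarrow>\<^sub>0 int) set" where
  "boundaries X q = boundary X q ` chains X (Suc q)"

definition homology_group :: "nat \<Rightarrow> 'x semisimplicial \<Rightarrow> ('x \<Rightarrow>\<^sub>0 int) set monoid" where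
  "homology_group q X = additive_group (cycles X q) Mod boundaries X q"

definition reduced_homology_group :: "nat \<Rightarrow> 'x semisimplicial \<Rightarrow> ('x \<Rightarrow>\<^sub>0 int) set monoid" where
  "reduced_homology_group q X = additive_group (reduced_cycles X q) Mod boundaries X q"

text \<open>Reduced homology in degree \<open>-1\<close>, which vanishes iff there is a \<open>0\<close>-simplex.\<close>

definition reduced_homology_group_minus1 :: "'x semisimplicial \<Rightarrow> int set monoid" where
  "reduced_homology_group_minus1 X =
     integer_group Mod (augmentation ` chains X 0)"

definition acyclic_upto :: "nat extended \<Rightarrow> 'x semisimplicial \<Rightarrow> bool" where
  "acyclic_upto n X \<longleftrightarrow>
     (n \<noteq> Minf \<longrightarrow> trivial_group (reduced_homology_group_minus1 X)) \<and>
     (\<forall>q. Fin q \<le> n \<longrightarrow> trivial_group (reduced_homology_group q X))"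

text \<open>For a homomorphism \<open>f\<close> into \<open>A\<close> that maps a normal subgroup \<open>M\<close> of its domain into the
  normal subgroup \<open>N\<close> of \<open>A\<close>, this is the induced map of quotient groups: it sends the coset
  of \<open>c\<close> modulo \<open>M\<close> to the coset of \<open>f c\<close> modulo \<open>N\<close>.\<close>

definition quotient_map :: "('a, 'm) monoid_scheme \<Rightarrow> 'a set \<Rightarrow> ('c \<Rightarrow> 'a) \<Rightarrow> 'c set \<Rightarrow> 'a set" where
  "quotient_map A N f C = N <#>\<^bsub>A\<^esub> (f ` C)"


section \<open>Families of groups and homological stability\<close>

text \<open>\<open>G 0 < G 1 < \<dots>\<close> as a chain of subgroups: the identity being a monomorphism means that
  the carrier is a subset and the multiplication is the restricted one.\<close>

definition group_tower :: "(nat \<Rightarrow> 'g monoid) \<Rightarrow> bool" where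
  "group_tower G \<longleftrightarrow> (\<forall>r. group (G r)) \<and> (\<forall>r. id \<in> mon (G r) (G (Suc r)))"

text \<open>The nerve of a group: its chain complex is the (inhomogeneous, unnormalised) bar complex
  with trivial coefficients, in which the list \<open>[g\<^sub>1, \<dots>, g\<^sub>k]\<close> stands for the bar symbol
  \<open>[g\<^sub>1|\<dots>|g\<^sub>k]\<close>.\<close>

definition tuples :: "'g monoid \<Rightarrow> nat \<Rightarrow> 'g list set" where
  "tuples G n = {s. length s = n \<and> set s \<subseteq> carrier G}"

definition nerve :: "'g monoid \<Rightarrow> 'g list semisimplicial" where
  "nerve G = \<lparr>simplices = tuples G,
     face = (\<lambda>k i s. if i = 0 then tl s
                     else if i = Suc k then butlast s
                     else take (i - 1) s @ [s ! (i - 1) \<otimes>\<^bsub>G\<^esub> s ! i] @ drop (Suc i) s)\<rparr>"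

definition group_homology :: "nat \<Rightarrow> 'g monoid \<Rightarrow> ('g list \<Rightarrow>\<^sub>0 int) set monoid" where
  "group_homology q G = homology_group q (nerve G)"

text \<open>On bar chains the map induced by the inclusion \<open>H \<le> G\<close> is the inclusion.\<close>

definition group_homology_incl ::
    "nat \<Rightarrow> 'g monoid \<Rightarrow> ('g list \<Rightarrow>\<^sub>0 int) set \<Rightarrow> ('g list \<Rightarrow>\<^sub>0 int) set" where
  "group_homology_incl q G =
     quotient_map (additive_group (cycles (nerve G) q)) (boundaries (nerve G) q) id"

definition homologically_stable :: "(nat \<Rightarrow> 'g monoid) \<Rightarrow> bool" where
  "homologically_stable G \<longleftrightarrow> (\<exists>\<rho>::nat \<Rightarrow> nat. \<forall>q. \<forall>n \<ge> \<rho> q.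
     group_homology_incl q (G (Suc n)) \<in> iso (group_homology q (G n)) (group_homology q (G (Suc n))))"


section \<open>Bounded cohomology and bc-stability\<close>

text \<open>Invariant bounded functions \<open>G\<^sup>q\<^sup>+\<^sup>1 \<rightarrow> \<real>\<close>, encoded as functions on lists that vanish
  outside \<open>tuples G (q + 1)\<close>.\<close>

definition bcochains :: "nat \<Rightarrow> 'g monoid \<Rightarrow> ('g list \<Rightarrow> real) set" where
  "bcochains q G =
     {f. (\<forall>s. s \<notin> tuples G (Suc q) \<longrightarrow> f s = 0) \<and>
         (\<exists>B. \<forall>s \<in> tuples G (Suc q). \<bar>f s\<bar> \<le> B) \<and>
         (\<forall>g \<in> carrier G. \<forall>s \<in> tuples G (Suc q). f (map (\<lambda>x. g \<otimes>\<^bsub>G\<^esub> x) s) = f s)}"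

definition bdifferential :: "nat \<Rightarrow> 'g monoid \<Rightarrow> ('g list \<Rightarrow> real) \<Rightarrow> 'g list \<Rightarrow> real" where
  "bdifferential q G f s =
     (if s \<in> tuples G (Suc (Suc q))
      then \<Sum>i\<le>Suc q. (- 1) ^ i * f (take i s @ drop (Suc i) s)
      else 0)"

definition bcocycles :: "nat \<Rightarrow> 'g monoid \<Rightarrow> ('g list \<Rightarrow> real) set" where
  "bcocycles q G = {f \<in> bcochains q G. \<forall>s. bdifferential q G f s = 0}"

definition bcoboundaries :: "nat \<Rightarrow> 'g monoid \<Rightarrow> ('g list \<Rightarrow> real) set" where
  "bcoboundaries q G =
     (case q of 0 \<Rightarrow> {\<lambda>_. 0} | Suc k \<Rightarrow> bdifferential k G ` bcochains k G)"

definition bcocycle_group :: "nat \<Rightarrow> 'g monoid \<Rightarrow> ('g list \<Rightarrow> real) monoid" where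
  "bcocycle_group q G =
     \<lparr>carrier = bcocycles q G, mult = (\<lambda>f g s. f s + g s), one = (\<lambda>_. 0)\<rparr>"

definition bounded_cohomology :: "nat \<Rightarrow> 'g monoid \<Rightarrow> ('g list \<Rightarrow> real) set monoid" where
  "bounded_cohomology q G = bcocycle_group q G Mod bcoboundaries q G"

text \<open>The map in bounded cohomology induced by an inclusion with domain \<open>H\<close>: restriction to
  \<open>H\<^sup>q\<^sup>+\<^sup>1\<close>. It is compatible with scalar multiplication, so it is an isomorphism of vector
  spaces as soon as it is one of groups.\<close>

definition bounded_cohomology_res ::
    "nat \<Rightarrow> 'g monoid \<Rightarrow> ('g list \<Rightarrow> real) set \<Rightarrow> ('g list \<Rightarrow> real) set" where
  "bounded_cohomology_res q H =
     quotient_map (bcocycle_group q H) (bcoboundaries q H)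
       (\<lambda>f s. if s \<in> tuples H (Suc q) then f s else 0)"

definition bc_stable :: "(nat \<Rightarrow> 'g monoid) \<Rightarrow> bool" where
  "bc_stable G \<longleftrightarrow> (\<exists>\<rho>::nat \<Rightarrow> nat. \<forall>q. \<forall>n \<ge> \<rho> q.
     bounded_cohomology_res q (G n)
       \<in> iso (bounded_cohomology q (G (Suc n))) (bounded_cohomology q (G n)))"


section \<open>Actions on \<open>\<Delta>\<close>-complexes\<close>

definition simplicial_action ::
    "'g monoid \<Rightarrow> 'x semisimplicial \<Rightarrow> (nat \<Rightarrow> 'g \<Rightarrow> 'x \<Rightarrow> 'x) \<Rightarrow> bool" where
  "simplicial_action G X \<phi> \<longleftrightarrow>
     (\<forall>k. group_action G (simplices X k) (\<phi> k)) \<and>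
     (\<forall>k. \<forall>i \<le> Suc k. \<forall>g \<in> carrier G. \<forall>x \<in> simplices X (Suc k).
        face X k i (\<phi> (Suc k) g x) = \<phi> k g (face X k i x))"

definition transitive_upto ::
    "nat extended \<Rightarrow> 'g monoid \<Rightarrow> 'x semisimplicial \<Rightarrow> (nat \<Rightarrow> 'g \<Rightarrow> 'x \<Rightarrow> 'x) \<Rightarrow> bool" where
  "transitive_upto n G X \<phi> \<longleftrightarrow> (\<forall>l. Fin l \<le> n \<longrightarrow> card (orbits G (simplices X l) (\<phi> l)) = 1)"

definition proper_fun :: "(nat \<Rightarrow> nat extended) \<Rightarrow> bool" where
  "proper_fun f \<longleftrightarrow> (\<forall>K. \<exists>R. \<forall>r \<ge> R. Fin K \<le> f r)"

text \<open>\<open>G\<^sub>k\<close> for \<open>k :: int\<close>, with \<open>G\<^sub>k = {1}\<close> for \<open>k < 0\<close>.\<close>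

definition tower_at :: "(nat \<Rightarrow> 'g monoid) \<Rightarrow> int \<Rightarrow> 'g set" where
  "tower_at G k = (if k < 0 then {\<one>\<^bsub>G 0\<^esub>} else carrier (G (nat k)))"

text \<open>\<open>H\<^sub>p = Stab(o\<^sub>p)\<close> for \<open>p \<ge> 0\<close>, and \<open>H\<^sub>-\<^sub>1 = G\<close>.\<close>

definition stab_at ::
    "'g monoid \<Rightarrow> (nat \<Rightarrow> 'g \<Rightarrow> 'x \<Rightarrow> 'x) \<Rightarrow> (nat \<Rightarrow> 'x) \<Rightarrow> int \<Rightarrow> 'g set" where
  "stab_at G \<phi> ob p =
     (if p < 0 then carrier G else stabilizer G (\<phi> (nat p)) (ob (nat p)))"

text \<open>Bounds \<open>p \<le> \<tau> r\<close> with an integer \<open>p \<ge> -1\<close> are taken in \<open>int extended\<close>; \<open>p + 1 \<le> \<tau> r\<close>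
  stands for \<open>p \<le> \<tau> r - 1\<close>. For \<open>p = -1\<close> the condition on the face \<open>\<delta>\<^sub>0\<close> of \<open>o\<^sub>0\<close> is an equation
  in the singleton of \<open>(-1)\<close>-simplices and therefore omitted.\<close>

definition compatible_stabilizers ::
    "(nat \<Rightarrow> 'g monoid) \<Rightarrow> (nat \<Rightarrow> 'x semisimplicial) \<Rightarrow> (nat \<Rightarrow> nat \<Rightarrow> 'g \<Rightarrow> 'x \<Rightarrow> 'x) \<Rightarrow>
     (nat \<Rightarrow> nat extended) \<Rightarrow> bool" where
  "compatible_stabilizers G X \<phi> \<tau> \<longleftrightarrow> (\<forall>r. \<exists>(ob :: nat \<Rightarrow> 'x) (w :: int \<Rightarrow> nat \<Rightarrow> 'g).
     (\<forall>p. Fin p \<le> \<tau> r \<longrightarrow> ob p \<in> simplices (X r) p) \<and>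
     (\<forall>p. Fin (Suc p) \<le> \<tau> r \<longrightarrow> is_face (X r) p (ob p) (Suc p) (ob (Suc p))) \<and>
     (\<forall>p. - 1 \<le> p \<and> Fin p \<le> map_extended int (\<tau> r) \<longrightarrow>
        stab_at (G r) (\<phi> r) ob p = tower_at G (int r - p - 1)) \<and>
     (\<forall>p i. - 1 \<le> p \<and> Fin (p + 1) \<le> map_extended int (\<tau> r) \<and> int i \<le> p + 1 \<longrightarrow>
        w p i \<in> carrier (G r) \<and>
        (0 \<le> p \<longrightarrow> face (X r) (nat p) i (ob (Suc (nat p)))
                    = \<phi> r (nat p) (inv\<^bsub>G r\<^esub> w p i) (ob (nat p))) \<and>
        (\<forall>h \<in> stab_at (G r) (\<phi> r) ob (p + 1).
           w p i \<otimes>\<^bsub>G r\<^esub> h \<otimes>\<^bsub>G r\<^esub> inv\<^bsub>G r\<^esub> w p i = h)))"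


section \<open>Rational \<open>\<ell>\<^sup>1\<close>-homotopies\<close>

definition scale_chain :: "rat \<Rightarrow> ('x \<Rightarrow>\<^sub>0 rat) \<Rightarrow> ('x \<Rightarrow>\<^sub>0 rat)" where
  "scale_chain a c = Poly_Mapping.map ((*) a) c"

definition rat_linear_on ::
    "(rat \<Rightarrow> 'a \<Rightarrow> 'a) \<Rightarrow> (rat \<Rightarrow> 'b \<Rightarrow> 'b) \<Rightarrow> 'a::ab_group_add set \<Rightarrow> ('a \<Rightarrow> 'b::ab_group_add) \<Rightarrow> bool" where
  "rat_linear_on s1 s2 V f \<longleftrightarrow>
     (\<forall>x \<in> V. \<forall>y \<in> V. f (x + y) = f x + f y) \<and> (\<forall>a. \<forall>x \<in> V. f (s1 a x) = s2 a (f x))"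

definition l1_norm :: "('x \<Rightarrow>\<^sub>0 rat) \<Rightarrow> real" where
  "l1_norm c = (\<Sum>x\<in>Poly_Mapping.keys c. \<bar>of_rat (Poly_Mapping.lookup c x)\<bar>)"

text \<open>\<open>ha\<close> is the component \<open>h\<^sub>-\<^sub>1\<close> of the homotopy and \<open>h k\<close> its component in degree \<open>k\<close>.\<close>

definition contracting_homotopy ::
    "nat extended \<Rightarrow> 'x semisimplicial \<Rightarrow> (rat \<Rightarrow> ('x \<Rightarrow>\<^sub>0 rat)) \<Rightarrow>
     (nat \<Rightarrow> ('x \<Rightarrow>\<^sub>0 rat) \<Rightarrow> ('x \<Rightarrow>\<^sub>0 rat)) \<Rightarrow> bool" where
  "contracting_homotopy n X ha h \<longleftrightarrow>
     (n \<noteq> Minf \<longrightarrow>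
        rat_linear_on (*) scale_chain UNIV ha \<and> range ha \<subseteq> chains X 0 \<and>
        (\<forall>a. augmentation (ha a) = a)) \<and>
     (\<forall>k. Fin k \<le> n \<longrightarrow>
        rat_linear_on scale_chain scale_chain (chains X k) (h k) \<and>
        h k ` chains X k \<subseteq> chains X (Suc k) \<and>
        (\<forall>c \<in> chains X k.
           boundary X k (h k c)
             + (case k of 0 \<Rightarrow> ha (augmentation c) | Suc j \<Rightarrow> h j (boundary X j c)) = c))"

definition l1_homotopy ::
    "nat extended \<Rightarrow> 'x semisimplicial \<Rightarrow> (rat \<Rightarrow> ('x \<Rightarrow>\<^sub>0 rat)) \<Rightarrow>
     (nat \<Rightarrow> ('x \<Rightarrow>\<^sub>0 rat) \<Rightarrow> ('x \<Rightarrow>\<^sub>0 rat)) \<Rightarrow> bool" where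
  "l1_homotopy n X ha h \<longleftrightarrow>
     contracting_homotopy n X ha h \<and>
     (\<forall>k. Fin k \<le> n \<longrightarrow>
        (\<exists>C > 0. \<forall>\<sigma> \<in> simplices X k. l1_norm (h k (Poly_Mapping.single \<sigma> 1)) \<le> C))"

end

theory Submission
  imports Defs "HOL-Library.Function_Algebras"
begin

text \<open>The proof is Quillen's stability argument with the spectral sequence replaced by the one
  diagram chase that the argument needs.

  Augment \<open>X(r)\<close> by a point and let \<open>Y P\<close> be its simplices of dimension \<open>P - 1\<close>. The group
  \<open>G = G\<^sub>r\<close> acts transitively on \<open>Y P\<close> in a range of \<open>P\<close>, and the stabilizer of the base point is
  \<open>G\<^sub>r\<^sub>-\<^sub>P\<close>. Put the chains on \<open>G\<^sup>j \<times> Y P\<close>, the bar complex of the action on \<open>Y P\<close>, in column \<open>P\<close> and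
  row \<open>j\<close> of a double complex. The rows are exact because \<open>X(r)\<close> is acyclic. Column \<open>P\<close> computes
  the homology of \<open>G\<^sub>r\<^sub>-\<^sub>P\<close> by Shapiro's lemma. The map from column \<open>P + 1\<close> to column \<open>P\<close> is an
  alternating sum over \<open>P + 1\<close> faces; as the elements \<open>w\<close> centralize the smaller stabilizer, every face
  induces the map \<open>H(G\<^sub>r\<^sub>-\<^sub>P\<^sub>-\<^sub>1) \<rightarrow> H(G\<^sub>r\<^sub>-\<^sub>P)\<close> of the inclusion, so that the sum induces this map if \<open>P\<close> is even
  and \<open>0\<close> if \<open>P\<close> is odd (\<open>hor_emb_cycle\<close>). In the degrees below \<open>q\<close>, where stability holds by
  induction, the homology of the columns is therefore horizontally exact from column \<open>2\<close> on, and a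
  chase (\<open>chain_double_complex\<close>) shows that column \<open>1\<close> maps isomorphically to column \<open>0\<close> in degree
  \<open>q\<close>. On homology this is the map of the inclusion \<open>G\<^sub>r\<^sub>-\<^sub>1 \<rightarrow> G\<^sub>r\<close>.

  In bounded cohomology the columns consist of the bounded \<open>G\<close>-equivariant functions on
  \<open>G\<^sup>j\<^sup>+\<^sup>1 \<times> Y P\<close>, and the dual chase applies (\<open>cochain_double_complex\<close>). A primitive of an
  equivariant function in the row direction is chosen for one tuple in each \<open>G\<close>-orbit of tuples; the
  \<open>\<ell>\<^sup>1\<close>-homotopy provides primitives with a common norm bound, so that they form a bounded function
  (\<open>cohor_exact\<close>).

  All homotopies come from \<open>prism_homotopy\<close>, a formula for functions on tuples with values in an
  arbitrary abelian group. With values in chains it serves homology, with values in the reals it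
  serves bounded cohomology. To see that a face induces the map of the inclusion, the base point has
  to be compared with its translate by \<open>w\<^sup>-\<^sup>1\<close>. The maps in Shapiro's lemma depend on a section of the
  orbit map \<open>G \<rightarrow> Y P\<close>, and for a section with value \<open>w\<^sup>-\<^sup>1\<close> at this translate the two projections
  agree without any further homotopy (\<open>translate_homotopic\<close>, \<open>translate_cohomologous\<close>).\<close>

section \<open>Alternating sums\<close>

definition signed :: "nat \<Rightarrow> 'a::ab_group_add \<Rightarrow> 'a" where
  "signed i x = (if even i then x else - x)"

definition alt_sum :: "nat \<Rightarrow> (nat \<Rightarrow> 'a::ab_group_add) \<Rightarrow> 'a" where
  "alt_sum n f = (\<Sum>i\<le>n. signed i (f i))"

lemma signed_0 [simp]: "signed i 0 = 0"
  by (simp add: signed_def)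

lemma signed_diff: "signed i (x - y) = signed i x - signed i y"
  by (simp add: signed_def)

lemma alt_sum_cong: "(\<And>i. i \<le> n \<Longrightarrow> f i = g i) \<Longrightarrow> alt_sum n f = alt_sum n g"
  by (simp add: alt_sum_def)

lemma alt_sum_0 [simp]: "alt_sum n (\<lambda>_. 0) = 0"
  by (simp add: alt_sum_def)

lemma alt_sum_diff: "alt_sum n (\<lambda>i. f i - g i) = alt_sum n f - alt_sum n g"
  by (simp add: alt_sum_def signed_diff sum_subtractf)

lemma alt_sum_const: "alt_sum n (\<lambda>_. c) = (if even n then c else 0)"
  by (induction n) (auto simp: alt_sum_def signed_def)

lemma alt_sum_apply: "alt_sum n f x = alt_sum n (\<lambda>i. f i x)"
proof -
  have "(\<Sum>i\<in>A. signed i (f i)) x = (\<Sum>i\<in>A. signed i (f i x))" if "finite A" for A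
    using that by (induction A) (auto simp: signed_def)
  then show ?thesis by (simp add: alt_sum_def)
qed

lemma (in additive) minus_signed: "f (signed i x) = signed i (f x)"
  by (simp add: signed_def minus)

lemma (in additive) alt_sum: "f (alt_sum n g) = alt_sum n (\<lambda>i. f (g i))"
  by (simp add: alt_sum_def sum minus_signed)

lemma alt_sum_Suc_shift: "alt_sum (Suc n) f = f 0 - alt_sum n (\<lambda>i. f (Suc i))"
  unfolding alt_sum_def
  by (subst sum.atMost_Suc_shift) (simp add: signed_def sum_negf[symmetric] del: sum.atMost_Suc cong: sum.cong if_cong, rule sum.cong, auto)

lemma alt_sum_in:
  assumes "0 \<in> S" "\<And>x y. x \<in> S \<Longrightarrow> y \<in> S \<Longrightarrow> x - y \<in> S" "\<And>i. i \<le> n \<Longrightarrow> f i \<in> S"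
  shows "alt_sum n f \<in> S"
  using assms(3)
proof (induction n arbitrary: f)
  case 0
  then show ?case by (simp add: alt_sum_def signed_def)
next
  case (Suc n)
  then show ?case by (simp add: alt_sum_Suc_shift assms(2))
qed

lemma alt_sum_bound:
  fixes f :: "nat \<Rightarrow> real"
  assumes "\<And>i. i \<le> n \<Longrightarrow> \<bar>f i\<bar> \<le> B"
  shows "\<bar>alt_sum n f\<bar> \<le> real (Suc n) * B"
  using assms
proof (induction n arbitrary: f)
  case 0
  then show ?case by (simp add: alt_sum_def signed_def)
next
  case (Suc n)
  have "\<bar>f 0\<bar> \<le> B" "\<bar>alt_sum n (\<lambda>i. f (Suc i))\<bar> \<le> real (Suc n) * B"
    by (rule Suc.prems, simp, rule Suc.IH, rule Suc.prems, simp)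
  then show ?case by (simp add: alt_sum_Suc_shift algebra_simps)
qed

text \<open>The sign cancellation behind \<open>\<partial>\<partial> = 0\<close> in a semi-simplicial set. Splitting off the index \<open>0\<close>
  from both sums leaves the same claim for the shifted array, and the split-off terms cancel.\<close>

lemma alt_sum_alt_sum_zero:
  fixes a :: "nat \<Rightarrow> nat \<Rightarrow> 'a::ab_group_add"
  assumes "\<And>i j. i < j \<Longrightarrow> j \<le> Suc n \<Longrightarrow> a j i = a i (j - 1)"
  shows "alt_sum (Suc n) (\<lambda>j. alt_sum n (a j)) = 0"
  using assms
proof (induction n arbitrary: a)
  case 0
  have "a 1 0 = a 0 0" using 0[of 0 1] by simp
  then show ?case by (simp add: alt_sum_def signed_def)
next
  case (Suc n)
  have IH: "alt_sum (Suc n) (\<lambda>j. alt_sum n (\<lambda>i. a (Suc j) (Suc i))) = 0"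
    by (rule Suc.IH) (use Suc.prems in force)
  have *: "a (Suc j) 0 = a 0 j" if "j \<le> Suc n" for j
    using Suc.prems[of 0 "Suc j"] that by simp
  have "alt_sum (Suc (Suc n)) (\<lambda>j. alt_sum (Suc n) (a j)) =
     alt_sum (Suc n) (a 0) - alt_sum (Suc n) (\<lambda>j. a (Suc j) 0 - alt_sum n (\<lambda>i. a (Suc j) (Suc i)))"
    by (subst alt_sum_Suc_shift) (simp add: alt_sum_Suc_shift[of n "a (Suc _)"])
  also have "\<dots> = alt_sum (Suc n) (a 0) - alt_sum (Suc n) (\<lambda>j. a (Suc j) 0)"
    by (simp add: alt_sum_diff IH)
  also have "alt_sum (Suc n) (\<lambda>j. a (Suc j) 0) = alt_sum (Suc n) (a 0)"
    by (rule alt_sum_cong) (simp add: *)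
  finally show ?case by simp
qed


section \<open>Omission sums and prisms\<close>

text \<open>The homogeneous differential: the alternating sum of the values of \<open>f\<close> on the tuples with one entry
  omitted (\<open>omission_sum_alt_sum\<close>). The recursion on the first entry makes the identities below
  inductions on lists without any reindexing.\<close>

fun omission_sum :: "('a list \<Rightarrow> 'b::ab_group_add) \<Rightarrow> 'a list \<Rightarrow> 'b" where
  "omission_sum f [] = 0"
| "omission_sum f (x # s) = f s - omission_sum (\<lambda>t. f (x # t)) s"

text \<open>The prism operator, the alternating sum of the values of \<open>f\<close> on
  \<open>(a x\<^sub>0, \<dots>, a x\<^sub>i, b x\<^sub>i, \<dots>, b x\<^sub>n)\<close>.\<close>

fun prism :: "('a \<Rightarrow> 'c) \<Rightarrow> ('a \<Rightarrow> 'c) \<Rightarrow> ('c list \<Rightarrow> 'b::ab_group_add) \<Rightarrow> 'a list \<Rightarrow> 'b" where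
  "prism a b f [] = 0"
| "prism a b f (x # s) = f (a x # b x # map b s) - prism a b (\<lambda>t. f (a x # t)) s"

lemma omission_sum_alt_sum:
  "omission_sum f (x # s) = alt_sum (length s) (\<lambda>i. f (take i (x # s) @ drop (Suc i) (x # s)))"
proof (induction s arbitrary: f x)
  case Nil
  then show ?case by (simp add: alt_sum_def signed_def)
next
  case (Cons y s)
  show ?case
    using Cons[of "\<lambda>t. f (x # t)" y] by (simp add: alt_sum_Suc_shift)
qed

lemma omission_sum_cong:
  assumes "\<And>t. set t \<subseteq> set s \<Longrightarrow> Suc (length t) = length s \<Longrightarrow> f t = g t"
  shows "omission_sum f s = omission_sum g s"
  using assms
proof (induction s arbitrary: f g)
  case (Cons x s)
  have "omission_sum (\<lambda>t. f (x # t)) s = omission_sum (\<lambda>t. g (x # t)) s"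
    by (rule Cons.IH, rule Cons.prems) auto
  then show ?case using Cons.prems by auto
qed simp

lemma omission_sum_in:
  assumes "0 \<in> S" "\<And>x y. x \<in> S \<Longrightarrow> y \<in> S \<Longrightarrow> x - y \<in> S"
    and "\<And>t. set t \<subseteq> set s \<Longrightarrow> Suc (length t) = length s \<Longrightarrow> f t \<in> S"
  shows "omission_sum f s \<in> S"
  using assms(3)
proof (induction s arbitrary: f)
  case (Cons x s)
  have "omission_sum (\<lambda>t. f (x # t)) s \<in> S"
    by (rule Cons.IH, rule Cons.prems) auto
  then show ?case using Cons.prems assms by auto
qed (simp add: assms)

lemma omission_sum_bound:
  fixes f :: "'a list \<Rightarrow> real" and B :: real
  assumes "\<And>t. set t \<subseteq> set s \<Longrightarrow> Suc (length t) = length s \<Longrightarrow> \<bar>f t\<bar> \<le> B"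
  shows "\<bar>omission_sum f s\<bar> \<le> length s * B"
  using assms
proof (induction s arbitrary: f)
  case (Cons x s)
  have "\<bar>omission_sum (\<lambda>t. f (x # t)) s\<bar> \<le> length s * B"
    by (rule Cons.IH, rule Cons.prems) auto
  moreover have "\<bar>f s\<bar> \<le> B" using Cons.prems by auto
  ultimately show ?case by (simp add: algebra_simps)
qed simp

lemma (in additive) omission_sum: "f (omission_sum g s) = omission_sum (\<lambda>t. f (g t)) s"
  by (induction s arbitrary: g) (auto simp: zero diff)

lemma omission_sum_diff:
  "omission_sum (\<lambda>t. f t - g t) s = omission_sum f s - omission_sum g s"
  by (induction s arbitrary: f g) auto

lemma omission_sum_0 [simp]: "omission_sum (\<lambda>_. 0) s = 0"
  by (induction s) auto

lemma omission_sum_map: "omission_sum f (map h s) = omission_sum (\<lambda>t. f (map h t)) s"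
  by (induction s arbitrary: f) auto

lemma omission_sum_omission_sum: "omission_sum (omission_sum f) s = 0"
  by (induction s arbitrary: f) (auto simp: omission_sum_diff)

lemma omission_sum_alt_sum_swap:
  "omission_sum (\<lambda>t. alt_sum n (\<lambda>i. f i t)) s = alt_sum n (\<lambda>i. omission_sum (f i) s)"
  by (induction s arbitrary: f) (auto simp: alt_sum_diff)

lemma prism_cong:
  assumes "\<And>t. set t \<subseteq> a ` set s \<union> b ` set s \<Longrightarrow> length t = Suc (length s) \<Longrightarrow> f t = g t"
  shows "prism a b f s = prism a b g s"
  using assms
proof (induction s arbitrary: f g)
  case (Cons x s)
  have "prism a b (\<lambda>t. f (a x # t)) s = prism a b (\<lambda>t. g (a x # t)) s"
    by (rule Cons.IH, rule Cons.prems) auto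
  moreover have "f (a x # b x # map b s) = g (a x # b x # map b s)"
    by (rule Cons.prems) auto
  ultimately show ?case by simp
qed simp

lemma prism_in:
  assumes "0 \<in> S" "\<And>x y. x \<in> S \<Longrightarrow> y \<in> S \<Longrightarrow> x - y \<in> S"
    and "\<And>t. set t \<subseteq> a ` set s \<union> b ` set s \<Longrightarrow> length t = Suc (length s) \<Longrightarrow> f t \<in> S"
  shows "prism a b f s \<in> S"
  using assms(3)
proof (induction s arbitrary: f)
  case (Cons x s)
  have "prism a b (\<lambda>t. f (a x # t)) s \<in> S"
    by (rule Cons.IH, rule Cons.prems) auto
  moreover have "f (a x # b x # map b s) \<in> S"
    by (rule Cons.prems) auto
  ultimately show ?case by (simp add: assms)
qed (simp add: assms)

lemma prism_bound:
  fixes f :: "'c list \<Rightarrow> real" and B :: real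
  assumes "\<And>t. set t \<subseteq> a ` set s \<union> b ` set s \<Longrightarrow> length t = Suc (length s) \<Longrightarrow> \<bar>f t\<bar> \<le> B"
  shows "\<bar>prism a b f s\<bar> \<le> length s * B"
  using assms
proof (induction s arbitrary: f)
  case (Cons x s)
  have "\<bar>prism a b (\<lambda>t. f (a x # t)) s\<bar> \<le> length s * B"
    by (rule Cons.IH, rule Cons.prems) auto
  moreover have "\<bar>f (a x # b x # map b s)\<bar> \<le> B"
    by (rule Cons.prems) auto
  ultimately show ?case by (simp add: algebra_simps)
qed simp

lemma (in additive) prism: "f (prism a b g s) = prism a b (\<lambda>t. f (g t)) s"
  by (induction s arbitrary: g) (auto simp: zero diff)

lemma prism_diff: "prism a b (\<lambda>t. f t - g t) s = prism a b f s - prism a b g s"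
  by (induction s arbitrary: f g) auto

lemma prism_0 [simp]: "prism a b (\<lambda>_. 0) s = 0"
  by (induction s) auto

text \<open>If \<open>a\<close> and \<open>b\<close> commute with a translation, so does their prism operator. This is why the homotopies
  below respect orbits.\<close>

lemma prism_map:
  assumes "\<And>x. x \<in> set s \<Longrightarrow> a (h x) = k (a' x)" "\<And>x. x \<in> set s \<Longrightarrow> b (h x) = k (b' x)"
  shows "prism a b f (map h s) = prism a' b' (\<lambda>t. f (map k t)) s"
  using assms
proof (induction s arbitrary: f)
  case (Cons x s)
  have "map b (map h s) = map k (map b' s)" using Cons.prems by simp
  moreover have "a (h x) = k (a' x)" "b (h x) = k (b' x)" using Cons.prems by simp_all
  moreover have "prism a b (\<lambda>t. f (k (a' x) # t)) (map h s) = prism a' b' (\<lambda>t. f (k (a' x) # map k t)) s"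
    by (rule Cons.IH) (simp_all add: Cons.prems)
  ultimately show ?case by (simp only: prism.simps list.map)
qed simp

text \<open>In the recursion for the tuple \<open>(x, s)\<close>, the terms that start with \<open>a x\<close> form the same statement for
  \<open>s\<close>, and the others cancel except for the two outer faces.\<close>

lemma prism_homotopy:
  "omission_sum (prism a b f) s + prism a b (omission_sum f) s = f (map b s) - f (map a s)"
proof (induction s arbitrary: f)
  case (Cons x s)
  have "omission_sum (prism a b f) (x # s) = prism a b f s
      - (omission_sum (\<lambda>t. f (a x # b x # t)) (map b s) - omission_sum (prism a b (\<lambda>t. f (a x # t))) s)"
    by (simp add: omission_sum_diff omission_sum_map)
  moreover have "prism a b (omission_sum f) (x # s) =
      f (b x # map b s) - f (a x # map b s) + omission_sum (\<lambda>t. f (a x # b x # t)) (map b s)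
      - prism a b f s + prism a b (omission_sum (\<lambda>t. f (a x # t))) s"
    using prism_diff[of a b f "omission_sum (\<lambda>t. f (a x # t))" s] by (simp add: o_def)
  ultimately show ?case using Cons[of "\<lambda>t. f (a x # t)"]
    by (simp only: list.map) (simp add: algebra_simps)
qed simp

section \<open>Two diagram chases in double complexes\<close>

text \<open>\<open>C P j\<close> is the entry in column \<open>P\<close> and row \<open>j\<close>, \<open>d\<close> the vertical and \<open>h\<close> the horizontal
  differential. The squares commute, so that no signs are needed. The assumption \<open>vanish\<close> is the
  vanishing of the second page of the spectral sequence in the columns \<open>\<ge> 2\<close> and rows \<open>< q\<close>, spelled out
  for elements, and \<open>zero\<close> says that column \<open>2\<close> maps to column \<open>1\<close> by zero on homology in degree \<open>q\<close>.\<close>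

locale chain_double_complex =
  fixes C :: "nat \<Rightarrow> nat \<Rightarrow> 'c::ab_group_add set"
    and d :: "nat \<Rightarrow> nat \<Rightarrow> 'c \<Rightarrow> 'c"
    and h :: "nat \<Rightarrow> 'c \<Rightarrow> 'c"
    and q :: nat
  assumes C_diff: "x \<in> C P j \<Longrightarrow> y \<in> C P j \<Longrightarrow> x - y \<in> C P j"
    and d_diff: "d P j (x - y) = d P j x - d P j y"
    and h_diff: "h P (x - y) = h P x - h P y"
    and d_in: "x \<in> C P (Suc j) \<Longrightarrow> d P (Suc j) x \<in> C P j"
    and d_0: "d P 0 x = 0"
    and d_d: "x \<in> C P (Suc j) \<Longrightarrow> d P j (d P (Suc j) x) = 0"
    and h_in: "x \<in> C (Suc P) j \<Longrightarrow> h P x \<in> C P j"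
    and h_h: "x \<in> C (Suc (Suc P)) j \<Longrightarrow> h P (h (Suc P) x) = 0"
    and commute: "x \<in> C (Suc P) j \<Longrightarrow> d P j (h P x) = h P (d (Suc P) j x)"
    and exact0: "x \<in> C 0 j \<Longrightarrow> \<exists>y \<in> C (Suc 0) j. h 0 y = x"
    and exact: "P \<le> Suc q \<Longrightarrow> x \<in> C (Suc P) j \<Longrightarrow> h P x = 0 \<Longrightarrow>
          \<exists>y \<in> C (Suc (Suc P)) j. h (Suc P) y = x"
    and vanish: "j < q \<Longrightarrow> P \<le> q \<Longrightarrow> z \<in> C (Suc (Suc P)) j \<Longrightarrow> d (Suc (Suc P)) j z = 0 \<Longrightarrow>
          b \<in> C (Suc P) (Suc j) \<Longrightarrow> h (Suc P) z = d (Suc P) (Suc j) b \<Longrightarrow>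
          \<exists>e \<in> C (Suc (Suc (Suc P))) j. \<exists>f \<in> C (Suc (Suc P)) (Suc j).
            d (Suc (Suc (Suc P))) j e = 0 \<and> z = h (Suc (Suc P)) e + d (Suc (Suc P)) (Suc j) f"
    and zero: "z \<in> C (Suc (Suc 0)) q \<Longrightarrow> d (Suc (Suc 0)) q z = 0 \<Longrightarrow>
          \<exists>f \<in> C (Suc 0) (Suc q). h (Suc 0) z = d (Suc 0) (Suc q) f"
begin

lemma h_add: "h P (x + y) = h P x + h P y"
proof -
  have "h P (0 - y) = h P 0 - h P y" "h P (0 - 0) = h P 0 - h P 0" by (simp_all only: h_diff)
  then have "h P (- y) = - h P y" by simp
  then show ?thesis using h_diff[of P x "- y"] by simp
qed

lemma d_zero: "d P j 0 = 0"
  using d_diff[of P j 0 0] by simp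

lemma h_zero: "h P 0 = 0"
  using h_diff[of P 0 0] by simp

text \<open>The boundary \<open>d y\<close> comes from the next column, from a cycle \<open>z'\<close> by induction on the row. By
  \<open>vanish\<close>, \<open>z'\<close> is a sum of a horizontal and a vertical boundary. The horizontal part does not
  contribute to \<open>d y\<close>, and the image of the vertical part corrects \<open>y\<close>.\<close>

lemma replace_by_cycle:
  assumes "j \<le> q" "P + j \<le> Suc q" "y \<in> C (Suc P) j" "h P (d (Suc P) j y) = 0"
  shows "\<exists>y' \<in> C (Suc P) j. d (Suc P) j y' = 0 \<and> h P y' = h P y"
  using assms
proof (induction j arbitrary: P y)
  case 0
  then show ?case by (auto simp: d_0)
next
  case (Suc j)
  obtain z where z: "z \<in> C (Suc (Suc P)) j" "h (Suc P) z = d (Suc P) (Suc j) y"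
    using exact[of P "d (Suc P) (Suc j) y" j] Suc.prems d_in by auto
  have "h (Suc P) (d (Suc (Suc P)) j z) = 0"
    using commute[OF z(1)] z(2) d_d Suc.prems(3) by simp
  then obtain z' where z': "z' \<in> C (Suc (Suc P)) j" "d (Suc (Suc P)) j z' = 0"
      "h (Suc P) z' = d (Suc P) (Suc j) y"
    using Suc.IH[of "Suc P" z] Suc.prems z by auto
  then obtain e f where e: "e \<in> C (Suc (Suc (Suc P))) j" and f: "f \<in> C (Suc (Suc P)) (Suc j)"
    and z'_eq: "z' = h (Suc (Suc P)) e + d (Suc (Suc P)) (Suc j) f"
    using vanish[of j P z' y] Suc.prems by auto
  have "d (Suc P) (Suc j) y = d (Suc P) (Suc j) (h (Suc P) f)"
    using z'(3) h_h[OF e] commute[OF f] by (simp add: z'_eq h_add)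
  moreover have "h P (y - h (Suc P) f) = h P y"
    using h_h[OF f] by (simp add: h_diff)
  moreover have "y - h (Suc P) f \<in> C (Suc P) (Suc j)"
    using Suc.prems(3) h_in[OF f] by (rule C_diff)
  ultimately show ?case
    by (intro bexI[of _ "y - h (Suc P) f"]) (auto simp: d_diff)
qed

lemma surjective:
  assumes "c \<in> C 0 q" "d 0 q c = 0"
  shows "\<exists>y \<in> C (Suc 0) q. d (Suc 0) q y = 0 \<and> h 0 y = c"
proof -
  obtain y where y: "y \<in> C (Suc 0) q" "h 0 y = c" using exact0 assms by blast
  then show ?thesis
    using replace_by_cycle[of q 0 y] commute[OF y(1)] assms(2) by auto
qed

lemma injective:
  assumes x: "x \<in> C (Suc 0) q" "d (Suc 0) q x = 0"
    and b: "b \<in> C 0 (Suc q)" "h 0 x = d 0 (Suc q) b"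
  shows "\<exists>f \<in> C (Suc 0) (Suc q). x = d (Suc 0) (Suc q) f"
proof -
  obtain y where y: "y \<in> C (Suc 0) (Suc q)" "h 0 y = b" using exact0 b by blast
  have 1: "x - d (Suc 0) (Suc q) y \<in> C (Suc 0) q" using x y d_in C_diff by blast
  have "h 0 (x - d (Suc 0) (Suc q) y) = 0"
    using b(2) y(2) commute[OF y(1)] by (simp add: h_diff)
  with 1 obtain z where z: "z \<in> C (Suc (Suc 0)) q" "h (Suc 0) z = x - d (Suc 0) (Suc q) y"
    using exact[of 0] by auto
  have "h (Suc 0) (d (Suc (Suc 0)) q z) = 0"
    using commute[OF z(1)] z(2) x(2) d_d[OF y(1)] by (simp add: d_diff)
  then obtain z' where z': "z' \<in> C (Suc (Suc 0)) q" "d (Suc (Suc 0)) q z' = 0" "h (Suc 0) z' = h (Suc 0) z"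
    using replace_by_cycle[of q "Suc 0" z] z by auto
  then obtain f where f: "f \<in> C (Suc 0) (Suc q)" "h (Suc 0) z' = d (Suc 0) (Suc q) f"
    using zero by blast
  have eq: "x = d (Suc 0) (Suc q) f - d (Suc 0) (Suc q) (0 - y)"
    using f z' z d_diff[of "Suc 0" "Suc q" 0 y] by (simp add: d_zero algebra_simps)
  have "0 - y \<in> C (Suc 0) (Suc q)" using C_diff[OF C_diff[OF y(1) y(1)] y(1)] by simp
  with f(1) have "f - (0 - y) \<in> C (Suc 0) (Suc q)" by (rule C_diff)
  moreover have "x = d (Suc 0) (Suc q) (f - (0 - y))" using eq by (simp only: d_diff)
  ultimately show ?thesis by blast
qed

end

text \<open>The dual of the previous setting. The vertical coboundaries \<open>B P j\<close> are a parameter because they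
  are zero in row \<open>0\<close>, which has no predecessor.\<close>

locale cochain_double_complex =
  fixes C :: "nat \<Rightarrow> nat \<Rightarrow> 'c::ab_group_add set"
    and d :: "nat \<Rightarrow> nat \<Rightarrow> 'c \<Rightarrow> 'c"
    and h :: "nat \<Rightarrow> 'c \<Rightarrow> 'c"
    and B :: "nat \<Rightarrow> nat \<Rightarrow> 'c set"
    and q :: nat
  assumes C_diff: "x \<in> C P j \<Longrightarrow> y \<in> C P j \<Longrightarrow> x - y \<in> C P j"
    and d_diff: "d P j (x - y) = d P j x - d P j y"
    and h_diff: "h P (x - y) = h P x - h P y"
    and d_in: "x \<in> C P j \<Longrightarrow> d P j x \<in> C P (Suc j)"
    and d_d: "x \<in> C P j \<Longrightarrow> d P (Suc j) (d P j x) = 0"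
    and B_0: "B P 0 = {0}"
    and B_Suc: "B P (Suc j) = d P j ` C P j"
    and C_nonempty: "C P j \<noteq> {}"
    and h_in: "x \<in> C P j \<Longrightarrow> h P x \<in> C (Suc P) j"
    and h_h: "x \<in> C P j \<Longrightarrow> h (Suc P) (h P x) = 0"
    and commute: "x \<in> C P j \<Longrightarrow> d (Suc P) j (h P x) = h P (d P j x)"
    and exact0: "x \<in> C 0 j \<Longrightarrow> h 0 x = 0 \<Longrightarrow> x = 0"
    and exact: "P \<le> q \<Longrightarrow> x \<in> C (Suc P) j \<Longrightarrow> h (Suc P) x = 0 \<Longrightarrow> \<exists>y \<in> C P j. h P y = x"
    and vanish: "j < q \<Longrightarrow> P \<le> q \<Longrightarrow> z \<in> C (Suc (Suc P)) j \<Longrightarrow> d (Suc (Suc P)) j z = 0 \<Longrightarrow>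
          h (Suc (Suc P)) z = 0 \<Longrightarrow>
          \<exists>e \<in> C (Suc P) j. d (Suc P) j e = 0 \<and> z - h (Suc P) e \<in> B (Suc (Suc P)) j"
    and zero: "z \<in> C (Suc 0) q \<Longrightarrow> d (Suc 0) q z = 0 \<Longrightarrow> h (Suc 0) z \<in> B (Suc (Suc 0)) q"
begin

lemma d_zero: "d P j 0 = 0"
  using d_diff[of P j 0 0] by simp

lemma h_zero: "h P 0 = 0"
  using h_diff[of P 0 0] by simp

lemma C_0: "0 \<in> C P j"
proof -
  obtain x where "x \<in> C P j" using C_nonempty by blast
  from C_diff[OF this this] show ?thesis by simp
qed

lemma B_C: "v \<in> B P j \<Longrightarrow> v \<in> C P j"
  by (cases j) (auto simp: B_0 B_Suc C_0 d_in)

lemma d_B: "v \<in> B P j \<Longrightarrow> d P j v = 0"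
  by (cases j) (auto simp: B_0 B_Suc d_zero d_d)

text \<open>The dual of \<open>replace_by_cycle\<close>: by \<open>vanish\<close>, a primitive \<open>y\<close> of \<open>h u\<close> can be modified by a cocycle
  such that \<open>h y\<close> becomes a coboundary; induction on the row and exactness then replace \<open>y\<close> by a
  primitive that comes from column \<open>P\<close>.\<close>

lemma coboundary_lift:
  assumes "j \<le> q" "P + j \<le> Suc q" "u \<in> C P j" "h P u \<in> B (Suc P) j"
  shows "\<exists>v \<in> B P j. h P u = h P v"
  using assms
proof (induction j arbitrary: P u)
  case 0
  then show ?case by (auto simp: B_0 h_zero)
next
  case (Suc j)
  obtain y where y: "y \<in> C (Suc P) j" "h P u = d (Suc P) j y"
    using Suc.prems by (auto simp: B_Suc)
  have z: "h (Suc P) y \<in> C (Suc (Suc P)) j" using y h_in by blast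
  have "d (Suc (Suc P)) j (h (Suc P) y) = h (Suc P) (h P u)"
    using commute[OF y(1)] y(2) by simp
  then have "d (Suc (Suc P)) j (h (Suc P) y) = 0" using h_h Suc.prems by simp
  then obtain e where e: "e \<in> C (Suc P) j" "d (Suc P) j e = 0"
      "h (Suc P) y - h (Suc P) e \<in> B (Suc (Suc P)) j"
    using vanish[of j P "h (Suc P) y"] Suc.prems z h_h[OF y(1)] by auto
  then obtain v where v: "v \<in> B (Suc P) j" "h (Suc P) (y - e) = h (Suc P) v"
    using Suc.IH[of "Suc P" "y - e"] Suc.prems C_diff[OF y(1) e(1)] by (auto simp: h_diff)
  have "h (Suc P) (y - e - v) = 0" using v(2) by (simp add: h_diff)
  moreover have "y - e - v \<in> C (Suc P) j" by (intro C_diff y e B_C v)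
  ultimately obtain t where t: "t \<in> C P j" "h P t = y - e - v"
    using exact[of P "y - e - v" j] Suc.prems by auto
  have "h P (d P j t) = d (Suc P) j (y - e - v)" using commute[OF t(1)] t(2) by simp
  also have "\<dots> = h P u" using y(2) e(2) d_B[OF v(1)] by (simp add: d_diff)
  finally have "h P u = h P (d P j t)" ..
  moreover have "d P j t \<in> B P (Suc j)" using t(1) by (simp add: B_Suc)
  ultimately show ?case by blast
qed

lemma injective:
  assumes "c \<in> C 0 q" "h 0 c \<in> B (Suc 0) q"
  shows "c \<in> B 0 q"
proof -
  have "\<exists>v \<in> B 0 q. h 0 c = h 0 v" by (rule coboundary_lift) (simp_all add: assms)
  then obtain v where v: "v \<in> B 0 q" "h 0 c = h 0 v" by blast
  have "c - v = 0"
    by (rule exact0[OF C_diff[OF assms(1) B_C[OF v(1)]]]) (simp add: h_diff v(2))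
  then show ?thesis using v by simp
qed

lemma surjective:
  assumes x: "x \<in> C (Suc 0) q" "d (Suc 0) q x = 0"
  shows "\<exists>c \<in> C 0 q. d 0 q c = 0 \<and> x - h 0 c \<in> B (Suc 0) q"
proof -
  have "\<exists>v \<in> B (Suc 0) q. h (Suc 0) x = h (Suc 0) v"
    by (rule coboundary_lift) (simp_all add: zero x)
  then obtain v where v: "v \<in> B (Suc 0) q" "h (Suc 0) x = h (Suc 0) v" by blast
  have "x - v \<in> C (Suc 0) q" by (rule C_diff[OF x(1) B_C[OF v(1)]])
  then obtain c where c: "c \<in> C 0 q" "h 0 c = x - v"
    using exact[of 0 "x - v" q] v(2) by (auto simp: h_diff)
  have "h 0 (d 0 q c) = 0" using commute[OF c(1)] c(2) x(2) d_B[OF v(1)] by (simp add: d_diff)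
  then have "d 0 q c = 0" by (rule exact0[OF d_in[OF c(1)]])
  moreover have "x - h 0 c = v" using c by simp
  ultimately show ?thesis using c(1) v(1) by (intro bexI[of _ c]) simp_all
qed

end

section \<open>Homogeneous and inhomogeneous tuples\<close>

text \<open>For a homogeneous tuple, this is the bar symbol of its orbit under left translation. Conversely,
  \<open>partial_products G u s\<close> is the tuple with first entry \<open>u\<close> in the orbit with bar symbol \<open>s\<close>.\<close>

fun quotients :: "('g, 'm) monoid_scheme \<Rightarrow> 'g list \<Rightarrow> 'g list" where
  "quotients G (x # y # s) = (inv\<^bsub>G\<^esub> x \<otimes>\<^bsub>G\<^esub> y) # quotients G (y # s)"
| "quotients G _ = []"

fun partial_products :: "('g, 'm) monoid_scheme \<Rightarrow> 'g \<Rightarrow> 'g list \<Rightarrow> 'g list" where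
  "partial_products G u [] = [u]"
| "partial_products G u (g # s) = u # partial_products G (u \<otimes>\<^bsub>G\<^esub> g) s"

lemma length_quotients [simp]: "length (quotients G x) = length x - 1"
  by (induction G x rule: quotients.induct) auto

lemma nth_quotients:
  "Suc i < length x \<Longrightarrow> quotients G x ! i = inv\<^bsub>G\<^esub> (x ! i) \<otimes>\<^bsub>G\<^esub> x ! Suc i"
proof (induction G x arbitrary: i rule: quotients.induct)
  case (1 G x y s)
  then show ?case by (cases i) auto
qed auto

lemma length_partial_products [simp]: "length (partial_products G u s) = Suc (length s)"
  by (induction s arbitrary: u) auto

lemma hd_partial_products [simp]: "hd (partial_products G u s) = u"
  by (cases s) auto

lemma partial_products_neq_Nil [simp]: "partial_products G u s \<noteq> []"
  by (cases s) auto

context group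
begin

lemma set_quotients:
  "set x \<subseteq> carrier G \<Longrightarrow> set (quotients G x) \<subseteq> carrier G"
  by (induction x rule: induct_list012) auto

lemma set_partial_products:
  "u \<in> carrier G \<Longrightarrow> set s \<subseteq> carrier G \<Longrightarrow> set (partial_products G u s) \<subseteq> carrier G"
  by (induction s arbitrary: u) auto

lemma quotients_map:
  assumes "g \<in> carrier G" "set x \<subseteq> carrier G"
  shows "quotients G (map (\<lambda>z. g \<otimes> z) x) = quotients G x"
  using assms(2)
proof (induction x rule: induct_list012)
  case (3 x y s)
  then show ?case using assms(1)
    by (simp add: inv_mult_group m_assoc inv_solve_left')
qed auto

lemma quotients_partial_products:
  assumes "u \<in> carrier G" "set s \<subseteq> carrier G"
  shows "quotients G (partial_products G u s) = s"
  using assms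
proof (induction s arbitrary: u)
  case (Cons g s)
  then have "quotients G (partial_products G u (g # s))
      = (inv u \<otimes> (u \<otimes> g)) # quotients G (partial_products G (u \<otimes> g) s)"
    by (cases s) auto
  then show ?case using Cons by (simp add: m_assoc[symmetric])
qed auto

lemma partial_products_quotients:
  assumes "set (u # x) \<subseteq> carrier G"
  shows "partial_products G u (quotients G (u # x)) = u # x"
  using assms
proof (induction x arbitrary: u)
  case (Cons y x)
  then show ?case by (simp add: m_assoc[symmetric])
qed simp

lemma partial_products_mult:
  assumes "g \<in> carrier G" "u \<in> carrier G" "set s \<subseteq> carrier G"
  shows "partial_products G (g \<otimes> u) s = map (\<lambda>z. g \<otimes> z) (partial_products G u s)"
  using assms by (induction s arbitrary: u) (auto simp: m_assoc)

lemma partial_products_one_quotients: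
  assumes "set x \<subseteq> carrier G" "x \<noteq> []"
  shows "partial_products G \<one> (quotients G x) = map (\<lambda>z. inv (hd x) \<otimes> z) x"
proof -
  obtain u t where x: "x = u # t" using assms by (cases x) auto
  have "partial_products G (inv u \<otimes> u) (quotients G x)
      = map (\<lambda>z. inv u \<otimes> z) (partial_products G u (quotients G x))"
    using assms x set_quotients[OF assms(1)] by (intro partial_products_mult) auto
  then show ?thesis using assms x partial_products_quotients[of u t] by simp
qed

end

text \<open>In homogeneous coordinates the faces of the nerve just omit an entry, so that the boundary in the
  nerve is an omission sum.\<close>

lemma nerve_face_quotients:
  fixes G :: "'g monoid" (structure)
  assumes "group G"
    and x: "set x \<subseteq> carrier G" "length x = Suc (Suc k)" and i: "i \<le> Suc k"
  shows "face (nerve G) k i (quotients G x) = quotients G (take i x @ drop (Suc i) x)"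
proof (rule nth_equalityI)
  interpret group G by fact
  have l: "length (quotients G x) = Suc k" by (simp add: x)
  show "length (face (nerve G) k i (quotients G x)) = length (quotients G (take i x @ drop (Suc i) x))"
    using i l by (auto simp: nerve_def x min_def)
  fix n assume "n < length (face (nerve G) k i (quotients G x))"
  then have n: "n < k" using i l by (auto simp: nerve_def min_def split: if_splits)
  have m: "(inv a \<otimes> b) \<otimes> (inv b \<otimes> c) = inv a \<otimes> c"
    if "a \<in> carrier G" "b \<in> carrier G" "c \<in> carrier G" for a b c
    using that by (simp add: m_assoc) (simp add: m_assoc[symmetric])
  have c: "x ! m \<in> carrier G" if "m < Suc (Suc k)" for m
    using x that by (metis nth_mem subset_iff)
  show "face (nerve G) k i (quotients G x) ! n = quotients G (take i x @ drop (Suc i) x) ! n"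
  proof -
    note [simp] = nth_quotients x(2)
    consider "i = 0" | "i = Suc k" | "0 < i" "i \<le> k" "Suc n < i" | "0 < i" "i \<le> k" "Suc n = i"
      | "0 < i" "i \<le> k" "i \<le> n"
      using i by linarith
    then show ?thesis
    proof cases
      case 1
      then show ?thesis using n by (simp add: nerve_def nth_tl)
    next
      case 2
      then show ?thesis using n by (simp add: nerve_def nth_butlast nth_append)
    next
      case 3
      then have "n < i - 1" by simp
      then show ?thesis using 3 n by (simp add: nerve_def nth_append)
    next
      case 4
      then show ?thesis using n m[OF c[of n] c[of "Suc n"] c[of "Suc (Suc n)"]]
        by (auto simp: nerve_def nth_append)
    next
      case 5
      obtain i' where i': "i = Suc i'" using \<open>0 < i\<close> by (cases i) auto
      obtain t where t: "n = i + t" using \<open>i \<le> n\<close> le_Suc_ex by blast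
      have k: "Suc (i' + t) < k" "i' < k" using n i' t by auto
      define s where "s = quotients G x"
      have "length s = Suc k" by (simp add: s_def x(2))
      then have 1: "(take i' s @ z # drop (Suc (Suc i')) s) ! Suc (i' + t) = s ! Suc (Suc (i' + t))" for z
        using k by (simp add: nth_append)
      have "(take (Suc i') x @ drop (Suc (Suc i')) x) ! Suc (i' + t) = x ! Suc (Suc (i' + t))"
        "(take (Suc i') x @ drop (Suc (Suc i')) x) ! Suc (Suc (i' + t)) = x ! Suc (Suc (Suc (i' + t)))"
        using k x(2) by (simp_all add: nth_append)
      moreover have "face (nerve G) k i s = take i' s @ (s ! i' \<otimes> s ! Suc i') # drop (Suc (Suc i')) s"
        using k by (simp add: nerve_def i')
      ultimately show ?thesis using 1 k unfolding s_def i' t by (simp add: s_def)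
    qed
  qed
qed

section \<open>The bar complex of a group action\<close>

text \<open>The form in which a homotopy formula passes to differences of chains.\<close>

lemma diff_of_equations:
  fixes a :: "'a::ab_group_add"
  assumes "a + b = c - e" "a' + b' = c' - e'"
  shows "(a - a') + (b - b') = (c - c') - (e - e')"
proof -
  have "(a - a') + (b - b') = (a + b) - (a' + b')" by (simp add: algebra_simps)
  then show ?thesis by (simp add: assms)
qed

definition frags :: "'b set \<Rightarrow> ('b \<Rightarrow>\<^sub>0 int) set" where
  "frags K = {c. Poly_Mapping.keys c \<subseteq> K}"

lemma frags_0 [simp]: "0 \<in> frags K"
  by (simp add: frags_def)

lemma frags_diff: "x \<in> frags K \<Longrightarrow> y \<in> frags K \<Longrightarrow> x - y \<in> frags K"
  using keys_diff[of x y] by (auto simp: frags_def)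

lemma frags_minus: "x \<in> frags K \<Longrightarrow> - x \<in> frags K"
  using frags_diff[of 0 K x] by simp

lemma frags_add: "x \<in> frags K \<Longrightarrow> y \<in> frags K \<Longrightarrow> x + y \<in> frags K"
  using frags_diff[of x K "- y"] frags_minus[of y K] by simp

lemma frag_of_in_frags [simp]: "frag_of x \<in> frags K \<longleftrightarrow> x \<in> K"
  by (simp add: frags_def)

lemma frags_mono: "K \<subseteq> L \<Longrightarrow> frags K \<subseteq> frags L"
  by (auto simp: frags_def)

lemma chains_eq_frags: "chains X k = frags (simplices X k)"
  by (simp add: chains_def frags_def)

lemma frag_extend_in_frags:
  assumes "c \<in> frags K" "\<And>x. x \<in> K \<Longrightarrow> f x \<in> frags L"
  shows "frag_extend f c \<in> frags L"
  using assms keys_frag_extend[of f c] by (fastforce simp: frags_def)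

lemma frags_induct [consumes 1, case_names zero generator diff]:
  assumes "c \<in> frags K" "P 0" "\<And>x. x \<in> K \<Longrightarrow> P (frag_of x)" "\<And>a b. P a \<Longrightarrow> P b \<Longrightarrow> P (a - b)"
  shows "P c"
  using frag_induction[of c K P] assms by (simp add: frags_def)

lemma additive_frag_extend: "additive (frag_extend f)"
  by unfold_locales (rule frag_extend_add)

lemma boundary_eq_frag_extend:
  "boundary X k = frag_extend (\<lambda>x. alt_sum (Suc k) (\<lambda>i. frag_of (face X k i x)))"
proof (rule ext)
  fix c :: "'a \<Rightarrow>\<^sub>0 int"
  have *: "Poly_Mapping.single y ((- 1) ^ i * a) = frag_cmul a (signed i (frag_of y))"
    for y :: 'a and a :: int and i :: nat
    by (rule poly_mapping_eqI) (auto simp: signed_def lookup_single when_def)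
  show "boundary X k c = frag_extend (\<lambda>x. alt_sum (Suc k) (\<lambda>i. frag_of (face X k i x))) c"
    unfolding boundary_def frag_extend_def alt_sum_def * by (simp add: frag_cmul_sum o_def del: sum.atMost_Suc)
qed

text \<open>The normal form of the \<open>G\<close>-orbit of \<open>(x, y)\<close> for the diagonal action: its representative whose
  tuple starts with \<open>1\<close>, with the tuple written inhomogeneously. The bar complex with coefficients in
  the permutation module of \<open>Y\<close> has these normal forms as a basis.\<close>

definition bar_symbol :: "'g monoid \<Rightarrow> ('g \<Rightarrow> 'y \<Rightarrow> 'y) \<Rightarrow> 'g list \<Rightarrow> 'y \<Rightarrow> 'g list \<times> 'y" where
  "bar_symbol G act x y = (quotients G x, act (inv\<^bsub>G\<^esub> hd x) y)"

definition bar_chains :: "'g monoid \<Rightarrow> 'y set \<Rightarrow> nat \<Rightarrow> ('g list \<times> 'y \<Rightarrow>\<^sub>0 int) set" where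
  "bar_chains G Y j = frags (tuples G j \<times> Y)"

definition bar_boundary ::
    "'g monoid \<Rightarrow> ('g \<Rightarrow> 'y \<Rightarrow> 'y) \<Rightarrow> nat \<Rightarrow> ('g list \<times> 'y \<Rightarrow>\<^sub>0 int) \<Rightarrow> ('g list \<times> 'y \<Rightarrow>\<^sub>0 int)" where
  "bar_boundary G act j =
     (if j = 0 then (\<lambda>_. 0)
      else frag_extend (\<lambda>(s, y). omission_sum (\<lambda>x. frag_of (bar_symbol G act x y))
                                    (partial_products G \<one>\<^bsub>G\<^esub> s)))"

lemma bar_boundary_0 [simp]: "bar_boundary G act 0 c = 0"
  by (simp add: bar_boundary_def)

lemma bar_boundary_zero [simp]: "bar_boundary G act j 0 = 0"
  by (simp add: bar_boundary_def)

lemma bar_boundary_diff: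
  "bar_boundary G act j (x - y) = bar_boundary G act j x - bar_boundary G act j y"
  by (simp add: bar_boundary_def frag_extend_diff)

lemma tuplesD: "x \<in> tuples G n \<Longrightarrow> length x = n" "x \<in> tuples G n \<Longrightarrow> set x \<subseteq> carrier G"
  by (simp_all add: tuples_def)

lemma tuples_Suc_neq_Nil: "x \<in> tuples G (Suc n) \<Longrightarrow> x \<noteq> []"
  by (auto simp: tuples_def)

locale gset = group G for G :: "'g monoid" (structure) +
  fixes Y :: "'y set" and act :: "'g \<Rightarrow> 'y \<Rightarrow> 'y"
  assumes act_in: "g \<in> carrier G \<Longrightarrow> y \<in> Y \<Longrightarrow> act g y \<in> Y"
    and act_one: "y \<in> Y \<Longrightarrow> act \<one> y = y"
    and act_mult: "g \<in> carrier G \<Longrightarrow> h \<in> carrier G \<Longrightarrow> y \<in> Y \<Longrightarrow> act (g \<otimes> h) y = act g (act h y)"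
begin

abbreviation "bd \<equiv> bar_boundary G act"
abbreviation "BC \<equiv> bar_chains G Y"
abbreviation "symb y x \<equiv> frag_of (bar_symbol G act x y)"
abbreviation "pp \<equiv> partial_products G \<one>"

lemma act_inv_act: "g \<in> carrier G \<Longrightarrow> y \<in> Y \<Longrightarrow> act (inv g) (act g y) = y"
  by (metis act_mult act_one inv_closed l_inv)

lemma act_act_inv: "g \<in> carrier G \<Longrightarrow> y \<in> Y \<Longrightarrow> act g (act (inv g) y) = y"
  by (metis act_mult act_one inv_closed r_inv)

lemma hd_in: "set x \<subseteq> carrier G \<Longrightarrow> x \<noteq> [] \<Longrightarrow> hd x \<in> carrier G"
  by (cases x) auto

lemma bar_symbol_in:
  assumes "x \<in> tuples G (Suc j)" "y \<in> Y"
  shows "bar_symbol G act x y \<in> tuples G j \<times> Y"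
  using assms set_quotients[of x] hd_in[of x] tuples_Suc_neq_Nil[of x G j]
  by (auto simp: bar_symbol_def tuples_def intro!: act_in)

lemma bar_symbol_mult:
  assumes "set x \<subseteq> carrier G" "x \<noteq> []" "g \<in> carrier G" "y \<in> Y"
  shows "bar_symbol G act (map ((\<otimes>) g) x) (act g y) = bar_symbol G act x y"
proof -
  have "act (inv (g \<otimes> hd x)) (act g y) = act (inv (hd x)) y"
    using hd_in[OF assms(1,2)] assms(3,4)
    by (simp add: inv_mult_group act_mult act_in act_inv_act)
  then show ?thesis
    using assms by (simp add: bar_symbol_def quotients_map hd_map)
qed

lemma bar_symbol_partial_products:
  assumes "set s \<subseteq> carrier G" "y \<in> Y"
  shows "bar_symbol G act (pp s) y = (s, y)"
  using assms by (simp add: bar_symbol_def quotients_partial_products act_one)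

lemma partial_products_one_in: "s \<in> tuples G j \<Longrightarrow> pp s \<in> tuples G (Suc j)"
  using set_partial_products[of \<one> s] by (auto simp: tuples_def)

lemma bar_chains_induct [consumes 1, case_names zero symbol diff]:
  assumes "c \<in> BC j" "P 0"
    and "\<And>x y. x \<in> tuples G (Suc j) \<Longrightarrow> y \<in> Y \<Longrightarrow> P (symb y x)"
    and "\<And>a b. P a \<Longrightarrow> P b \<Longrightarrow> P (a - b)"
  shows "P c"
  using assms(1) unfolding bar_chains_def
proof (induction rule: frags_induct)
  case (generator p)
  then obtain s y where "p = (s, y)" "s \<in> tuples G j" "y \<in> Y" by auto
  then show ?case
    using assms(3)[OF partial_products_one_in] bar_symbol_partial_products tuplesD by metis
qed (use assms in auto)

text \<open>An invariant function on pairs can be evaluated on a bar symbol through any representative. The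
  operators on bar chains are defined on normal forms and computed on all pairs by this lemma.\<close>

lemma extend_bar_symbol:
  assumes inv: "\<And>g. g \<in> carrier G \<Longrightarrow> f (map ((\<otimes>) g) x) (act g y) = f x y"
    and "x \<in> tuples G (Suc j)" "y \<in> Y"
  shows "frag_extend (\<lambda>(s, y). f (pp s) y) (symb y x) = f x y"
proof -
  have x: "set x \<subseteq> carrier G" "x \<noteq> []"
    using assms(2) tuplesD tuples_Suc_neq_Nil by blast+
  have "frag_extend (\<lambda>(s, y). f (pp s) y) (symb y x)
      = f (map (\<lambda>z. inv (hd x) \<otimes> z) x) (act (inv (hd x)) y)"
    using x by (simp add: bar_symbol_def partial_products_one_quotients)
  then show ?thesis using inv[of "inv (hd x)"] hd_in[OF x] by simp
qed

lemma bar_boundary_symbol: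
  assumes x: "x \<in> tuples G (Suc (Suc j))" and y: "y \<in> Y"
  shows "bd (Suc j) (symb y x)
       = omission_sum (symb y) x"
proof -
  have "omission_sum (\<lambda>t. symb (act g y) t) (map ((\<otimes>) g) x)
      = omission_sum (symb y) x" if g: "g \<in> carrier G" for g
    unfolding omission_sum_map
  proof (rule omission_sum_cong)
    fix t assume t: "set t \<subseteq> set x" "Suc (length t) = length x"
    then have "set t \<subseteq> carrier G" "t \<noteq> []" using x by (auto simp: tuples_def)
    then show "symb (act g y) (map ((\<otimes>) g) t) = symb y t"
      using bar_symbol_mult g y by simp
  qed
  from extend_bar_symbol[of "\<lambda>x y. omission_sum (symb y) x", OF this x y]
  show ?thesis by (simp add: bar_boundary_def)
qed

lemma bar_boundary_in:
  "c \<in> BC (Suc j) \<Longrightarrow> bd (Suc j) c \<in> BC j"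
proof (induction c rule: bar_chains_induct)
  case (symbol x y)
  have "omission_sum (symb y) x \<in> BC j"
    unfolding bar_chains_def
  proof (rule omission_sum_in[OF frags_0 frags_diff])
    fix t assume "set t \<subseteq> set x" "Suc (length t) = length x"
    then have "t \<in> tuples G (Suc j)" using symbol by (auto simp: tuples_def)
    then show "symb y t \<in> frags (tuples G j \<times> Y)"
      using bar_symbol_in symbol by simp
  qed
  then show ?case using bar_boundary_symbol symbol by simp
qed (auto simp: bar_boundary_diff bar_chains_def frags_diff)

lemma bar_boundary_boundary:
  "c \<in> BC (Suc j) \<Longrightarrow> bd j (bd (Suc j) c) = 0"
proof (induction c rule: bar_chains_induct)
  case (symbol x y)
  show ?case
  proof (cases j)
    case (Suc i)
    interpret additive "bd j"
      unfolding bar_boundary_def using Suc by (simp add: additive_frag_extend)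
    have "bd j (bd (Suc j) (symb y x))
        = omission_sum (\<lambda>t. bd j (symb y t)) x"
      using symbol by (simp add: bar_boundary_symbol omission_sum)
    also have "\<dots> = omission_sum (omission_sum (symb y)) x"
      using symbol Suc by (intro omission_sum_cong bar_boundary_symbol[of _ i, folded Suc])
        (auto simp: tuples_def)
    finally show ?thesis by (simp add: omission_sum_omission_sum)
  qed simp
qed (auto simp: bar_boundary_diff)

end

lemma nerve_boundary_quotients:
  fixes G :: "'g monoid"
  assumes "group G" and x: "x \<in> tuples G (Suc (Suc k))"
  shows "boundary (nerve G) k (frag_of (quotients G x)) = omission_sum (\<lambda>t. frag_of (quotients G t)) x"
proof -
  obtain u s where us: "x = u # s" "length s = Suc k"
    using x by (cases x) (auto simp: tuples_def)
  have "boundary (nerve G) k (frag_of (quotients G x))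
      = alt_sum (Suc k) (\<lambda>i. frag_of (face (nerve G) k i (quotients G x)))"
    by (simp add: boundary_eq_frag_extend)
  also have "\<dots> = alt_sum (Suc k) (\<lambda>i. frag_of (quotients G (take i x @ drop (Suc i) x)))"
    using nerve_face_quotients[OF assms(1)] x by (intro alt_sum_cong) (simp add: tuples_def)
  finally show ?thesis by (simp only: us omission_sum_alt_sum)
qed

section \<open>Shapiro's lemma\<close>

text \<open>Subgroup inclusion for group records: the multiplications need only agree on the smaller carrier, as
  is the case for the members of a tower.\<close>

definition subgroup_of :: "'g monoid \<Rightarrow> 'g monoid \<Rightarrow> bool" where
  "subgroup_of K G \<longleftrightarrow> group K \<and> carrier K \<subseteq> carrier G \<and>
     (\<forall>x \<in> carrier K. \<forall>y \<in> carrier K. x \<otimes>\<^bsub>K\<^esub> y = x \<otimes>\<^bsub>G\<^esub> y)"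

lemma subgroup_of_in: "subgroup_of K G \<Longrightarrow> x \<in> carrier K \<Longrightarrow> x \<in> carrier G"
  by (auto simp: subgroup_of_def)

lemma subgroup_of_tuples: "subgroup_of K G \<Longrightarrow> x \<in> tuples K n \<Longrightarrow> x \<in> tuples G n"
  by (auto simp: subgroup_of_def tuples_def)

lemma subgroup_of_mult:
  "subgroup_of K G \<Longrightarrow> x \<in> carrier K \<Longrightarrow> y \<in> carrier K \<Longrightarrow> x \<otimes>\<^bsub>G\<^esub> y = x \<otimes>\<^bsub>K\<^esub> y"
  by (auto simp: subgroup_of_def)

lemma subgroup_of_one:
  assumes "subgroup_of K G" "group G"
  shows "\<one>\<^bsub>K\<^esub> = \<one>\<^bsub>G\<^esub>"
proof -
  interpret G: group G by fact
  interpret K: group K using assms by (simp add: subgroup_of_def)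
  have "\<one>\<^bsub>K\<^esub> \<otimes>\<^bsub>G\<^esub> \<one>\<^bsub>K\<^esub> = \<one>\<^bsub>K\<^esub>" using subgroup_of_mult[OF assms(1)] by simp
  then show ?thesis using subgroup_of_in[OF assms(1) K.one_closed] G.l_cancel_one by blast
qed

lemma subgroup_of_inv:
  assumes "subgroup_of K G" "group G" "x \<in> carrier K"
  shows "inv\<^bsub>G\<^esub> x = inv\<^bsub>K\<^esub> x"
proof -
  interpret G: group G by fact
  interpret K: group K using assms by (simp add: subgroup_of_def)
  have "inv\<^bsub>K\<^esub> x \<otimes>\<^bsub>G\<^esub> x = \<one>\<^bsub>G\<^esub>"
    using subgroup_of_mult[OF assms(1)] subgroup_of_one[OF assms(1,2)] assms(3) by simp
  then show ?thesis using subgroup_of_in[OF assms(1)] assms(3) by (intro G.inv_equality) auto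
qed

lemma subgroup_of_boundary:
  fixes c :: "'g list \<Rightarrow>\<^sub>0 int"
  assumes K: "subgroup_of K G" and c: "c \<in> chains (nerve K) (Suc k)"
  shows "boundary (nerve K) k c = boundary (nerve G) k c"
  unfolding boundary_eq_frag_extend
proof (intro frag_extend_eq alt_sum_cong arg_cong[where f = frag_of])
  fix s i assume "s \<in> Poly_Mapping.keys c" and i: "i \<le> Suc k"
  then have "s \<in> tuples K (Suc k)" using c by (auto simp: chains_def nerve_def)
  then have s: "s ! m \<in> carrier K" if "m < Suc k" for m
    using that by (auto simp: tuples_def)
  show "face (nerve K) k i s = face (nerve G) k i s"
    using i subgroup_of_mult[OF K s s, of "i - 1" i] by (auto simp: nerve_def)
qed

lemma cycles_Suc_subgroup_of:
  assumes "subgroup_of K G"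
  shows "cycles (nerve K) (Suc k) = {c \<in> chains (nerve K) (Suc k). boundary (nerve G) k c = 0}"
  using subgroup_of_boundary[OF assms] by (auto simp: cycles_def)

lemma boundaries_subgroup_of:
  assumes "subgroup_of K G"
  shows "boundaries (nerve K) k = boundary (nerve G) k ` chains (nerve K) (Suc k)"
  using subgroup_of_boundary[OF assms] by (auto simp: boundaries_def image_iff)

lemma chains_nerve: "chains (nerve K) j = frags (tuples K j)"
  by (simp add: chains_eq_frags nerve_def)

lemma boundary_diff: "boundary X k (a - b) = boundary X k a - (boundary X k b :: _ \<Rightarrow>\<^sub>0 int)"
  by (simp add: boundary_eq_frag_extend frag_extend_diff)

lemma boundary_0 [simp]: "boundary X k 0 = (0 :: _ \<Rightarrow>\<^sub>0 int)"
  by (simp add: boundary_eq_frag_extend)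

lemma nerve_chains_induct [consumes 2, case_names zero symbol diff]:
  assumes K: "group K"
    and "c \<in> chains (nerve K) j" "P 0"
    and "\<And>x. x \<in> tuples K (Suc j) \<Longrightarrow> P (frag_of (quotients K x))"
    and "\<And>a b. P a \<Longrightarrow> P b \<Longrightarrow> P (a - b)"
  shows "P c"
  using assms(2) unfolding chains_nerve
proof (induction rule: frags_induct)
  case (generator s)
  interpret group K by fact
  have "partial_products K \<one>\<^bsub>K\<^esub> s \<in> tuples K (Suc j)"
    using generator set_partial_products[of "\<one>\<^bsub>K\<^esub>" s] by (auto simp: tuples_def)
  then show ?case
    using assms(4) quotients_partial_products[of "\<one>\<^bsub>K\<^esub>" s] generator by (fastforce simp: tuples_def)
qed (use assms in auto)

lemma subgroup_of_quotients:
  assumes "subgroup_of K G" "group G" "set x \<subseteq> carrier K"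
  shows "quotients K x = quotients G x"
  using assms(3)
proof (induction x rule: induct_list012)
  case (3 x y s)
  interpret K: group K using assms by (simp add: subgroup_of_def)
  show ?case using 3 subgroup_of_inv[OF assms(1,2), of x] subgroup_of_mult[OF assms(1)] by simp
qed auto

lemma group_quotients_in_tuples:
  assumes "group K" "x \<in> tuples K (Suc j)"
  shows "quotients K x \<in> tuples K j"
  using assms group.set_quotients[OF assms(1), of x] by (auto simp: tuples_def)

definition emb :: "'y \<Rightarrow> ('g list \<Rightarrow>\<^sub>0 int) \<Rightarrow> ('g list \<times> 'y \<Rightarrow>\<^sub>0 int)" where
  "emb y = frag_extend (\<lambda>s. frag_of (s, y))"

lemma additive_emb: "additive (emb y)"
  unfolding emb_def by (rule additive_frag_extend)

lemma emb_0 [simp]: "emb y 0 = 0"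
  by (simp add: emb_def)

lemma emb_diff: "emb y (a - b) = emb y a - emb y b"
  by (simp add: emb_def frag_extend_diff)

text \<open>A point with a group \<open>K\<close> that fixes it, not necessarily its whole stabilizer. Pairing tuples with
  the fixed point embeds the bar complex of \<open>K\<close>.\<close>

locale fixed_point_gset = gset +
  fixes K :: "'a monoid" and ob :: 'b
  assumes K: "subgroup_of K G"
    and ob: "ob \<in> Y"
    and fixed: "h \<in> carrier K \<Longrightarrow> act h ob = ob"
begin

lemma group_K: "group K"
  using K by (simp add: subgroup_of_def)

lemma fixed_inv: "h \<in> carrier K \<Longrightarrow> act (inv h) ob = ob"
  using act_inv_act[OF subgroup_of_in[OF K] ob] fixed by fastforce

lemma emb_quotients:
  assumes "x \<in> tuples K (Suc j)"
  shows "emb ob (frag_of (quotients G x)) = symb ob x"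
proof -
  have "hd x \<in> carrier K" using assms by (cases x) (auto simp: tuples_def)
  then show ?thesis by (simp add: emb_def bar_symbol_def fixed_inv)
qed

lemma quotients_K: "x \<in> tuples K n \<Longrightarrow> quotients K x = quotients G x"
  using subgroup_of_quotients[OF K is_group] by (simp add: tuples_def)

lemma emb_in: "c \<in> chains (nerve K) j \<Longrightarrow> emb ob c \<in> BC j"
  unfolding emb_def bar_chains_def chains_nerve
  by (erule frag_extend_in_frags) (use subgroup_of_tuples[OF K] ob in auto)

lemma emb_boundary:
  assumes "c \<in> chains (nerve K) (Suc k)"
  shows "bd (Suc k) (emb ob c) = emb ob (boundary (nerve G) k c)"
  using group_K assms
proof (induction c rule: nerve_chains_induct)
  case (symbol x)
  have x: "x \<in> tuples G (Suc (Suc k))" using subgroup_of_tuples[OF K symbol] .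
  have "emb ob (boundary (nerve G) k (frag_of (quotients G x)))
      = omission_sum (\<lambda>t. emb ob (frag_of (quotients G t))) x"
    using x by (simp add: nerve_boundary_quotients[OF is_group] additive.omission_sum[OF additive_emb])
  also have "\<dots> = omission_sum (symb ob) x"
    using symbol by (intro omission_sum_cong emb_quotients[of _ k]) (auto simp: tuples_def)
  finally show ?case
    using bar_boundary_symbol[OF x ob] by (simp add: quotients_K[OF symbol] emb_quotients[OF symbol])
qed (auto simp: emb_diff boundary_diff bar_boundary_diff)

lemma emb_cycle:
  assumes "c \<in> cycles (nerve K) j"
  shows "emb ob c \<in> BC j" "bd j (emb ob c) = 0"
  using assms emb_in emb_boundary
  by (cases j; auto simp: cycles_Suc_subgroup_of[OF K] cycles_def subgroup_of_boundary[OF K])+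

lemma emb_bounds:
  assumes "c \<in> boundaries (nerve K) j"
  shows "\<exists>f \<in> BC (Suc j). emb ob c = bd (Suc j) f"
proof -
  obtain b where b: "b \<in> chains (nerve K) (Suc j)" "c = boundary (nerve G) j b"
    using assms boundaries_subgroup_of[OF K] by auto
  then show ?thesis using emb_boundary[OF b(1)] emb_in[OF b(1)] by metis
qed

end

text \<open>A base point with full stabilizer \<open>K\<close> in a transitive \<open>G\<close>-set, and a section \<open>\<sigma>\<close> of the orbit map.
  The section determines the inverse in Shapiro's lemma on the level of chains.\<close>

locale sectioned_gset = fixed_point_gset +
  fixes \<sigma> :: "'b \<Rightarrow> 'a"
  assumes stab: "g \<in> carrier G \<Longrightarrow> act g ob = ob \<Longrightarrow> g \<in> carrier K"
    and section_in: "y \<in> Y \<Longrightarrow> \<sigma> y \<in> carrier G"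
    and act_section: "y \<in> Y \<Longrightarrow> act (\<sigma> y) ob = y"
    and section_ob: "\<sigma> ob = \<one>"
begin

text \<open>\<open>retr y\<close> maps \<open>G\<close> to the coset of the elements that move \<open>ob\<close> to \<open>y\<close>. Transporting the value \<open>\<sigma> y\<close> at
  \<open>x = 1\<close> along the diagonal action makes the family equivariant (\<open>retr_mult\<close>).\<close>

definition retr :: "'b \<Rightarrow> 'a \<Rightarrow> 'a" where
  "retr y x = x \<otimes> \<sigma> (act (inv x) y)"

lemma retr_in: "x \<in> carrier G \<Longrightarrow> y \<in> Y \<Longrightarrow> retr y x \<in> carrier G"
  using section_in act_in by (simp add: retr_def)

lemma act_retr: "x \<in> carrier G \<Longrightarrow> y \<in> Y \<Longrightarrow> act (retr y x) ob = y"
  using section_in act_section act_in ob by (simp add: retr_def act_mult act_act_inv)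

lemma act_inv_retr: "x \<in> carrier G \<Longrightarrow> y \<in> Y \<Longrightarrow> act (inv (retr y x)) y = ob"
  using act_inv_act[OF retr_in ob] act_retr by metis

lemma retr_mult:
  assumes "g \<in> carrier G" "x \<in> carrier G" "y \<in> Y"
  shows "retr (act g y) (g \<otimes> x) = g \<otimes> retr y x"
proof -
  have "act (inv (g \<otimes> x)) (act g y) = act (inv x) y"
    using assms by (simp add: inv_mult_group act_mult act_in act_inv_act)
  then show ?thesis using assms section_in[of "act (inv x) y"] by (simp add: retr_def m_assoc act_in)
qed

lemma map_retr_in: "x \<in> tuples G n \<Longrightarrow> y \<in> Y \<Longrightarrow> map (retr y) x \<in> tuples G n"
  by (auto simp: tuples_def retr_in)

text \<open>Two elements that move the base point to the same point differ by an element of the stabilizer.\<close>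

lemma quotients_retr_in:
  assumes x: "x \<in> tuples G (Suc j)" and y: "y \<in> Y"
  shows "quotients G (map (retr y) x) \<in> tuples K j"
proof -
  have "set (quotients G z) \<subseteq> carrier K"
    if "set z \<subseteq> carrier G" "\<And>g. g \<in> set z \<Longrightarrow> act g ob = y" for z
    using that
  proof (induction z rule: induct_list012)
    case (3 a b s)
    have "act (inv a \<otimes> b) ob = act (inv a) (act a ob)"
      using 3 ob by (simp add: act_mult)
    also have "\<dots> = ob" using 3(3) ob by (intro act_inv_act) auto
    finally have "inv a \<otimes> b \<in> carrier K" using 3 by (simp add: stab)
    then show ?case using 3 by simp
  qed auto
  from this[of "map (retr y) x"] show ?thesis
    using x y map_retr_in[OF x y] act_retr by (auto simp: tuples_def)
qed

definition proj :: "('a list \<times> 'b \<Rightarrow>\<^sub>0 int) \<Rightarrow> ('a list \<Rightarrow>\<^sub>0 int)" where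
  "proj = frag_extend (\<lambda>(s, y). frag_of (quotients G (map (retr y) (pp s))))"

definition homotopy :: "('a list \<times> 'b \<Rightarrow>\<^sub>0 int) \<Rightarrow> ('a list \<times> 'b \<Rightarrow>\<^sub>0 int)" where
  "homotopy = frag_extend (\<lambda>(s, y). prism (\<lambda>x. x) (retr y) (symb y)
                                          (pp s))"

lemma proj_diff: "proj (a - b) = proj a - proj b"
  by (simp add: proj_def frag_extend_diff)

lemma homotopy_diff: "homotopy (a - b) = homotopy a - homotopy b"
  by (simp add: homotopy_def frag_extend_diff)

lemma proj_0: "proj 0 = 0" and homotopy_0: "homotopy 0 = 0"
  by (simp_all add: proj_def homotopy_def)

lemma proj_symbol:
  assumes x: "x \<in> tuples G (Suc j)" and y: "y \<in> Y"
  shows "proj (symb y x) = frag_of (quotients G (map (retr y) x))"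
  unfolding proj_def
proof (rule extend_bar_symbol[of "\<lambda>x y. frag_of (quotients G (map (retr y) x))"])
  fix g assume g: "g \<in> carrier G"
  have "map (retr (act g y)) (map ((\<otimes>) g) x) = map ((\<otimes>) g) (map (retr y) x)"
    using x y g retr_mult by (auto simp: tuples_def)
  then show "frag_of (quotients G (map (retr (act g y)) (map ((\<otimes>) g) x)))
      = frag_of (quotients G (map (retr y) x))"
    using quotients_map[OF g, of "map (retr y) x"] map_retr_in[OF x y] by (simp only: tuples_def mem_Collect_eq)
qed (use x y in auto)

lemma homotopy_symbol:
  assumes x: "x \<in> tuples G (Suc j)" and y: "y \<in> Y"
  shows "homotopy (symb y x)
       = prism (\<lambda>x. x) (retr y) (symb y) x"
  unfolding homotopy_def
proof (rule extend_bar_symbol[of "\<lambda>x y. prism (\<lambda>x. x) (retr y) (symb y) x"])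
  fix g assume g: "g \<in> carrier G"
  have "prism (\<lambda>x. x) (retr (act g y)) (\<lambda>t. symb (act g y) t) (map ((\<otimes>) g) x)
      = prism (\<lambda>x. x) (retr y) (\<lambda>t. symb (act g y) (map ((\<otimes>) g) t)) x"
    using x y g retr_mult by (intro prism_map) (auto simp: tuples_def)
  also have "\<dots> = prism (\<lambda>x. x) (retr y) (symb y) x"
  proof (rule prism_cong)
    fix t assume t: "set t \<subseteq> (\<lambda>x. x) ` set x \<union> retr y ` set x" "length t = Suc (length x)"
    then have "set t \<subseteq> carrier G" "t \<noteq> []" using x y retr_in by (auto simp: tuples_def)
    then show "symb (act g y) (map ((\<otimes>) g) t) = symb y t"
      using bar_symbol_mult g y by simp
  qed
  finally show "prism (\<lambda>x. x) (retr (act g y)) (\<lambda>t. symb (act g y) t) (map ((\<otimes>) g) x)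
      = prism (\<lambda>x. x) (retr y) (symb y) x" .
qed (use x y in auto)

lemma tuples_prism:
  assumes x: "x \<in> tuples G n" and y: "y \<in> Y"
    and t: "set t \<subseteq> (\<lambda>x. x) ` set x \<union> retr y ` set x" "length t = Suc (length x)"
  shows "t \<in> tuples G (Suc n)"
  using assms retr_in by (auto simp: tuples_def)

lemma proj_in: "c \<in> BC j \<Longrightarrow> proj c \<in> chains (nerve K) j"
  by (induction c rule: bar_chains_induct)
    (auto simp: proj_symbol proj_0 proj_diff chains_nerve frags_diff quotients_retr_in)

lemma homotopy_in: "c \<in> BC j \<Longrightarrow> homotopy c \<in> BC (Suc j)"
proof (induction c rule: bar_chains_induct)
  case (symbol x y)
  have "prism (\<lambda>x. x) (retr y) (symb y) x \<in> BC (Suc j)"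
    unfolding bar_chains_def
    by (rule prism_in[OF frags_0 frags_diff])
      (use tuples_prism[OF symbol] bar_symbol_in symbol in auto)
  then show ?case by (simp add: homotopy_symbol[OF symbol])
qed (auto simp: homotopy_0 homotopy_diff bar_chains_def frags_diff)

text \<open>If \<open>\<sigma> y\<close> commutes with \<open>L\<close>, then \<open>retr y\<close> is left translation by \<open>\<sigma> y\<close> on \<open>L\<close>, which does not
  change bar symbols. At the base point \<open>\<sigma> ob = 1\<close>; at a translate \<open>w\<^sup>-\<^sup>1 ob\<close> the section can be chosen
  with value \<open>w\<^sup>-\<^sup>1\<close>.\<close>

lemma proj_emb:
  assumes "fixed_point_gset G Y act L y" and commute: "\<And>h. h \<in> carrier L \<Longrightarrow> h \<otimes> \<sigma> y = \<sigma> y \<otimes> h"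
    and c: "c \<in> chains (nerve L) j"
  shows "proj (emb y c) = c"
proof -
  interpret L: fixed_point_gset G Y act L y by fact
  show ?thesis
    using L.group_K c
  proof (induction c rule: nerve_chains_induct)
    case (symbol x)
    have x: "x \<in> tuples G (Suc j)" using subgroup_of_tuples[OF L.K symbol] .
    have "map (retr y) x = map (\<lambda>z. \<sigma> y \<otimes> z) x"
      using symbol commute L.fixed_inv by (auto simp: tuples_def retr_def)
    then have "quotients G (map (retr y) x) = quotients G x"
      using quotients_map[OF section_in[OF L.ob] tuplesD(2)[OF x]] by (simp only:)
    then show ?case
      by (simp add: L.quotients_K[OF symbol] L.emb_quotients[OF symbol] proj_symbol[OF x L.ob])
  qed (auto simp: proj_0 emb_diff proj_diff)
qed

lemma proj_emb_ob: "c \<in> chains (nerve K) j \<Longrightarrow> proj (emb ob c) = c"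
  using subgroup_of_in[OF K]
  by (intro proj_emb[of K ob]) (auto simp: section_ob fixed_point_gset_axioms)

lemma proj_boundary:
  "c \<in> BC (Suc k) \<Longrightarrow> boundary (nerve G) k (proj c) = proj (bd (Suc k) c)"
proof (induction c rule: bar_chains_induct)
  case (symbol x y)
  interpret p: additive proj unfolding proj_def by (rule additive_frag_extend)
  have "proj (bd (Suc k) (symb y x))
      = omission_sum (\<lambda>t. proj (symb y t)) x"
    by (simp add: bar_boundary_symbol[OF symbol] p.omission_sum)
  also have "\<dots> = omission_sum (\<lambda>t. frag_of (quotients G (map (retr y) t))) x"
    using symbol by (intro omission_sum_cong proj_symbol[of _ k]) (auto simp: tuples_def)
  also have "\<dots> = boundary (nerve G) k (frag_of (quotients G (map (retr y) x)))"
    using nerve_boundary_quotients[OF is_group map_retr_in[OF symbol]] by (simp add: omission_sum_map)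
  finally show ?case by (simp add: proj_symbol[OF symbol])
qed (auto simp: proj_0 proj_diff boundary_diff bar_boundary_diff)

text \<open>The prism formula for the identity and \<open>retr y\<close>. The second map sends \<open>(x, y)\<close> to a tuple with
  values in one coset of \<open>K\<close>, whose bar symbol lies over the base point.\<close>

lemma homotopy_formula:
  "c \<in> BC j \<Longrightarrow>
     bd (Suc j) (homotopy c) + homotopy (bd j c) = emb ob (proj c) - c"
proof (induction c rule: bar_chains_induct)
  case (symbol x y)
  define F where "F t = symb y t" for t
  interpret H: additive homotopy unfolding homotopy_def by (rule additive_frag_extend)
  interpret B: additive "bd (Suc j)"
    unfolding bar_boundary_def by (simp add: additive_frag_extend)
  have "bd (Suc j) (homotopy (symb y x))
      = prism (\<lambda>x. x) (retr y) (\<lambda>t. bd (Suc j) (F t)) x"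
    by (simp add: homotopy_symbol[OF symbol] B.prism F_def)
  also have "\<dots> = prism (\<lambda>x. x) (retr y) (omission_sum F) x"
    using tuples_prism[OF symbol] bar_boundary_symbol[OF _ symbol(2)]
    by (intro prism_cong) (auto simp: F_def[abs_def])
  finally have 1: "bd (Suc j) (homotopy (symb y x)) = \<dots>" .
  have 2: "homotopy (bd j (symb y x)) = omission_sum (prism (\<lambda>x. x) (retr y) F) x"
  proof (cases j)
    case 0
    then obtain u where "x = [u]" using symbol by (auto simp: tuples_def length_Suc_conv)
    then show ?thesis using 0 by (simp add: homotopy_0)
  next
    case (Suc i)
    have "homotopy (bd j (symb y x))
        = omission_sum (\<lambda>t. homotopy (symb y t)) x"
      using symbol Suc by (simp add: bar_boundary_symbol H.omission_sum)
    also have "\<dots> = omission_sum (prism (\<lambda>x. x) (retr y) F) x"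
      unfolding F_def using symbol Suc by (intro omission_sum_cong homotopy_symbol[of _ i]) (auto simp: tuples_def)
    finally show ?thesis .
  qed
  have "x \<noteq> []" "hd x \<in> carrier G"
    using symbol(1) hd_in[of x] tuples_Suc_neq_Nil[OF symbol(1)] by (auto simp: tuples_def)
  then have "bar_symbol G act (map (retr y) x) y = (quotients G (map (retr y) x), ob)"
    using symbol act_inv_retr by (simp add: bar_symbol_def hd_map)
  then have "F (map (retr y) x) = emb ob (proj (symb y x))"
    by (simp add: F_def proj_symbol[OF symbol] emb_def)
  then show ?case using 1 2 prism_homotopy[of "\<lambda>x. x" "retr y" F x] by (simp add: F_def add.commute)
next
  case (diff a b)
  then show ?case
    by (simp only: bar_boundary_diff homotopy_diff emb_diff proj_diff diff_of_equations)
qed (simp add: homotopy_0 emb_0 proj_0)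

lemma shapiro_surjective:
  assumes "z \<in> BC j" "bd j z = 0"
  shows "\<exists>c \<in> cycles (nerve K) j. \<exists>f \<in> BC (Suc j). z = emb ob c + bd (Suc j) f"
proof (intro bexI)
  show "z = emb ob (proj z) + bd (Suc j) (0 - homotopy z)"
    using homotopy_formula[OF assms(1)] assms(2)
    by (simp add: bar_boundary_diff homotopy_0 algebra_simps del: diff_0)
  show "0 - homotopy z \<in> BC (Suc j)"
    using homotopy_in[OF assms(1)] unfolding bar_chains_def by (intro frags_diff) auto
  show "proj z \<in> cycles (nerve K) j"
  proof (cases j)
    case 0
    then show ?thesis using proj_in assms by (simp add: cycles_def)
  next
    case (Suc k)
    then show ?thesis
      using proj_in assms proj_boundary[of z k] by (simp add: cycles_Suc_subgroup_of[OF K] proj_0)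
  qed
qed

lemma shapiro_injective:
  assumes "c \<in> cycles (nerve K) j" "b \<in> BC (Suc j)" "emb ob c = bd (Suc j) b"
  shows "c \<in> boundaries (nerve K) j"
proof -
  have "c \<in> chains (nerve K) j" using assms(1) by (simp add: cycles_def)
  then have "c = proj (emb ob c)" by (rule proj_emb_ob[symmetric])
  then have "c = boundary (nerve G) j (proj b)" using assms(3) proj_boundary[OF assms(2)] by simp
  then show ?thesis using proj_in[OF assms(2)] by (simp add: boundaries_subgroup_of[OF K])
qed

end

locale transitive_gset = fixed_point_gset +
  assumes stab: "g \<in> carrier G \<Longrightarrow> act g ob = ob \<Longrightarrow> g \<in> carrier K"
    and orbit: "y \<in> Y \<Longrightarrow> \<exists>g \<in> carrier G. act g ob = y"
begin

text \<open>The prescribed value is only compatible with \<open>\<sigma> ob = 1\<close> away from the base point.\<close>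

lemma section_through:
  assumes "g \<in> carrier G"
  shows "\<exists>\<sigma>. sectioned_gset G Y act K ob \<sigma> \<and> (act g ob \<noteq> ob \<longrightarrow> \<sigma> (act g ob) = g)"
proof -
  obtain s where s: "\<And>y. y \<in> Y \<Longrightarrow> s y \<in> carrier G \<and> act (s y) ob = y"
    using orbit by metis
  define \<sigma> where "\<sigma> y = (if y = ob then \<one> else if y = act g ob then g else s y)" for y
  have "sectioned_gset G Y act K ob \<sigma>"
    by unfold_locales (use stab s assms act_one[OF ob] in \<open>auto simp: \<sigma>_def\<close>)
  then show ?thesis by (auto simp: \<sigma>_def)
qed

lemma translate_fixed_point:
  assumes L: "subgroup_of L G" "carrier L \<subseteq> carrier K"
    and w: "w \<in> carrier G" "\<And>h. h \<in> carrier L \<Longrightarrow> w \<otimes> h = h \<otimes> w"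
  shows "fixed_point_gset G Y act L (act (inv w) ob)"
    and "h \<in> carrier L \<Longrightarrow> h \<otimes> inv w = inv w \<otimes> h"
proof -
  have comm: "h \<otimes> inv w = inv w \<otimes> h" if h: "h \<in> carrier L" for h
    using w(1) w(2)[OF h] subgroup_of_in[OF L(1) h] by (metis inv_solve_left inv_solve_right m_assoc inv_closed m_closed)
  then show "h \<in> carrier L \<Longrightarrow> h \<otimes> inv w = inv w \<otimes> h" .
  show "fixed_point_gset G Y act L (act (inv w) ob)"
  proof
    fix h assume h: "h \<in> carrier L"
    have "act h (act (inv w) ob) = act (inv w \<otimes> h) ob"
      using comm[OF h] act_mult[of h "inv w" ob] subgroup_of_in[OF L(1) h] w(1) ob by simp
    also have "\<dots> = act (inv w) ob"
      using fixed[of h] h L(2) act_mult[of "inv w" h ob] subgroup_of_in[OF L(1) h] w(1) ob by auto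
    finally show "act h (act (inv w) ob) = act (inv w) ob" .
  qed (use L w ob act_in in auto)
qed

text \<open>Both sides embed the bar complex of \<open>L\<close>, over \<open>w\<^sup>-\<^sup>1 ob\<close> and over \<open>ob\<close>. With a section through
  \<open>w\<^sup>-\<^sup>1\<close>, the first one projects to the same chains of \<open>K\<close> as the second, hence they are homotopic.\<close>

lemma translate_homotopic:
  assumes L: "subgroup_of L G" "carrier L \<subseteq> carrier K"
    and w: "w \<in> carrier G" "\<And>h. h \<in> carrier L \<Longrightarrow> w \<otimes> h = h \<otimes> w"
    and c: "c \<in> cycles (nerve L) j"
  shows "\<exists>f \<in> BC (Suc j). emb (act (inv w) ob) c = emb ob c + bd (Suc j) f"
proof (cases "act (inv w) ob = ob")
  case True
  have "0 \<in> BC (Suc j)" by (simp add: bar_chains_def)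
  then show ?thesis using True by (intro bexI[of _ 0]) simp_all
next
  case False
  obtain \<sigma> where \<sigma>: "sectioned_gset G Y act K ob \<sigma>" "\<sigma> (act (inv w) ob) = inv w"
    using section_through[OF inv_closed[OF w(1)]] False by blast
  interpret S: sectioned_gset G Y act K ob \<sigma> by (rule \<sigma>(1))
  note fp = translate_fixed_point[OF L w]
  interpret L: fixed_point_gset G Y act L "act (inv w) ob" by (rule fp(1))
  let ?z = "emb (act (inv w) ob) c"
  have "c \<in> chains (nerve L) j" using c by (simp add: cycles_def)
  then have "S.proj ?z = c" using S.proj_emb[OF fp(1)] fp(2) \<sigma>(2) by simp
  then have "bd (Suc j) (S.homotopy ?z) = emb ob c - ?z"
    using S.homotopy_formula[OF L.emb_cycle(1)[OF c]] L.emb_cycle(2)[OF c] by (simp add: S.homotopy_0)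
  then have "?z = emb ob c + bd (Suc j) (0 - S.homotopy ?z)"
    by (simp add: bar_boundary_diff del: diff_0)
  moreover have "0 - S.homotopy ?z \<in> BC (Suc j)"
    using S.homotopy_in[OF L.emb_cycle(1)[OF c]] unfolding bar_chains_def by (intro frags_diff) auto
  ultimately show ?thesis by blast
qed

end

section \<open>Bounded equivariant cochains\<close>

text \<open>As for \<open>bcochains\<close>, the functions vanish outside their domain, so that equality of cochains is
  equality of functions.\<close>

definition eq_cochains ::
    "'g monoid \<Rightarrow> 'y set \<Rightarrow> ('g \<Rightarrow> 'y \<Rightarrow> 'y) \<Rightarrow> nat \<Rightarrow> ('g list \<Rightarrow> 'y \<Rightarrow> real) set" where
  "eq_cochains G Y act j =
     {F. (\<forall>x y. \<not> (x \<in> tuples G (Suc j) \<and> y \<in> Y) \<longrightarrow> F x y = 0) \<and>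
         (\<exists>B. \<forall>x \<in> tuples G (Suc j). \<forall>y \<in> Y. \<bar>F x y\<bar> \<le> B) \<and>
         (\<forall>g \<in> carrier G. \<forall>x \<in> tuples G (Suc j). \<forall>y \<in> Y. F (map (\<lambda>z. g \<otimes>\<^bsub>G\<^esub> z) x) (act g y) = F x y)}"

definition eq_differential ::
    "'g monoid \<Rightarrow> 'y set \<Rightarrow> nat \<Rightarrow> ('g list \<Rightarrow> 'y \<Rightarrow> real) \<Rightarrow> 'g list \<Rightarrow> 'y \<Rightarrow> real" where
  "eq_differential G Y j F =
     (\<lambda>x y. if x \<in> tuples G (Suc (Suc j)) \<and> y \<in> Y then omission_sum (\<lambda>t. F t y) x else 0)"

definition eq_coboundaries ::
    "'g monoid \<Rightarrow> 'y set \<Rightarrow> ('g \<Rightarrow> 'y \<Rightarrow> 'y) \<Rightarrow> nat \<Rightarrow> ('g list \<Rightarrow> 'y \<Rightarrow> real) set" where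
  "eq_coboundaries G Y act j =
     (case j of 0 \<Rightarrow> {0} | Suc i \<Rightarrow> eq_differential G Y i ` eq_cochains G Y act i)"

lemma eq_cochainsI:
  assumes "\<And>x y. \<not> (x \<in> tuples G (Suc j) \<and> y \<in> Y) \<Longrightarrow> F x y = 0"
    and "\<And>x y. x \<in> tuples G (Suc j) \<Longrightarrow> y \<in> Y \<Longrightarrow> \<bar>F x y\<bar> \<le> B"
    and "\<And>g x y. g \<in> carrier G \<Longrightarrow> x \<in> tuples G (Suc j) \<Longrightarrow> y \<in> Y \<Longrightarrow>
           F (map (\<lambda>z. g \<otimes>\<^bsub>G\<^esub> z) x) (act g y) = F x y"
  shows "F \<in> eq_cochains G Y act j"
  unfolding eq_cochains_def
  by (intro CollectI conjI allI impI ballI exI[of _ B]) (rule assms; assumption)+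

lemma eq_cochains_outside:
  "F \<in> eq_cochains G Y act j \<Longrightarrow> \<not> (x \<in> tuples G (Suc j) \<and> y \<in> Y) \<Longrightarrow> F x y = 0"
  by (simp add: eq_cochains_def)

lemma eq_cochains_bound:
  "F \<in> eq_cochains G Y act j \<Longrightarrow> \<exists>B. \<forall>x \<in> tuples G (Suc j). \<forall>y \<in> Y. \<bar>F x y\<bar> \<le> B"
  by (simp add: eq_cochains_def)

lemma eq_cochains_invariant:
  "F \<in> eq_cochains G Y act j \<Longrightarrow> g \<in> carrier G \<Longrightarrow> x \<in> tuples G (Suc j) \<Longrightarrow> y \<in> Y \<Longrightarrow>
     F (map (\<lambda>z. g \<otimes>\<^bsub>G\<^esub> z) x) (act g y) = F x y"
  by (simp add: eq_cochains_def)

lemma eq_cochains_0: "0 \<in> eq_cochains G Y act j"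
  by (rule eq_cochainsI[where B = 0]) auto

lemma eq_cochains_diff:
  assumes "F \<in> eq_cochains G Y act j" "F' \<in> eq_cochains G Y act j"
  shows "F - F' \<in> eq_cochains G Y act j"
proof -
  obtain B B' where B: "\<forall>x \<in> tuples G (Suc j). \<forall>y \<in> Y. \<bar>F x y\<bar> \<le> B"
    and B': "\<forall>x \<in> tuples G (Suc j). \<forall>y \<in> Y. \<bar>F' x y\<bar> \<le> B'"
    using eq_cochains_bound[OF assms(1)] eq_cochains_bound[OF assms(2)] by blast
  show ?thesis
  proof (rule eq_cochainsI[where B = "B + B'"])
    fix x y assume "x \<in> tuples G (Suc j)" "y \<in> Y"
    then have "\<bar>F x y\<bar> \<le> B" "\<bar>F' x y\<bar> \<le> B'" using B B' by auto
    then show "\<bar>(F - F') x y\<bar> \<le> B + B'" by simp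
  next
    fix x y assume "\<not> (x \<in> tuples G (Suc j) \<and> y \<in> Y)"
    then show "(F - F') x y = 0"
      using eq_cochains_outside[OF assms(1), of x y] eq_cochains_outside[OF assms(2), of x y] by simp
  next
    fix g x y assume "g \<in> carrier G" "x \<in> tuples G (Suc j)" "y \<in> Y"
    then show "(F - F') (map (\<lambda>z. g \<otimes>\<^bsub>G\<^esub> z) x) (act g y) = (F - F') x y"
      using eq_cochains_invariant[OF assms(1), of g x y] eq_cochains_invariant[OF assms(2), of g x y] by simp
  qed
qed

lemma eq_differential_diff:
  "eq_differential G Y j (F - F') = eq_differential G Y j F - eq_differential G Y j F'"
  by (intro ext) (simp add: eq_differential_def omission_sum_diff)

lemma eq_differential_0 [simp]: "eq_differential G Y j 0 = 0"
  by (intro ext) (simp add: eq_differential_def)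

lemma bdifferential_eq_omission_sum:
  "bdifferential q K f = (\<lambda>s. if s \<in> tuples K (Suc (Suc q)) then omission_sum f s else 0)"
proof (rule ext)
  fix s
  show "bdifferential q K f s = (if s \<in> tuples K (Suc (Suc q)) then omission_sum f s else 0)"
  proof (cases "s \<in> tuples K (Suc (Suc q))")
    case True
    then obtain u t where s: "s = u # t" "length t = Suc q" by (cases s) (auto simp: tuples_def)
    have "signed i a = (- 1) ^ i * a" for i :: nat and a :: real by (simp add: signed_def)
    then have "omission_sum f s = (\<Sum>i\<le>Suc q. (- 1) ^ i * f (take i s @ drop (Suc i) s))"
      unfolding s(1) omission_sum_alt_sum s(2) alt_sum_def by (intro sum.cong) auto
    then show ?thesis using True by (simp add: bdifferential_def)
  qed (simp add: bdifferential_def)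
qed

lemma bcochainsI:
  assumes "\<And>s. s \<notin> tuples K (Suc q) \<Longrightarrow> f s = 0"
    and "\<And>s. s \<in> tuples K (Suc q) \<Longrightarrow> \<bar>f s\<bar> \<le> B"
    and "\<And>g s. g \<in> carrier K \<Longrightarrow> s \<in> tuples K (Suc q) \<Longrightarrow> f (map (\<lambda>z. g \<otimes>\<^bsub>K\<^esub> z) s) = f s"
  shows "f \<in> bcochains q K"
  unfolding bcochains_def
  by (intro CollectI conjI allI impI ballI exI[of _ B]) (rule assms; assumption)+

lemma bcochains_outside: "f \<in> bcochains q K \<Longrightarrow> s \<notin> tuples K (Suc q) \<Longrightarrow> f s = 0"
  by (simp add: bcochains_def)

lemma bcochains_bound: "f \<in> bcochains q K \<Longrightarrow> \<exists>B. \<forall>s \<in> tuples K (Suc q). \<bar>f s\<bar> \<le> B"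
  by (simp add: bcochains_def)

lemma bcochains_invariant:
  "f \<in> bcochains q K \<Longrightarrow> g \<in> carrier K \<Longrightarrow> s \<in> tuples K (Suc q) \<Longrightarrow> f (map (\<lambda>z. g \<otimes>\<^bsub>K\<^esub> z) s) = f s"
  by (simp add: bcochains_def)

text \<open>Used to transfer facts about equivariant cochains to the groups themselves.\<close>

lemma bcochains_iff_eq_cochains:
  "f \<in> bcochains q K \<longleftrightarrow> (\<lambda>s (_::unit). f s) \<in> eq_cochains K {()} (\<lambda>_ y. y) q"
  by (simp add: bcochains_def eq_cochains_def)

lemma bdifferential_eq_eq_differential:
  "(\<lambda>s (_::unit). bdifferential q K f s) = eq_differential K {()} q (\<lambda>s _. f s)"
  by (simp add: bdifferential_eq_omission_sum eq_differential_def fun_eq_iff)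

lemma bcochains_diff:
  assumes "f \<in> bcochains j L" "g \<in> bcochains j L"
  shows "f - g \<in> bcochains j L"
  using eq_cochains_diff[OF assms[unfolded bcochains_iff_eq_cochains]]
  by (simp add: bcochains_iff_eq_cochains fun_diff_def)

lemma bcochains_0: "0 \<in> bcochains j L"
  by (rule bcochainsI[where B = 0]) auto

lemma bdifferential_diff: "bdifferential j L (f - g) = bdifferential j L f - bdifferential j L g"
  by (simp add: bdifferential_eq_omission_sum fun_diff_def omission_sum_diff fun_eq_iff)

lemma bdifferential_0: "bdifferential j L 0 = 0"
  using bdifferential_diff[of j L 0 0] by simp

lemma bcoboundaries_0: "0 \<in> bcoboundaries j L"
proof (cases j)
  case (Suc i)
  have "0 = bdifferential i L 0" by (simp add: bdifferential_0)
  then have "0 \<in> bdifferential i L ` bcochains i L" using bcochains_0 by (rule image_eqI)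
  then show ?thesis using Suc by (simp add: bcoboundaries_def)
qed (simp add: bcoboundaries_def zero_fun_def)

lemma bcoboundaries_diff:
  assumes "f \<in> bcoboundaries j L" "g \<in> bcoboundaries j L"
  shows "f - g \<in> bcoboundaries j L"
proof (cases j)
  case 0
  then show ?thesis using assms by (simp add: bcoboundaries_def fun_eq_iff)
next
  case (Suc i)
  then obtain f' g' where "f' \<in> bcochains i L" "f = bdifferential i L f'"
    "g' \<in> bcochains i L" "g = bdifferential i L g'"
    using assms by (auto simp: bcoboundaries_def)
  then have "f - g = bdifferential i L (f' - g')" "f' - g' \<in> bcochains i L"
    by (auto simp: bdifferential_diff intro: bcochains_diff)
  then show ?thesis using Suc by (auto simp: bcoboundaries_def)
qed

lemma bcoboundaries_add:
  assumes "f \<in> bcoboundaries j L" "g \<in> bcoboundaries j L"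
  shows "f + g \<in> bcoboundaries j L"
proof -
  have "f - (0 - g) \<in> bcoboundaries j L" by (intro bcoboundaries_diff bcoboundaries_0 assms)
  then show ?thesis by simp
qed

definition restr :: "'g monoid \<Rightarrow> 'y \<Rightarrow> nat \<Rightarrow> ('g list \<Rightarrow> 'y \<Rightarrow> real) \<Rightarrow> 'g list \<Rightarrow> real" where
  "restr L y j F = (\<lambda>s. if s \<in> tuples L (Suc j) then F s y else 0)"

lemma restr_diff: "restr L y j (F - F') = restr L y j F - restr L y j F'"
  by (intro ext) (simp add: restr_def)

lemma restr_0: "restr L y j 0 = 0"
  by (simp add: restr_def fun_eq_iff)

lemma tuples_omit: "x \<in> tuples G (Suc n) \<Longrightarrow> set t \<subseteq> set x \<Longrightarrow> Suc (length t) = length x \<Longrightarrow> t \<in> tuples G n"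
  by (auto simp: tuples_def)

context gset
begin

abbreviation "EC \<equiv> eq_cochains G Y act"
abbreviation "dE \<equiv> eq_differential G Y"

lemma map_mult_in: "g \<in> carrier G \<Longrightarrow> x \<in> tuples G n \<Longrightarrow> map ((\<otimes>) g) x \<in> tuples G n"
  by (auto simp: tuples_def)

lemma eq_differential_in:
  assumes F: "F \<in> EC j"
  shows "dE j F \<in> EC (Suc j)"
proof -
  obtain B where B: "\<forall>x \<in> tuples G (Suc j). \<forall>y \<in> Y. \<bar>F x y\<bar> \<le> B"
    using eq_cochains_bound[OF F] by blast
  show ?thesis
  proof (rule eq_cochainsI[where B = "real (Suc (Suc j)) * B"])
    fix x y assume x: "x \<in> tuples G (Suc (Suc j))" and y: "y \<in> Y"
    have "\<bar>omission_sum (\<lambda>t. F t y) x\<bar> \<le> real (length x) * B"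
      by (rule omission_sum_bound, rule B[rule_format, OF tuples_omit[OF x] y])
    then show "\<bar>dE j F x y\<bar> \<le> real (Suc (Suc j)) * B"
      using x y by (simp add: eq_differential_def tuplesD)
    fix g assume g: "g \<in> carrier G"
    have "omission_sum (\<lambda>t. F (map ((\<otimes>) g) t) (act g y)) x = omission_sum (\<lambda>t. F t y) x"
      by (rule omission_sum_cong, rule eq_cochains_invariant[OF F g tuples_omit[OF x] y])
    then show "dE j F (map ((\<otimes>) g) x) (act g y) = dE j F x y"
      using x y g by (simp add: eq_differential_def map_mult_in act_in omission_sum_map)
  qed (auto simp: eq_differential_def)
qed

lemma eq_differential_differential:
  "dE (Suc j) (dE j F) = 0"
proof (intro ext)
  fix x y
  have "omission_sum (\<lambda>t. dE j F t y) x = omission_sum (omission_sum (\<lambda>t. F t y)) x"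
    if "x \<in> tuples G (Suc (Suc (Suc j)))" "y \<in> Y"
    by (rule omission_sum_cong) (use that tuples_omit[OF that(1)] in \<open>auto simp: eq_differential_def\<close>)
  then show "dE (Suc j) (dE j F) x y = 0 x y"
    by (simp add: eq_differential_def[of G Y "Suc j"] omission_sum_omission_sum)
qed

end

context fixed_point_gset
begin

lemma restr_in:
  assumes F: "F \<in> EC j"
  shows "restr K ob j F \<in> bcochains j K"
proof -
  obtain B where B: "\<forall>x \<in> tuples G (Suc j). \<forall>y \<in> Y. \<bar>F x y\<bar> \<le> B"
    using eq_cochains_bound[OF F] by blast
  show ?thesis
  proof (rule bcochainsI[where B = B])
    fix s assume s: "s \<in> tuples K (Suc j)"
    then have s': "s \<in> tuples G (Suc j)" by (rule subgroup_of_tuples[OF K])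
    show "\<bar>restr K ob j F s\<bar> \<le> B" using s s' B ob by (simp add: restr_def)
    fix g assume g: "g \<in> carrier K"
    have "map (\<lambda>z. g \<otimes>\<^bsub>K\<^esub> z) s = map ((\<otimes>) g) s"
      using subgroup_of_mult[OF K g] s by (auto simp: tuples_def)
    moreover have "map (\<lambda>z. g \<otimes>\<^bsub>K\<^esub> z) s \<in> tuples K (Suc j)"
      using g s group.is_monoid[OF group_K] by (auto simp: tuples_def intro: monoid.m_closed)
    moreover have "F (map ((\<otimes>) g) s) (act g ob) = F s ob"
      using eq_cochains_invariant[OF F subgroup_of_in[OF K g] s' ob] .
    moreover have "act g ob = ob" using g by (rule fixed)
    ultimately show "restr K ob j F (map (\<lambda>z. g \<otimes>\<^bsub>K\<^esub> z) s) = restr K ob j F s"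
      using s by (simp only: restr_def if_True)
  qed (simp add: restr_def)
qed

lemma restr_differential: "bdifferential j K (restr K ob j F) = restr K ob (Suc j) (dE j F)"
proof (rule ext)
  fix s
  show "bdifferential j K (restr K ob j F) s = restr K ob (Suc j) (dE j F) s"
  proof (cases "s \<in> tuples K (Suc (Suc j))")
    case True
    then have "omission_sum (restr K ob j F) s = omission_sum (\<lambda>t. F t ob) s"
      using tuples_omit[OF True] by (intro omission_sum_cong) (auto simp: restr_def)
    then show ?thesis
      using True subgroup_of_tuples[OF K True] ob
      by (simp add: bdifferential_eq_omission_sum restr_def eq_differential_def)
  qed (simp add: bdifferential_eq_omission_sum restr_def)
qed

lemma restr_cocycle:
  assumes F: "F \<in> EC j" "dE j F = 0"
  shows "restr K ob j F \<in> bcocycles j K"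
  using restr_in[OF F(1)] F(2) by (simp add: bcocycles_def restr_differential) (simp add: restr_def)

lemma restr_coboundary:
  assumes "F \<in> eq_coboundaries G Y act j"
  shows "restr K ob j F \<in> bcoboundaries j K"
proof (cases j)
  case 0
  then show ?thesis using assms by (simp add: eq_coboundaries_def restr_0 bcoboundaries_0)
next
  case (Suc i)
  then obtain E where E: "E \<in> EC i" "F = dE i E"
    using assms by (auto simp: eq_coboundaries_def)
  then have "restr K ob j F = bdifferential i K (restr K ob i E)" by (simp add: restr_differential Suc)
  then show ?thesis using restr_in[OF E(1)] by (simp add: bcoboundaries_def Suc)
qed

end

context sectioned_gset
begin

text \<open>A homotopy inverse of the restriction to \<open>K\<close> and the base point: \<open>retr y\<close> moves the entries of the
  tuple into one coset of \<open>K\<close>, which is then translated back to \<open>K\<close>.\<close>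

definition coind :: "nat \<Rightarrow> ('a list \<Rightarrow> real) \<Rightarrow> 'a list \<Rightarrow> 'b \<Rightarrow> real" where
  "coind j f = (\<lambda>x y. if x \<in> tuples G (Suc j) \<and> y \<in> Y
                     then f (map (\<lambda>z. inv (retr y (hd x)) \<otimes> retr y z) x) else 0)"

definition cohomotopy :: "nat \<Rightarrow> ('a list \<Rightarrow> 'b \<Rightarrow> real) \<Rightarrow> 'a list \<Rightarrow> 'b \<Rightarrow> real" where
  "cohomotopy j F = (\<lambda>x y. if x \<in> tuples G (Suc j) \<and> y \<in> Y
                          then prism (\<lambda>x. x) (retr y) (\<lambda>t. F t y) x else 0)"

lemma translate_to_stab:
  assumes "u \<in> carrier G" "y \<in> Y" "act u y = ob" "x \<in> tuples G n"
  shows "map (\<lambda>z. u \<otimes> retr y z) x \<in> tuples K n"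
proof -
  have "u \<otimes> retr y z \<in> carrier K" if "z \<in> set x" for z
  proof -
    have "z \<in> carrier G" using that assms(4) by (auto simp: tuples_def)
    then show ?thesis
      using assms ob by (intro stab) (simp_all add: retr_in act_mult act_retr)
  qed
  then show ?thesis using assms(4) by (auto simp: tuples_def)
qed

lemma hd_in_tuples: "x \<in> tuples G (Suc j) \<Longrightarrow> hd x \<in> carrier G"
  using hd_in tuplesD(2) tuples_Suc_neq_Nil by blast

text \<open>Two elements \<open>u\<close> that move \<open>y\<close> to the base point differ by an element of \<open>K\<close>, under which \<open>f\<close> is
  invariant.\<close>

lemma coind_eq:
  assumes f: "f \<in> bcochains j K" and x: "x \<in> tuples G (Suc j)" and y: "y \<in> Y"
    and u: "u \<in> carrier G" "act u y = ob"
  shows "coind j f x y = f (map (\<lambda>z. u \<otimes> retr y z) x)"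
proof -
  define v where "v = inv (retr y (hd x))"
  have v: "v \<in> carrier G" "act v y = ob"
    using hd_in_tuples[OF x] y retr_in act_inv_retr by (auto simp: v_def)
  have "act (v \<otimes> inv u) ob = ob"
    using u v y act_inv_act[OF u(1) y] ob by (simp add: act_mult)
  then have k: "v \<otimes> inv u \<in> carrier K" using u v by (intro stab) simp_all
  have ux: "map (\<lambda>z. u \<otimes> retr y z) x \<in> tuples K (Suc j)" using translate_to_stab u y x by blast
  have "map (\<lambda>z. (v \<otimes> inv u) \<otimes>\<^bsub>K\<^esub> z) (map (\<lambda>z. u \<otimes> retr y z) x) = map (\<lambda>z. v \<otimes> retr y z) x"
  proof (subst map_map, rule map_cong[OF HOL.refl])
    fix z assume z: "z \<in> set x"
    then have "retr y z \<in> carrier G" using x y retr_in by (auto simp: tuples_def)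
    moreover have "u \<otimes> retr y z \<in> carrier K" using ux z by (auto simp: tuples_def)
    moreover have "(v \<otimes> inv u) \<otimes> (u \<otimes> b) = v \<otimes> b" if "b \<in> carrier G" for b
      using u v that by (simp add: m_assoc) (simp add: m_assoc[symmetric])
    ultimately show "((\<otimes>\<^bsub>K\<^esub>) (v \<otimes> inv u) \<circ> (\<lambda>z. u \<otimes> retr y z)) z = v \<otimes> retr y z"
      using subgroup_of_mult[OF K k, of "u \<otimes> retr y z"] by simp
  qed
  with bcochains_invariant[OF f k ux]
  have "f (map (\<lambda>z. v \<otimes> retr y z) x) = f (map (\<lambda>z. u \<otimes> retr y z) x)" by (simp only:)
  then show ?thesis using x y by (simp add: coind_def v_def)
qed

lemma coind_in:
  assumes f: "f \<in> bcochains j K"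
  shows "coind j f \<in> EC j"
proof -
  obtain B where B: "\<forall>s \<in> tuples K (Suc j). \<bar>f s\<bar> \<le> B" using bcochains_bound[OF f] by blast
  show ?thesis
  proof (rule eq_cochainsI[where B = B])
    fix x y assume x: "x \<in> tuples G (Suc j)" and y: "y \<in> Y"
    define u where "u = inv (retr y (hd x))"
    have u: "u \<in> carrier G" "act u y = ob"
      using hd_in_tuples[OF x] y retr_in act_inv_retr by (auto simp: u_def)
    show "\<bar>coind j f x y\<bar> \<le> B"
      using coind_eq[OF f x y u] translate_to_stab[OF u(1) y u(2) x] B by simp
    fix g assume g: "g \<in> carrier G"
    have "coind j f (map ((\<otimes>) g) x) (act g y)
        = f (map (\<lambda>z. (u \<otimes> inv g) \<otimes> retr (act g y) z) (map ((\<otimes>) g) x))"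
      using g x y u by (intro coind_eq[OF f]) (auto simp: map_mult_in act_in act_mult act_inv_act)
    also have "map (\<lambda>z. (u \<otimes> inv g) \<otimes> retr (act g y) z) (map ((\<otimes>) g) x) = map (\<lambda>z. u \<otimes> retr y z) x"
    proof (subst map_map, rule map_cong[OF HOL.refl])
      fix z assume "z \<in> set x"
      then have "z \<in> carrier G" using x by (auto simp: tuples_def)
      then show "((\<lambda>z. (u \<otimes> inv g) \<otimes> retr (act g y) z) \<circ> (\<otimes>) g) z = u \<otimes> retr y z"
        using g u y retr_in by (simp add: retr_mult m_assoc) (simp add: m_assoc[symmetric])
    qed
    finally show "coind j f (map ((\<otimes>) g) x) (act g y) = coind j f x y"
      using coind_eq[OF f x y u] by simp
  qed (auto simp: coind_def)
qed

lemma coind_differential: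
  assumes f: "f \<in> bcochains j K"
  shows "coind (Suc j) (bdifferential j K f) = dE j (coind j f)"
proof (intro ext)
  fix x y
  show "coind (Suc j) (bdifferential j K f) x y = dE j (coind j f) x y"
  proof (cases "x \<in> tuples G (Suc (Suc j)) \<and> y \<in> Y")
    case True
    then have x: "x \<in> tuples G (Suc (Suc j))" and y: "y \<in> Y" by auto
    define u where "u = inv (retr y (hd x))"
    have u: "u \<in> carrier G" "act u y = ob"
      using hd_in_tuples[OF x] y retr_in act_inv_retr by (auto simp: u_def)
    have "omission_sum (\<lambda>t. coind j f t y) x = omission_sum (\<lambda>t. f (map (\<lambda>z. u \<otimes> retr y z) t)) x"
      by (rule omission_sum_cong, rule coind_eq[OF f tuples_omit[OF x] y u])
    then show ?thesis
      using x y translate_to_stab[OF u(1) y u(2) x]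
      by (simp add: coind_def[of "Suc j"] eq_differential_def bdifferential_eq_omission_sum
          u_def[symmetric] omission_sum_map)
  qed (auto simp: coind_def eq_differential_def)
qed

text \<open>The dual of \<open>proj_emb\<close>.\<close>

lemma coind_at_fixed_point:
  assumes "fixed_point_gset G Y act L y" "carrier L \<subseteq> carrier K"
    and commute: "\<And>h. h \<in> carrier L \<Longrightarrow> h \<otimes> \<sigma> y = \<sigma> y \<otimes> h"
    and f: "f \<in> bcochains j K" and s: "s \<in> tuples L (Suc j)"
  shows "coind j f s y = f s"
proof -
  interpret L: fixed_point_gset G Y act L y by fact
  have u: "inv (\<sigma> y) \<in> carrier G" "act (inv (\<sigma> y)) y = ob"
    using section_in[OF L.ob] act_section[OF L.ob] act_inv_act[OF _ ob, of "\<sigma> y"] by auto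
  have "inv (\<sigma> y) \<otimes> retr y z = z" if z: "z \<in> carrier L" for z
  proof -
    have "z \<in> carrier G" using subgroup_of_in[OF L.K z] .
    then show ?thesis
      using section_in[OF L.ob] commute[OF z] L.fixed_inv[OF z] by (simp add: retr_def inv_solve_left')
  qed
  then have "map (\<lambda>z. inv (\<sigma> y) \<otimes> retr y z) s = s"
    using s by (intro map_idI) (auto simp: tuples_def)
  then show ?thesis using coind_eq[OF f subgroup_of_tuples[OF L.K s] L.ob u] by simp
qed

lemma restr_coind:
  assumes f: "f \<in> bcochains j K"
  shows "restr K ob j (coind j f) = f"
proof (rule ext)
  fix s
  show "restr K ob j (coind j f) s = f s"
    using coind_at_fixed_point[OF fixed_point_gset_axioms _ _ f, of s] subgroup_of_in[OF K]
      bcochains_outside[OF f, of s] by (simp add: restr_def section_ob)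
qed

lemma cohomotopy_in:
  assumes F: "F \<in> EC (Suc j)"
  shows "cohomotopy j F \<in> EC j"
proof -
  obtain B where B: "\<forall>x \<in> tuples G (Suc (Suc j)). \<forall>y \<in> Y. \<bar>F x y\<bar> \<le> B"
    using eq_cochains_bound[OF F] by blast
  show ?thesis
  proof (rule eq_cochainsI[where B = "real (Suc j) * B"])
    fix x y assume x: "x \<in> tuples G (Suc j)" and y: "y \<in> Y"
    have "\<bar>prism (\<lambda>x. x) (retr y) (\<lambda>t. F t y) x\<bar> \<le> real (length x) * B"
      by (rule prism_bound, rule B[rule_format, OF tuples_prism[OF x y] y])
    then show "\<bar>cohomotopy j F x y\<bar> \<le> real (Suc j) * B"
      using x y by (simp add: cohomotopy_def tuplesD)
    fix g assume g: "g \<in> carrier G"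
    have "prism (\<lambda>x. x) (retr (act g y)) (\<lambda>t. F t (act g y)) (map ((\<otimes>) g) x)
        = prism (\<lambda>x. x) (retr y) (\<lambda>t. F (map ((\<otimes>) g) t) (act g y)) x"
      using x y g retr_mult by (intro prism_map) (auto simp: tuples_def)
    also have "\<dots> = prism (\<lambda>x. x) (retr y) (\<lambda>t. F t y) x"
      by (rule prism_cong, rule eq_cochains_invariant[OF F g tuples_prism[OF x y] y])
    finally show "cohomotopy j F (map ((\<otimes>) g) x) (act g y) = cohomotopy j F x y"
      using x y g by (simp add: cohomotopy_def map_mult_in act_in)
  qed (auto simp: cohomotopy_def)
qed

text \<open>On a cocycle the second term of the prism formula vanishes. In row \<open>0\<close> nothing remains on the left,
  so that a cocycle there is coinduced from its restriction.\<close>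

lemma cohomotopy_formula:
  assumes F: "F \<in> EC j" "dE j F = 0"
  shows "(case j of 0 \<Rightarrow> 0 | Suc i \<Rightarrow> dE i (cohomotopy i F)) = coind j (restr K ob j F) - F"
proof (intro ext)
  fix x y
  show "(case j of 0 \<Rightarrow> 0 | Suc i \<Rightarrow> dE i (cohomotopy i F)) x y = (coind j (restr K ob j F) - F) x y"
  proof (cases "x \<in> tuples G (Suc j) \<and> y \<in> Y")
    case True
    then have x: "x \<in> tuples G (Suc j)" and y: "y \<in> Y" by auto
    define f where "f = (\<lambda>t. F t y)"
    have "prism (\<lambda>x. x) (retr y) (omission_sum f) x = prism (\<lambda>x. x) (retr y) (\<lambda>t. 0) x"
    proof (rule prism_cong)
      fix t assume "set t \<subseteq> (\<lambda>x. x) ` set x \<union> retr y ` set x" "length t = Suc (length x)"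
      then have "t \<in> tuples G (Suc (Suc j))" using tuples_prism[OF x y] by blast
      then show "omission_sum f t = 0"
        using fun_cong[OF fun_cong[OF F(2)], of t y] y by (simp add: eq_differential_def f_def)
    qed
    then have 1: "omission_sum (prism (\<lambda>x. x) (retr y) f) x = f (map (retr y) x) - f x"
      using prism_homotopy[of "\<lambda>x. x" "retr y" f x] by simp
    have 2: "omission_sum (prism (\<lambda>x. x) (retr y) f) x
        = (case j of 0 \<Rightarrow> 0 | Suc i \<Rightarrow> dE i (cohomotopy i F)) x y"
    proof (cases j)
      case 0
      then obtain u where "x = [u]" using x by (auto simp: tuples_def length_Suc_conv)
      then show ?thesis using 0 by simp
    next
      case (Suc i)
      have "omission_sum (prism (\<lambda>x. x) (retr y) f) x = omission_sum (\<lambda>t. cohomotopy i F t y) x"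
        by (rule omission_sum_cong)
          (use y tuples_omit[OF x] Suc in \<open>auto simp: cohomotopy_def f_def\<close>)
      then show ?thesis using Suc x y by (simp add: eq_differential_def)
    qed
    define u where "u = inv (retr y (hd x))"
    have u: "u \<in> carrier G" "act u y = ob"
      using hd_in_tuples[OF x] y retr_in act_inv_retr by (auto simp: u_def)
    have "coind j (restr K ob j F) x y = F (map ((\<otimes>) u) (map (retr y) x)) (act u y)"
      using x y translate_to_stab[OF u(1) y u(2) x]
      by (simp add: coind_def restr_def u_def[symmetric] u(2) o_def)
    also have "\<dots> = f (map (retr y) x)"
      using eq_cochains_invariant[OF F(1) u(1) map_retr_in[OF x y] y] by (simp add: f_def)
    finally show ?thesis using 1 2 by (simp add: f_def)
  next
    case False
    then show ?thesis
      using eq_cochains_outside[OF F(1), of x y]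
      by (auto simp: coind_def eq_differential_def split: nat.split)
  qed
qed

lemma coshapiro_injective:
  assumes F: "F \<in> EC j" "dE j F = 0"
    and b: "restr K ob j F \<in> bcoboundaries j K"
  shows "F \<in> eq_coboundaries G Y act j"
proof (cases j)
  case 0
  then have "restr K ob j F = 0" using b by (auto simp: bcoboundaries_def)
  then have "coind j (restr K ob j F) = 0" by (intro ext) (simp add: coind_def)
  then show ?thesis using cohomotopy_formula[OF F] 0 by (simp add: eq_coboundaries_def)
next
  case (Suc i)
  then obtain f where f: "f \<in> bcochains i K" "restr K ob j F = bdifferential i K f"
    using b by (auto simp: bcoboundaries_def)
  have "dE i (cohomotopy i F) = dE i (coind i f) - F"
    using cohomotopy_formula[OF F] f Suc coind_differential[OF f(1)] by simp
  then have "F = dE i (coind i f - cohomotopy i F)"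
    by (simp add: eq_differential_diff)
  moreover have "coind i f - cohomotopy i F \<in> EC i"
    using F(1) Suc by (intro eq_cochains_diff coind_in f cohomotopy_in) simp
  ultimately show ?thesis by (auto simp: eq_coboundaries_def Suc)
qed

lemma coshapiro_surjective:
  assumes f: "f \<in> bcocycles j K"
  shows "\<exists>F \<in> EC j. dE j F = 0 \<and> restr K ob j F = f"
proof -
  have f': "f \<in> bcochains j K" "bdifferential j K f = (\<lambda>_. 0)" using f by (auto simp: bcocycles_def)
  have "dE j (coind j f) = 0"
    using coind_differential[OF f'(1)] f'(2) by (auto simp: coind_def fun_eq_iff)
  then show ?thesis using coind_in[OF f'(1)] restr_coind[OF f'(1)] by blast
qed

end

context transitive_gset
begin

text \<open>The dual of \<open>translate_homotopic\<close>: for a section through \<open>w\<^sup>-\<^sup>1\<close>, the value of \<open>F\<close> at \<open>ob\<close> is the value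
  of the coinduced cochain at \<open>w\<^sup>-\<^sup>1 ob\<close>, and that cochain differs from \<open>F\<close> by a coboundary.\<close>

lemma translate_cohomologous:
  assumes L: "subgroup_of L G" "carrier L \<subseteq> carrier K"
    and w: "w \<in> carrier G" "\<And>h. h \<in> carrier L \<Longrightarrow> w \<otimes> h = h \<otimes> w"
    and F: "F \<in> EC j" "dE j F = 0"
  shows "restr L ob j F - restr L (act (inv w) ob) j F \<in> bcoboundaries j L"
proof (cases "act (inv w) ob = ob")
  case True
  then show ?thesis by (simp add: bcoboundaries_0)
next
  case False
  obtain \<sigma> where \<sigma>: "sectioned_gset G Y act K ob \<sigma>" "\<sigma> (act (inv w) ob) = inv w"
    using section_through[OF inv_closed[OF w(1)]] False by blast
  interpret S: sectioned_gset G Y act K ob \<sigma> by (rule \<sigma>(1))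
  note fp = translate_fixed_point[OF L w]
  define y where "y = act (inv w) ob"
  interpret L: fixed_point_gset G Y act L y unfolding y_def by (rule fp(1))
  have "S.coind j (restr K ob j F) s y = F s ob" if s: "s \<in> tuples L (Suc j)" for s
  proof -
    have "S.coind j (restr K ob j F) s y = restr K ob j F s"
      using fp \<sigma>(2) by (intro S.coind_at_fixed_point[OF _ L(2) _ restr_in[OF F(1)] s]) (auto simp: y_def)
    then show ?thesis using s L(2) by (auto simp: restr_def tuples_def)
  qed
  then have "restr L ob j F - restr L y j F = restr L y j (S.coind j (restr K ob j F) - F)"
    by (auto simp: restr_def fun_eq_iff)
  also have "\<dots> = restr L y j (case j of 0 \<Rightarrow> 0 | Suc i \<Rightarrow> dE i (S.cohomotopy i F))"
    using S.cohomotopy_formula[OF F] by simp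
  also have "\<dots> \<in> bcoboundaries j L"
  proof (rule L.restr_coboundary)
    show "(case j of 0 \<Rightarrow> 0 | Suc i \<Rightarrow> dE i (S.cohomotopy i F)) \<in> eq_coboundaries G Y act j"
      using F(1) S.cohomotopy_in by (cases j) (auto simp: eq_coboundaries_def)
  qed
  finally show ?thesis by (simp add: y_def)
qed

end

section \<open>Augmented complexes with a transitive action\<close>

text \<open>Surjectivity and injectivity of the map on homology induced by \<open>A \<le> B\<close>, on the level of cycles.\<close>

definition homology_iso :: "nat \<Rightarrow> 'g monoid \<Rightarrow> 'g monoid \<Rightarrow> bool" where
  "homology_iso j A B \<longleftrightarrow>
     (\<forall>c \<in> cycles (nerve B) j. \<exists>c' \<in> cycles (nerve A) j. c - c' \<in> boundaries (nerve B) j) \<and>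
     (\<forall>c \<in> cycles (nerve A) j. c \<in> boundaries (nerve B) j \<longrightarrow> c \<in> boundaries (nerve A) j)"

definition bres :: "nat \<Rightarrow> 'g monoid \<Rightarrow> ('g list \<Rightarrow> real) \<Rightarrow> 'g list \<Rightarrow> real" where
  "bres j A f = (\<lambda>s. if s \<in> tuples A (Suc j) then f s else 0)"

definition bcohomology_iso :: "nat \<Rightarrow> 'g monoid \<Rightarrow> 'g monoid \<Rightarrow> bool" where
  "bcohomology_iso j A B \<longleftrightarrow>
     (\<forall>f \<in> bcocycles j A. \<exists>f' \<in> bcocycles j B. f - bres j A f' \<in> bcoboundaries j A) \<and>
     (\<forall>f \<in> bcocycles j B. bres j A f \<in> bcoboundaries j A \<longrightarrow> f \<in> bcoboundaries j B)"

text \<open>The data of one stage of the induction. The \<open>P\<close>-th set \<open>Y P\<close> consists of the \<open>(P - 1)\<close>-simplices, so that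
  \<open>Y 0\<close> is the augmentation point and \<open>fc P i\<close> for \<open>i \<le> P\<close> are the faces from \<open>Y (P + 1)\<close> to \<open>Y P\<close>.
  To treat degree \<open>q\<close>, the chase passes through the columns up to \<open>q + 2\<close> and compares each of them
  with the next one; this accounts for the bound \<open>q + 3\<close>.\<close>

locale aug_complex = group G for G :: "'g monoid" (structure) +
  fixes Y :: "nat \<Rightarrow> 'y set" and act :: "nat \<Rightarrow> 'g \<Rightarrow> 'y \<Rightarrow> 'y" and fc :: "nat \<Rightarrow> nat \<Rightarrow> 'y \<Rightarrow> 'y"
    and ob :: "nat \<Rightarrow> 'y" and K :: "nat \<Rightarrow> 'g monoid" and w :: "nat \<Rightarrow> nat \<Rightarrow> 'g" and q :: nat
  assumes gset: "gset G (Y P) (act P)"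
    and fc_in: "i \<le> P \<Longrightarrow> y \<in> Y (Suc P) \<Longrightarrow> fc P i y \<in> Y P"
    and fc_fc: "i < j \<Longrightarrow> j \<le> Suc P \<Longrightarrow> y \<in> Y (Suc (Suc P)) \<Longrightarrow>
          fc P i (fc (Suc P) j y) = fc P (j - 1) (fc (Suc P) i y)"
    and fc_act: "i \<le> P \<Longrightarrow> g \<in> carrier G \<Longrightarrow> y \<in> Y (Suc P) \<Longrightarrow> fc P i (act (Suc P) g y) = act P g (fc P i y)"
    and orbit: "P \<le> q + 3 \<Longrightarrow> transitive_gset G (Y P) (act P) (K P) (ob P)"
    and K_sub: "P \<le> q + 2 \<Longrightarrow> carrier (K (Suc P)) \<subseteq> carrier (K P)"
    and w_in: "P \<le> q + 2 \<Longrightarrow> i \<le> P \<Longrightarrow> w P i \<in> carrier G"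
    and fc_ob: "P \<le> q + 2 \<Longrightarrow> i \<le> P \<Longrightarrow> fc P i (ob (Suc P)) = act P (inv (w P i)) (ob P)"
    and w_commute: "P \<le> q + 2 \<Longrightarrow> i \<le> P \<Longrightarrow> h \<in> carrier (K (Suc P)) \<Longrightarrow> w P i \<otimes> h = h \<otimes> w P i"
begin

lemma fixed_point: "P \<le> q + 3 \<Longrightarrow> fixed_point_gset G (Y P) (act P) (K P) (ob P)"
  using orbit by (simp add: transitive_gset_def)

lemma sectioned:
  assumes "P \<le> q + 3"
  shows "\<exists>\<sigma>. sectioned_gset G (Y P) (act P) (K P) (ob P) \<sigma>"
  using transitive_gset.section_through[OF orbit[OF assms] one_closed] by blast

lemma K_subgroup: "P \<le> q + 3 \<Longrightarrow> subgroup_of (K P) G"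
  using fixed_point_gset.K[OF fixed_point] .

definition ydelta :: "nat \<Rightarrow> ('y \<Rightarrow>\<^sub>0 int) \<Rightarrow> ('y \<Rightarrow>\<^sub>0 int)" where
  "ydelta P = frag_extend (\<lambda>y. alt_sum P (\<lambda>i. frag_of (fc P i y)))"

definition hor :: "nat \<Rightarrow> ('g list \<times> 'y \<Rightarrow>\<^sub>0 int) \<Rightarrow> ('g list \<times> 'y \<Rightarrow>\<^sub>0 int)" where
  "hor P = frag_extend (\<lambda>(s, y). alt_sum P (\<lambda>i. frag_of (s, fc P i y)))"

abbreviation "C P j \<equiv> bar_chains G (Y P) j"
abbreviation "emb_at P \<equiv> emb (ob P)"
abbreviation "d P j \<equiv> bar_boundary G (act P) j"

lemma hor_diff: "hor P (a - b) = hor P a - hor P b"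
  by (simp add: hor_def frag_extend_diff)

lemma hor_zero [simp]: "hor P 0 = 0"
  by (simp add: hor_def)

lemma additive_hor: "additive (hor P)"
  unfolding hor_def by (rule additive_frag_extend)

lemma additive_d: "additive (d P j)"
  by (cases j) (simp_all add: bar_boundary_def additive_def frag_extend_add)

lemma C_diff: "a \<in> C P j \<Longrightarrow> b \<in> C P j \<Longrightarrow> a - b \<in> C P j"
  unfolding bar_chains_def by (rule frags_diff)

lemma C_add: "a \<in> C P j \<Longrightarrow> b \<in> C P j \<Longrightarrow> a + b \<in> C P j"
  unfolding bar_chains_def by (rule frags_add)

lemma C_zero: "0 \<in> C P j"
  unfolding bar_chains_def by (rule frags_0)

lemma hor_symbol:
  assumes "x \<in> tuples G (Suc j)" "y \<in> Y (Suc P)"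
  shows "hor P (frag_of (bar_symbol G (act (Suc P)) x y))
       = alt_sum P (\<lambda>i. frag_of (bar_symbol G (act P) x (fc P i y)))"
proof -
  have "hd x \<in> carrier G" using gset.hd_in[OF gset] assms tuplesD tuples_Suc_neq_Nil by metis
  then show ?thesis
    using assms by (simp add: hor_def bar_symbol_def fc_act cong: alt_sum_cong)
qed

lemma hor_in: "c \<in> C (Suc P) j \<Longrightarrow> hor P c \<in> C P j"
  unfolding hor_def bar_chains_def
  by (erule frag_extend_in_frags) (auto intro!: alt_sum_in frags_diff fc_in)

lemma hor_hor: "c \<in> C (Suc (Suc P)) j \<Longrightarrow> hor P (hor (Suc P) c) = 0"
  unfolding bar_chains_def
proof (induction c rule: frags_induct)
  case (generator p)
  then obtain s y where p: "p = (s, y)" "y \<in> Y (Suc (Suc P))" by auto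
  have "hor P (hor (Suc P) (frag_of p)) = alt_sum (Suc P) (\<lambda>j. alt_sum P (\<lambda>i. frag_of (s, fc P i (fc (Suc P) j y))))"
    unfolding hor_def p(1) by (simp add: additive.alt_sum[OF additive_frag_extend])
  also have "\<dots> = 0"
    by (rule alt_sum_alt_sum_zero) (simp only: fc_fc[OF _ _ p(2)])
  finally show ?case .
qed (auto simp: hor_diff)

lemma d_hor: "c \<in> C (Suc P) j \<Longrightarrow> d P j (hor P c) = hor P (d (Suc P) j c)"
proof (induction c rule: gset.bar_chains_induct[OF gset, consumes 1, case_names zero symbol diff])
  case (symbol x y)
  show ?case
  proof (cases j)
    case (Suc i)
    have "d P j (hor P (frag_of (bar_symbol G (act (Suc P)) x y)))
        = alt_sum P (\<lambda>k. d P j (frag_of (bar_symbol G (act P) x (fc P k y))))"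
      by (simp only: hor_symbol[OF symbol] additive.alt_sum[OF additive_d])
    also have "\<dots> = alt_sum P (\<lambda>k. omission_sum (\<lambda>t. frag_of (bar_symbol G (act P) t (fc P k y))) x)"
      unfolding Suc
      by (rule alt_sum_cong, rule gset.bar_boundary_symbol[OF gset]) (use symbol Suc fc_in in auto)
    also have "\<dots> = omission_sum (\<lambda>t. alt_sum P (\<lambda>k. frag_of (bar_symbol G (act P) t (fc P k y)))) x"
      by (simp add: omission_sum_alt_sum_swap)
    also have "\<dots> = omission_sum (\<lambda>t. hor P (frag_of (bar_symbol G (act (Suc P)) t y))) x"
      by (rule omission_sum_cong, rule hor_symbol[symmetric, OF tuples_omit[of x]]) (use symbol Suc in auto)
    also have "\<dots> = hor P (d (Suc P) j (frag_of (bar_symbol G (act (Suc P)) x y)))"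
      unfolding Suc gset.bar_boundary_symbol[OF gset symbol[unfolded Suc]]
      by (simp only: additive.omission_sum[OF additive_hor])
    finally show ?thesis .
  qed simp
qed (auto simp: hor_diff bar_boundary_diff)

definition slice :: "'g list \<Rightarrow> ('g list \<times> 'y \<Rightarrow>\<^sub>0 int) \<Rightarrow> ('y \<Rightarrow>\<^sub>0 int)" where
  "slice s = frag_extend (\<lambda>(t, y). if t = s then frag_of y else 0)"

definition unslice :: "'g list \<Rightarrow> ('y \<Rightarrow>\<^sub>0 int) \<Rightarrow> ('g list \<times> 'y \<Rightarrow>\<^sub>0 int)" where
  "unslice s = frag_extend (\<lambda>y. frag_of (s, y))"

lemma slice_in: "c \<in> C P j \<Longrightarrow> slice s c \<in> frags (Y P)"
  unfolding slice_def bar_chains_def by (erule frag_extend_in_frags) auto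

lemma unslice_in: "e \<in> frags (Y P) \<Longrightarrow> s \<in> tuples G j \<Longrightarrow> unslice s e \<in> C P j"
  unfolding unslice_def bar_chains_def by (erule frag_extend_in_frags) auto

lemma slice_hor: "slice s (hor P c) = ydelta P (slice s c)"
proof -
  interpret sl: additive "slice s" unfolding slice_def by (rule additive_frag_extend)
  interpret y: additive "ydelta P" unfolding ydelta_def by (rule additive_frag_extend)
  have "c \<in> frags UNIV" by (simp add: frags_def)
  then show ?thesis
  proof (induction c rule: frags_induct)
    case (generator p)
    obtain t y where p: "p = (t, y)" by (cases p)
    have "slice s (hor P (frag_of p)) = alt_sum P (\<lambda>i. slice s (frag_of (t, fc P i y)))"
      by (simp add: hor_def p sl.alt_sum)
    then show ?case by (auto simp: p slice_def ydelta_def)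
  qed (auto simp: sl.diff y.diff hor_diff sl.zero y.zero)
qed

lemma hor_unslice: "hor P (unslice s e) = unslice s (ydelta P e)"
proof -
  interpret u: additive "unslice s" unfolding unslice_def by (rule additive_frag_extend)
  interpret y: additive "ydelta P" unfolding ydelta_def by (rule additive_frag_extend)
  have "e \<in> frags UNIV" by (simp add: frags_def)
  then show ?thesis
  proof (induction e rule: frags_induct)
    case (generator y)
    have "unslice s (ydelta P (frag_of y)) = alt_sum P (\<lambda>i. unslice s (frag_of (fc P i y)))"
      by (simp add: ydelta_def u.alt_sum)
    then show ?case by (simp add: hor_def unslice_def)
  qed (auto simp: u.diff y.diff hor_diff u.zero y.zero)
qed

lemma sum_unslice_slice:
  assumes "finite S" "c \<in> frags (S \<times> UNIV)"
  shows "(\<Sum>s\<in>S. unslice s (slice s c)) = c"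
  using assms(2)
proof (induction c rule: frags_induct)
  case (generator p)
  then obtain t y where p: "p = (t, y)" "t \<in> S" by auto
  have "(\<Sum>s\<in>S. unslice s (slice s (frag_of p))) = (\<Sum>s\<in>S. if s = t then frag_of p else 0)"
    by (rule sum.cong) (auto simp: slice_def unslice_def p)
  then show ?case using p(2) assms(1) by simp
qed (auto simp: slice_def unslice_def frag_extend_diff sum_subtractf)

text \<open>The rows of the bar complex are direct sums of copies of the augmented chain complex of the
  \<open>\<Delta>\<close>-complex, one for each tuple.\<close>

lemma hor_lift:
  assumes row: "\<And>s. \<exists>e \<in> frags (Y (Suc P)). ydelta P e = slice s c" and c: "c \<in> C P j"
  shows "\<exists>e \<in> C (Suc P) j. hor P e = c"
proof -
  obtain e where e: "\<And>s. e s \<in> frags (Y (Suc P))" "\<And>s. ydelta P (e s) = slice s c"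
    using row by metis
  define S where "S = fst ` Poly_Mapping.keys c"
  have S: "finite S" "S \<subseteq> tuples G j" "c \<in> frags (S \<times> UNIV)"
    using c by (force simp: S_def bar_chains_def frags_def)+
  have "hor P (\<Sum>s\<in>S. unslice s (e s)) = (\<Sum>s\<in>S. unslice s (slice s c))"
    by (simp add: additive.sum[OF additive_hor] hor_unslice e)
  also have "\<dots> = c" using S by (simp add: sum_unslice_slice)
  finally have "hor P (\<Sum>s\<in>S. unslice s (e s)) = c" .
  moreover have "(\<Sum>s\<in>T. unslice s (e s)) \<in> C (Suc P) j" if "finite T" "T \<subseteq> S" for T
    using that by induction (use e S unslice_in C_add C_zero in auto)
  ultimately show ?thesis using S(1) by blast
qed

text \<open>The map between adjacent columns on homology. Each of the \<open>P + 1\<close> faces of the base point is a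
  translate of the next base point by an element that centralizes the stabilizer, hence contributes the
  same class up to sign, and an alternating sum of \<open>P + 1\<close> equal terms keeps one of them or none.\<close>

lemma hor_emb_cycle:
  assumes P: "P \<le> q + 2" and c: "c \<in> cycles (nerve (K (Suc P))) j"
  shows "\<exists>f \<in> C P (Suc j). hor P (emb_at (Suc P) c) = (if even P then emb_at P c else 0) + d P (Suc j) f"
proof -
  have "\<exists>f \<in> C P (Suc j). emb (fc P i (ob (Suc P))) c = emb_at P c + d P (Suc j) f" if i: "i \<le> P" for i
    using transitive_gset.translate_homotopic[OF orbit K_subgroup K_sub[OF P] w_in[OF P i] w_commute[OF P i] c] P i
    by (simp add: fc_ob)
  then obtain f where f: "\<And>i. i \<le> P \<Longrightarrow> f i \<in> C P (Suc j)"
    "\<And>i. i \<le> P \<Longrightarrow> emb (fc P i (ob (Suc P))) c = emb_at P c + d P (Suc j) (f i)"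
    by metis
  have "c \<in> frags UNIV" by (simp add: frags_def)
  then have "hor P (emb_at (Suc P) c) = alt_sum P (\<lambda>i. emb (fc P i (ob (Suc P))) c)"
    by (induction c rule: frags_induct) (auto simp: hor_def emb_def frag_extend_diff alt_sum_diff)
  also have "\<dots> = alt_sum P (\<lambda>i. emb_at P c - (- d P (Suc j) (f i)))"
    by (rule alt_sum_cong) (simp add: f)
  also have "\<dots> = (if even P then emb_at P c else 0) + d P (Suc j) (alt_sum P f)"
    unfolding alt_sum_diff alt_sum_const additive.alt_sum[OF additive_d]
    by (simp add: alt_sum_def signed_def sum_negf[symmetric] if_distrib[of uminus] cong: if_cong)
  finally show ?thesis
    using alt_sum_in[of "C P (Suc j)" P f, OF C_zero C_diff] f by blast
qed

lemma shapiro_surjective_at: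
  assumes P: "P \<le> q + 3" and "z \<in> C P j" "d P j z = 0"
  shows "\<exists>c \<in> cycles (nerve (K P)) j. \<exists>f \<in> C P (Suc j). z = emb_at P c + d P (Suc j) f"
  using sectioned[OF P] sectioned_gset.shapiro_surjective assms(2,3) by metis

lemma shapiro_injective_at:
  assumes P: "P \<le> q + 3" and "c \<in> cycles (nerve (K P)) j" "b \<in> C P (Suc j)" "emb_at P c = d P (Suc j) b"
  shows "c \<in> boundaries (nerve (K P)) j"
  using sectioned[OF P] sectioned_gset.shapiro_injective assms(2-4) by metis

lemma cycles_K_mono:
  assumes "P \<le> q + 2"
  shows "cycles (nerve (K (Suc P))) j \<subseteq> cycles (nerve (K P)) j"
proof -
  have "tuples (K (Suc P)) n \<subseteq> tuples (K P) n" for n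
    using K_sub[OF assms] by (auto simp: tuples_def)
  then have ch: "chains (nerve (K (Suc P))) n \<subseteq> (chains (nerve (K P)) n :: ('g list \<Rightarrow>\<^sub>0 int) set)" for n
    unfolding chains_nerve by (rule frags_mono)
  show ?thesis
  proof (cases j)
    case 0
    then show ?thesis using ch by (auto simp: cycles_def)
  next
    case (Suc k)
    have "subgroup_of (K P) G" "subgroup_of (K (Suc P)) G" using K_subgroup assms by auto
    then show ?thesis using ch Suc by (auto simp: cycles_Suc_subgroup_of)
  qed
qed

lemma cycles_diff: "a \<in> cycles X j \<Longrightarrow> b \<in> cycles X j \<Longrightarrow> a - b \<in> cycles X j"
  by (cases j) (auto simp: cycles_def chains_eq_frags frags_diff boundary_diff)

text \<open>The inductive step: only the inclusion \<open>K 1 \<rightarrow> K 0\<close> in degree \<open>q\<close> is new, everything else that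
  the chase needs of stability concerns lower degrees.\<close>

lemma homology_iso_step:
  assumes row0: "\<And>c. c \<in> frags (Y 0) \<Longrightarrow> \<exists>e \<in> frags (Y (Suc 0)). ydelta 0 e = c"
    and row: "\<And>P c. P \<le> Suc q \<Longrightarrow> c \<in> frags (Y (Suc P)) \<Longrightarrow> ydelta P c = 0 \<Longrightarrow>
                \<exists>e \<in> frags (Y (Suc (Suc P))). ydelta (Suc P) e = c"
    and stable: "\<And>j P. j < q \<Longrightarrow> 1 \<le> P \<Longrightarrow> P \<le> q + 2 \<Longrightarrow> homology_iso j (K (Suc P)) (K P)"
  shows "homology_iso q (K (Suc 0)) (K 0)"
proof -
  interpret chain_double_complex C d hor q
  proof
    fix P j x assume x: "x \<in> C 0 j"
    show "\<exists>y \<in> C (Suc 0) j. hor 0 y = x"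
      by (rule hor_lift[OF row0[OF slice_in[OF x]] x])
  next
    fix P j x assume P: "P \<le> Suc q" and x: "x \<in> C (Suc P) j" "hor P x = 0"
    have "ydelta P (slice s x) = 0" for s
      using slice_hor[of s P x] x(2) by (simp add: slice_def)
    then show "\<exists>y \<in> C (Suc (Suc P)) j. hor (Suc P) y = x"
      using P x(1) by (intro hor_lift row slice_in[OF x(1)])
  next
    fix j P z b
    assume j: "j < q" and P: "P \<le> q" and z: "z \<in> C (Suc (Suc P)) j" "d (Suc (Suc P)) j z = 0"
      and b: "b \<in> C (Suc P) (Suc j)" "hor (Suc P) z = d (Suc P) (Suc j) b"
    define Q where "Q = Suc (Suc P)"
    have Q: "Q \<le> q + 3" "Q \<le> q + 2" "Suc P \<le> q + 3" "Suc P \<le> q + 2" "Suc Q \<le> q + 3" using P by (auto simp: Q_def)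
    obtain c f where c: "c \<in> cycles (nerve (K Q)) j" and f: "f \<in> C Q (Suc j)"
      and z_eq: "z = emb_at Q c + d Q (Suc j) f"
      using shapiro_surjective_at[OF Q(1)] z unfolding Q_def by blast
    show "\<exists>e \<in> C (Suc (Suc (Suc P))) j. \<exists>f \<in> C (Suc (Suc P)) (Suc j).
            d (Suc (Suc (Suc P))) j e = 0 \<and> z = hor (Suc (Suc P)) e + d (Suc (Suc P)) (Suc j) f"
    proof (cases "even Q")
      case True
      \<comment> \<open>Column \<open>Q + 1\<close> maps to column \<open>Q\<close> by an inclusion, which is surjective on \<open>H\<^sub>j\<close>.\<close>
      obtain c' where c': "c' \<in> cycles (nerve (K (Suc Q))) j" "c - c' \<in> boundaries (nerve (K Q)) j"
        using stable[OF j, of Q] Q c by (auto simp: homology_iso_def Q_def)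
      obtain g where g: "g \<in> C Q (Suc j)" "emb_at Q (c - c') = d Q (Suc j) g"
        using fixed_point_gset.emb_bounds[OF fixed_point[OF Q(1)] c'(2)] by blast
      obtain k where k: "k \<in> C Q (Suc j)" "hor Q (emb_at (Suc Q) c') = emb_at Q c' + d Q (Suc j) k"
        using hor_emb_cycle[OF Q(2) c'(1)] True by auto
      have "z = hor Q (emb_at (Suc Q) c') + (d Q (Suc j) g - d Q (Suc j) k + d Q (Suc j) f)"
        using z_eq g(2) k(2) by (simp add: emb_diff algebra_simps)
      also have "d Q (Suc j) g - d Q (Suc j) k + d Q (Suc j) f = d Q (Suc j) (g - k + f)"
        by (simp add: additive.add[OF additive_d] additive.diff[OF additive_d])
      finally have "z = hor Q (emb_at (Suc Q) c') + d Q (Suc j) (g - k + f)" .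
      moreover have "g - k + f \<in> C Q (Suc j)" using g k f by (intro C_add C_diff)
      ultimately show ?thesis
        using fixed_point_gset.emb_cycle[OF fixed_point[OF Q(5)] c'(1)] unfolding Q_def by blast
    next
      case False
      \<comment> \<open>Column \<open>Q\<close> maps to column \<open>Q - 1\<close> by an inclusion, which is injective on \<open>H\<^sub>j\<close>.\<close>
      obtain k where k: "k \<in> C (Suc P) (Suc j)" "hor (Suc P) (emb_at Q c) = emb_at (Suc P) c + d (Suc P) (Suc j) k"
        using hor_emb_cycle[OF Q(4), of c j] c False by (auto simp: Q_def)
      have "d (Suc P) (Suc j) (hor (Suc P) f) = hor (Suc P) (d Q (Suc j) f)"
        using d_hor f by (simp add: Q_def)
      then have "emb_at (Suc P) c = d (Suc P) (Suc j) (b - k - hor (Suc P) f)"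
        using b(2) k(2) z_eq
        by (simp only: additive.add[OF additive_hor] bar_boundary_diff) (simp add: algebra_simps)
      moreover have "b - k - hor (Suc P) f \<in> C (Suc P) (Suc j)"
        using b k f by (intro C_diff hor_in) (auto simp: Q_def)
      ultimately have "c \<in> boundaries (nerve (K (Suc P))) j"
        using shapiro_injective_at[OF Q(3)] cycles_K_mono[OF Q(4)] c unfolding Q_def by blast
      then have "c \<in> boundaries (nerve (K Q)) j"
        using stable[OF j, of "Suc P"] Q c by (auto simp: homology_iso_def Q_def)
      then obtain g where g: "g \<in> C Q (Suc j)" "emb_at Q c = d Q (Suc j) g"
        using fixed_point_gset.emb_bounds[OF fixed_point[OF Q(1)]] by blast
      have "z = hor Q 0 + d Q (Suc j) (g + f)"
        using z_eq g(2) by (simp add: additive.add[OF additive_d])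
      then show ?thesis
        using C_zero C_add[OF g(1) f] bar_boundary_zero unfolding Q_def by blast
    qed
  next
    fix z assume z: "z \<in> C (Suc (Suc 0)) q" "d (Suc (Suc 0)) q z = 0"
    obtain c f where c: "c \<in> cycles (nerve (K (Suc (Suc 0)))) q" and f: "f \<in> C (Suc (Suc 0)) (Suc q)"
      and z_eq: "z = emb_at (Suc (Suc 0)) c + d (Suc (Suc 0)) (Suc q) f"
      using shapiro_surjective_at[OF _ z] by auto
    obtain k where k: "k \<in> C (Suc 0) (Suc q)" "hor (Suc 0) (emb_at (Suc (Suc 0)) c) = d (Suc 0) (Suc q) k"
      using hor_emb_cycle[of "Suc 0", OF _ c] by auto
    have "hor (Suc 0) z = d (Suc 0) (Suc q) (k + hor (Suc 0) f)"
      using d_hor[OF f] k(2) z_eq by (simp add: additive.add[OF additive_hor] additive.add[OF additive_d])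
    then show "\<exists>f \<in> C (Suc 0) (Suc q). hor (Suc 0) z = d (Suc 0) (Suc q) f"
      using C_add[OF k(1) hor_in[OF f]] by blast
  qed (use gset.bar_boundary_in[OF gset] gset.bar_boundary_boundary[OF gset] in
      \<open>auto simp: C_diff bar_boundary_diff hor_diff hor_in hor_hor d_hor\<close>)
  show ?thesis
    unfolding homology_iso_def
  proof (intro conjI ballI impI)
    fix c assume c: "c \<in> cycles (nerve (K 0)) q"
    obtain y where y: "y \<in> C (Suc 0) q" "d (Suc 0) q y = 0" "hor 0 y = emb_at 0 c"
      using surjective[OF fixed_point_gset.emb_cycle[OF fixed_point c]] by auto
    obtain c' f where c': "c' \<in> cycles (nerve (K (Suc 0))) q" and f: "f \<in> C (Suc 0) (Suc q)"
      and y_eq: "y = emb_at (Suc 0) c' + d (Suc 0) (Suc q) f"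
      using shapiro_surjective_at[OF _ y(1,2)] by auto
    obtain k where k: "k \<in> C 0 (Suc q)" "hor 0 (emb_at (Suc 0) c') = emb_at 0 c' + d 0 (Suc q) k"
      using hor_emb_cycle[of 0, OF _ c'] by auto
    have "emb_at 0 (c - c') = d 0 (Suc q) (k + hor 0 f)"
      using d_hor[OF f] k(2) y(3) y_eq
      by (simp add: emb_diff additive.add[OF additive_hor] additive.add[OF additive_d] algebra_simps)
    moreover have "c - c' \<in> cycles (nerve (K 0)) q" using subsetD[OF cycles_K_mono[of 0] c'] by (intro cycles_diff c) simp
    ultimately have "c - c' \<in> boundaries (nerve (K 0)) q"
      using C_add[OF k(1) hor_in[OF f]] shapiro_injective_at[of 0] by blast
    then show "\<exists>c' \<in> cycles (nerve (K (Suc 0))) q. c - c' \<in> boundaries (nerve (K 0)) q" using c' by blast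
  next
    fix c assume c: "c \<in> cycles (nerve (K (Suc 0))) q" "c \<in> boundaries (nerve (K 0)) q"
    obtain g where g: "g \<in> C 0 (Suc q)" "emb_at 0 c = d 0 (Suc q) g"
      using fixed_point_gset.emb_bounds[OF fixed_point c(2)] by auto
    obtain k where k: "k \<in> C 0 (Suc q)" "hor 0 (emb_at (Suc 0) c) = emb_at 0 c + d 0 (Suc q) k"
      using hor_emb_cycle[of 0, OF _ c(1)] by auto
    have "hor 0 (emb_at (Suc 0) c) = d 0 (Suc q) (g + k)"
      using g k by (simp add: additive.add[OF additive_d])
    then obtain f where "f \<in> C (Suc 0) (Suc q)" "emb_at (Suc 0) c = d (Suc 0) (Suc q) f"
      using injective[OF fixed_point_gset.emb_cycle[OF fixed_point c(1)] C_add[OF g(1) k(1)]] by auto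
    then show "c \<in> boundaries (nerve (K (Suc 0))) q"
      using shapiro_injective_at[OF _ c(1)] by auto
  qed
qed

end

section \<open>The stability step in bounded cohomology\<close>

context aug_complex
begin

abbreviation "E P j \<equiv> eq_cochains G (Y P) (act P) j"
abbreviation "\<delta> P j \<equiv> eq_differential G (Y P) j"

definition cohor :: "nat \<Rightarrow> ('g list \<Rightarrow> 'y \<Rightarrow> real) \<Rightarrow> 'g list \<Rightarrow> 'y \<Rightarrow> real" where
  "cohor P F = (\<lambda>x y. if y \<in> Y (Suc P) then alt_sum P (\<lambda>i. F x (fc P i y)) else 0)"

abbreviation "restr_at P \<equiv> restr (K P) (ob P)"

lemma cohor_diff: "cohor P (F - F') = cohor P F - cohor P F'"
  by (intro ext) (simp add: cohor_def alt_sum_diff)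

lemma cohor_in:
  assumes F: "F \<in> E P j"
  shows "cohor P F \<in> E (Suc P) j"
proof -
  obtain B where B: "\<forall>x \<in> tuples G (Suc j). \<forall>y \<in> Y P. \<bar>F x y\<bar> \<le> B"
    using eq_cochains_bound[OF F] by blast
  show ?thesis
  proof (rule eq_cochainsI[where B = "real (Suc P) * B"])
    fix x y assume "\<not> (x \<in> tuples G (Suc j) \<and> y \<in> Y (Suc P))"
    then show "cohor P F x y = 0" using eq_cochains_outside[OF F, of x] by (auto simp: cohor_def)
  next
    fix x y assume x: "x \<in> tuples G (Suc j)" and y: "y \<in> Y (Suc P)"
    have "\<bar>alt_sum P (\<lambda>i. F x (fc P i y))\<bar> \<le> real (Suc P) * B"
      by (rule alt_sum_bound, rule B[rule_format, OF x fc_in[OF _ y]])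
    then show "\<bar>cohor P F x y\<bar> \<le> real (Suc P) * B" using y by (simp add: cohor_def)
    fix g assume g: "g \<in> carrier G"
    have "alt_sum P (\<lambda>i. F (map (\<lambda>z. g \<otimes> z) x) (fc P i (act (Suc P) g y))) = alt_sum P (\<lambda>i. F x (fc P i y))"
    proof (rule alt_sum_cong)
      fix i assume i: "i \<le> P"
      show "F (map (\<lambda>z. g \<otimes> z) x) (fc P i (act (Suc P) g y)) = F x (fc P i y)"
        using eq_cochains_invariant[OF F g x fc_in[OF i y]] fc_act[OF i g y] by simp
    qed
    then show "cohor P F (map (\<lambda>z. g \<otimes> z) x) (act (Suc P) g y) = cohor P F x y"
      using y gset.act_in[OF gset g y] by (simp add: cohor_def)
  qed
qed

lemma cohor_cohor: "cohor (Suc P) (cohor P F) = 0"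
proof (intro ext)
  fix x y
  have "alt_sum (Suc P) (\<lambda>j. alt_sum P (\<lambda>i. F x (fc P i (fc (Suc P) j y)))) = 0" if "y \<in> Y (Suc (Suc P))"
    by (rule alt_sum_alt_sum_zero) (simp only: fc_fc[OF _ _ that])
  moreover have "alt_sum (Suc P) (\<lambda>j. cohor P F x (fc (Suc P) j y))
      = alt_sum (Suc P) (\<lambda>j. alt_sum P (\<lambda>i. F x (fc P i (fc (Suc P) j y))))" if "y \<in> Y (Suc (Suc P))"
    by (rule alt_sum_cong) (simp add: cohor_def fc_in[OF _ that])
  ultimately show "cohor (Suc P) (cohor P F) x y = 0 x y"
    by (simp add: cohor_def[of "Suc P"])
qed

lemma differential_cohor: "\<delta> (Suc P) j (cohor P F) = cohor P (\<delta> P j F)"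
proof (intro ext)
  fix x y
  show "\<delta> (Suc P) j (cohor P F) x y = cohor P (\<delta> P j F) x y"
  proof (cases "x \<in> tuples G (Suc (Suc j)) \<and> y \<in> Y (Suc P)")
    case True
    then have y: "y \<in> Y (Suc P)" by simp
    have "omission_sum (\<lambda>t. alt_sum P (\<lambda>i. F t (fc P i y))) x = alt_sum P (\<lambda>i. omission_sum (\<lambda>t. F t (fc P i y)) x)"
      by (rule omission_sum_alt_sum_swap)
    also have "\<dots> = alt_sum P (\<lambda>i. \<delta> P j F x (fc P i y))"
      by (rule alt_sum_cong) (use True fc_in[OF _ y] in \<open>simp add: eq_differential_def\<close>)
    finally show ?thesis using True by (simp add: eq_differential_def[of G "Y (Suc P)"] cohor_def)
  qed (auto simp: eq_differential_def cohor_def)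
qed

text \<open>Exactness with control of norms. The constant \<open>c\<close> must not depend on \<open>f\<close>, because primitives
  of infinitely many functions are assembled into one bounded cochain.\<close>

definition row_exact :: "nat \<Rightarrow> bool" where
  "row_exact P \<longleftrightarrow> (\<exists>c. \<forall>B f. 0 \<le> B \<longrightarrow> (\<forall>y \<in> Y (Suc P). \<bar>f y\<bar> \<le> B) \<longrightarrow>
     (\<forall>z \<in> Y (Suc (Suc P)). alt_sum (Suc P) (\<lambda>i. f (fc (Suc P) i z)) = 0) \<longrightarrow>
     (\<exists>e::'y \<Rightarrow> real. (\<forall>y \<in> Y P. \<bar>e y\<bar> \<le> c * B) \<and> (\<forall>y \<in> Y (Suc P). alt_sum P (\<lambda>i. e (fc P i y)) = f y)))"

text \<open>Equivariant cochains are determined by their values on tuples with first entry \<open>1\<close>, and these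
  values are arbitrary. For each such tuple a primitive of the same norm bound is chosen.\<close>

lemma cohor_exact:
  assumes row: "row_exact P" and F: "F \<in> E (Suc P) j" "cohor (Suc P) F = 0"
  shows "\<exists>F' \<in> E P j. cohor P F' = F"
proof -
  obtain c where c: "\<And>B f. 0 \<le> B \<Longrightarrow> (\<forall>y \<in> Y (Suc P). \<bar>f y\<bar> \<le> B) \<Longrightarrow>
     (\<forall>z \<in> Y (Suc (Suc P)). alt_sum (Suc P) (\<lambda>i. f (fc (Suc P) i z)) = 0) \<Longrightarrow>
     (\<exists>e::'y \<Rightarrow> real. (\<forall>y \<in> Y P. \<bar>e y\<bar> \<le> c * B) \<and> (\<forall>y \<in> Y (Suc P). alt_sum P (\<lambda>i. e (fc P i y)) = f y))"
    using row unfolding row_exact_def by metis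
  obtain B' where B': "\<forall>x \<in> tuples G (Suc j). \<forall>y \<in> Y (Suc P). \<bar>F x y\<bar> \<le> B'"
    using eq_cochains_bound[OF F(1)] by blast
  define B where "B = max 0 B'"
  have B0: "0 \<le> B" and B: "\<forall>x \<in> tuples G (Suc j). \<forall>y \<in> Y (Suc P). \<bar>F x y\<bar> \<le> B"
    using B' by (force simp: B_def)+
  have "\<exists>e::'y \<Rightarrow> real. (\<forall>y \<in> Y P. \<bar>e y\<bar> \<le> c * B) \<and>
      (\<forall>y \<in> Y (Suc P). alt_sum P (\<lambda>i. e (fc P i y)) = F (partial_products G \<one> s) y)"
    if s: "s \<in> tuples G j" for s
  proof (rule c[OF B0])
    have "partial_products G \<one> s \<in> tuples G (Suc j)"
      using set_partial_products[of \<one> s] s by (auto simp: tuples_def)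
    then show "\<forall>y \<in> Y (Suc P). \<bar>F (partial_products G \<one> s) y\<bar> \<le> B" using B by blast
    show "\<forall>z \<in> Y (Suc (Suc P)). alt_sum (Suc P) (\<lambda>i. F (partial_products G \<one> s) (fc (Suc P) i z)) = 0"
    proof
      fix z assume "z \<in> Y (Suc (Suc P))"
      then show "alt_sum (Suc P) (\<lambda>i. F (partial_products G \<one> s) (fc (Suc P) i z)) = 0"
        using fun_cong[OF fun_cong[OF F(2)], of "partial_products G \<one> s" z] by (simp add: cohor_def)
    qed
  qed
  then obtain e :: "'g list \<Rightarrow> 'y \<Rightarrow> real" where e: "\<And>s y. s \<in> tuples G j \<Longrightarrow> y \<in> Y P \<Longrightarrow> \<bar>e s y\<bar> \<le> c * B"
    "\<And>s y. s \<in> tuples G j \<Longrightarrow> y \<in> Y (Suc P) \<Longrightarrow>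
        alt_sum P (\<lambda>i. e s (fc P i y)) = F (partial_products G \<one> s) y"
    by metis
  define F' where "F' = (\<lambda>x y. if x \<in> tuples G (Suc j) \<and> y \<in> Y P
                               then (case bar_symbol G (act P) x y of (s, z) \<Rightarrow> e s z) else 0)"
  have x0: "hd x \<in> carrier G" "x \<noteq> []" "quotients G x \<in> tuples G j" if "x \<in> tuples G (Suc j)" for x
    using gset.hd_in[OF gset] that tuplesD tuples_Suc_neq_Nil group_quotients_in_tuples[OF is_group] by metis+
  have "F' \<in> E P j"
  proof (rule eq_cochainsI[where B = "c * B"])
    fix x y assume x: "x \<in> tuples G (Suc j)" and y: "y \<in> Y P"
    show "\<bar>F' x y\<bar> \<le> c * B"
      using gset.bar_symbol_in[OF gset x y] x y e(1) by (auto simp: F'_def)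
    fix g assume g: "g \<in> carrier G"
    show "F' (map (\<lambda>z. g \<otimes> z) x) (act P g y) = F' x y"
      using gset.bar_symbol_mult[OF gset tuplesD(2)[OF x] x0(2)[OF x] g y] x y g
        gset.map_mult_in[OF gset g x] gset.act_in[OF gset g y] by (simp add: F'_def)
  qed (auto simp: F'_def)
  moreover have "cohor P F' = F"
  proof (intro ext)
    fix x y
    show "cohor P F' x y = F x y"
    proof (cases "x \<in> tuples G (Suc j) \<and> y \<in> Y (Suc P)")
      case True
      then have x: "x \<in> tuples G (Suc j)" and y: "y \<in> Y (Suc P)" by auto
      define u where "u = inv (hd x)"
      have u: "u \<in> carrier G" using x0[OF x] by (simp add: u_def)
      have uy: "act (Suc P) u y \<in> Y (Suc P)" using gset.act_in[OF gset u y] .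
      have "alt_sum P (\<lambda>i. F' x (fc P i y)) = alt_sum P (\<lambda>i. e (quotients G x) (fc P i (act (Suc P) u y)))"
      proof (rule alt_sum_cong)
        fix i assume i: "i \<le> P"
        show "F' x (fc P i y) = e (quotients G x) (fc P i (act (Suc P) u y))"
          using x fc_in[OF i y] fc_act[OF i u y] by (simp add: F'_def bar_symbol_def u_def)
      qed
      also have "\<dots> = F (map (\<lambda>z. u \<otimes> z) x) (act (Suc P) u y)"
        using e(2)[OF x0(3)[OF x] uy] partial_products_one_quotients[OF tuplesD(2)[OF x] x0(2)[OF x]]
        by (simp add: u_def)
      also have "\<dots> = F x y" using eq_cochains_invariant[OF F(1) u x y] .
      finally show ?thesis using y by (simp add: cohor_def)
    next
      case False
      then have "F x y = 0" using eq_cochains_outside[OF F(1)] by blast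
      with False show ?thesis by (auto simp: cohor_def F'_def)
    qed
  qed
  ultimately show ?thesis by blast
qed

text \<open>The dual of \<open>hor_emb_cycle\<close>.\<close>

lemma restr_cohor:
  assumes P: "P \<le> q + 2" and F: "F \<in> E P j" "\<delta> P j F = 0"
  shows "(if even P then bres j (K (Suc P)) (restr_at P j F) else 0) - restr_at (Suc P) j (cohor P F)
           \<in> bcoboundaries j (K (Suc P))"
proof -
  have ob1: "ob (Suc P) \<in> Y (Suc P)" using fixed_point_gset.ob[OF fixed_point] P by simp
  define k where "k i = restr (K (Suc P)) (ob P) j F - restr (K (Suc P)) (fc P i (ob (Suc P))) j F" for i
  have "k i \<in> bcoboundaries j (K (Suc P))" if i: "i \<le> P" for i
    using transitive_gset.translate_cohomologous[OF orbit K_subgroup K_sub[OF P] w_in[OF P i] w_commute[OF P i] F] P i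
    by (simp add: k_def fc_ob)
  then have "alt_sum P k \<in> bcoboundaries j (K (Suc P))"
    by (intro alt_sum_in[OF bcoboundaries_0 bcoboundaries_diff])
  moreover have "alt_sum P k = (if even P then bres j (K (Suc P)) (restr_at P j F) else 0)
      - restr_at (Suc P) j (cohor P F)"
  proof (rule ext)
    fix s
    have "s \<in> tuples (K P) (Suc j)" if "s \<in> tuples (K (Suc P)) (Suc j)"
      using that K_sub[OF P] by (auto simp: tuples_def)
    then show "alt_sum P k s = ((if even P then bres j (K (Suc P)) (restr_at P j F) else 0)
      - restr_at (Suc P) j (cohor P F)) s"
      using ob1 by (simp add: alt_sum_apply[of P k] k_def bres_def restr_def cohor_def alt_sum_diff alt_sum_const)
  qed
  ultimately show ?thesis by simp
qed

lemma coshapiro_injective_at: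
  assumes "P \<le> q + 3" "F \<in> E P j" "\<delta> P j F = 0" "restr_at P j F \<in> bcoboundaries j (K P)"
  shows "F \<in> eq_coboundaries G (Y P) (act P) j"
  using sectioned[OF assms(1)] sectioned_gset.coshapiro_injective assms(2-4) by metis

lemma coshapiro_surjective_at:
  assumes "P \<le> q + 3" "f \<in> bcocycles j (K P)"
  shows "\<exists>F \<in> E P j. \<delta> P j F = 0 \<and> restr_at P j F = f"
  using sectioned[OF assms(1)] sectioned_gset.coshapiro_surjective assms(2) by metis

text \<open>Exactness at the left end of the rows: as \<open>G\<close> acts transitively, a function on \<open>Y 0\<close> is determined by
  its pullback to \<open>Y 1\<close>.\<close>

lemma augmentation_onto: "y \<in> Y 0 \<Longrightarrow> \<exists>z \<in> Y (Suc 0). fc 0 0 z = y"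
proof -
  assume y: "y \<in> Y 0"
  interpret O: transitive_gset G "Y 0" "act 0" "K 0" "ob 0" using orbit by simp
  have ob1: "ob (Suc 0) \<in> Y (Suc 0)" using fixed_point_gset.ob[OF fixed_point] by simp
  obtain g where g: "g \<in> carrier G" "act 0 g (ob 0) = y" using O.orbit y by blast
  have w: "w 0 0 \<in> carrier G" using w_in by simp
  have "fc 0 0 (act (Suc 0) (g \<otimes> w 0 0) (ob (Suc 0))) = act 0 (g \<otimes> w 0 0) (act 0 (inv (w 0 0)) (ob 0))"
    using fc_act[of 0 0 "g \<otimes> w 0 0"] fc_ob[of 0 0] g w ob1 by simp
  also have "\<dots> = y" using g w O.act_mult O.act_in O.ob O.act_act_inv by simp
  finally show ?thesis using gset.act_in[OF gset _ ob1] g w by blast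
qed

lemma bcohomology_iso_step:
  assumes row: "\<And>P. P \<le> q \<Longrightarrow> row_exact P"
    and stable: "\<And>j P. j < q \<Longrightarrow> 1 \<le> P \<Longrightarrow> P \<le> q + 2 \<Longrightarrow> bcohomology_iso j (K (Suc P)) (K P)"
  shows "bcohomology_iso q (K (Suc 0)) (K 0)"
proof -
  interpret cochain_double_complex E \<delta> cohor "\<lambda>P j. eq_coboundaries G (Y P) (act P) j" q
  proof
    fix P j F assume F: "F \<in> E 0 j" "cohor 0 F = 0"
    show "F = 0"
    proof (intro ext)
      fix x y
      show "F x y = 0 x y"
      proof (cases "y \<in> Y 0")
        case True
        then obtain z where z: "z \<in> Y (Suc 0)" "fc 0 0 z = y" using augmentation_onto by blast
        then show ?thesis using fun_cong[OF fun_cong[OF F(2)], of x z]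
          by (simp add: cohor_def alt_sum_def signed_def)
      qed (use eq_cochains_outside[OF F(1)] in auto)
    qed
  next
    fix P j F assume "P \<le> q" "F \<in> E (Suc P) j" "cohor (Suc P) F = 0"
    then show "\<exists>F' \<in> E P j. cohor P F' = F" using cohor_exact row by blast
  next
    fix j P z
    assume j: "j < q" and P: "P \<le> q" and z: "z \<in> E (Suc (Suc P)) j" "\<delta> (Suc (Suc P)) j z = 0"
      and zz: "cohor (Suc (Suc P)) z = 0"
    define Q where "Q = Suc (Suc P)"
    have Q: "Q \<le> q + 3" "Q \<le> q + 2" "Suc P \<le> q + 3" "Suc P \<le> q + 2" "Suc Q \<le> q + 3"
      using P by (auto simp: Q_def)
    note z = z[folded Q_def] and zz = zz[folded Q_def]
    have rz: "restr_at Q j z \<in> bcocycles j (K Q)" using fixed_point_gset.restr_cocycle[OF fixed_point[OF Q(1)] z] .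
    show "\<exists>e \<in> E (Suc P) j. \<delta> (Suc P) j e = 0 \<and>
        z - cohor (Suc P) e \<in> eq_coboundaries G (Y (Suc (Suc P))) (act (Suc (Suc P))) j"
    proof (cases "even Q")
      case True
      \<comment> \<open>Column \<open>Q\<close> maps to column \<open>Q + 1\<close> by an injective restriction, so that \<open>e = 0\<close> works.\<close>
      have "restr_at (Suc Q) j (cohor Q z) = 0" by (simp add: zz restr_0)
      then have "bres j (K (Suc Q)) (restr_at Q j z) \<in> bcoboundaries j (K (Suc Q))"
        using restr_cohor[OF Q(2) z] True by simp
      then have "restr_at Q j z \<in> bcoboundaries j (K Q)"
        using stable[OF j, of Q] Q rz by (auto simp: bcohomology_iso_def Q_def)
      then have "z \<in> eq_coboundaries G (Y Q) (act Q) j" using coshapiro_injective_at[OF Q(1) z] by simp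
      moreover have "cohor (Suc P) 0 = 0" using cohor_diff[of "Suc P" 0 0] by simp
      ultimately show ?thesis
        by (intro bexI[of _ 0]) (simp_all add: eq_cochains_0 Q_def)
    next
      case False
      \<comment> \<open>Column \<open>Q - 1\<close> maps to column \<open>Q\<close> by a surjective restriction, which provides \<open>e\<close>.\<close>
      obtain f' where f': "f' \<in> bcocycles j (K (Suc P))" "restr_at Q j z - bres j (K Q) f' \<in> bcoboundaries j (K Q)"
        using stable[OF j, of "Suc P"] Q rz by (auto simp: bcohomology_iso_def Q_def)
      obtain e where e: "e \<in> E (Suc P) j" "\<delta> (Suc P) j e = 0" "restr_at (Suc P) j e = f'"
        using coshapiro_surjective_at[OF Q(3) f'(1)] by blast
      have "bres j (K Q) f' - restr_at Q j (cohor (Suc P) e) \<in> bcoboundaries j (K Q)"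
        using restr_cohor[OF Q(4) e(1,2)] e(3) False by (simp add: Q_def)
      from bcoboundaries_add[OF f'(2) this]
      have "restr_at Q j (z - cohor (Suc P) e) \<in> bcoboundaries j (K Q)"
        by (simp add: restr_diff)
      moreover have "cohor (Suc P) e \<in> E Q j" using cohor_in[OF e(1)] by (simp add: Q_def)
      moreover have "\<delta> Q j (cohor (Suc P) e) = 0"
        using differential_cohor[of "Suc P" j e] e(2) cohor_diff[of "Suc P" 0 0] by (simp add: Q_def)
      ultimately have "z - cohor (Suc P) e \<in> eq_coboundaries G (Y Q) (act Q) j"
        using z by (intro coshapiro_injective_at[OF Q(1)] eq_cochains_diff) (simp_all add: eq_differential_diff)
      then show ?thesis
        using e unfolding Q_def by blast
    qed
  next
    fix z assume z: "z \<in> E (Suc 0) q" "\<delta> (Suc 0) q z = 0"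
    have "0 - restr_at (Suc (Suc 0)) q (cohor (Suc 0) z) \<in> bcoboundaries q (K (Suc (Suc 0)))"
      using restr_cohor[of "Suc 0", OF _ z] by simp
    from bcoboundaries_diff[OF bcoboundaries_0 this]
    have "restr_at (Suc (Suc 0)) q (cohor (Suc 0) z) \<in> bcoboundaries q (K (Suc (Suc 0)))" by simp
    moreover have "\<delta> (Suc (Suc 0)) q (cohor (Suc 0) z) = 0"
      using differential_cohor[of "Suc 0" q z] z(2) cohor_diff[of "Suc 0" 0 0] by simp
    ultimately show "cohor (Suc 0) z \<in> eq_coboundaries G (Y (Suc (Suc 0))) (act (Suc (Suc 0))) q"
      using cohor_in[OF z(1)] by (intro coshapiro_injective_at) simp_all
  next
    fix P j
    show "E P j \<noteq> {}" using eq_cochains_0 by blast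
  qed (simp_all add: eq_cochains_diff eq_differential_diff cohor_diff gset.eq_differential_in[OF gset]
      gset.eq_differential_differential[OF gset] eq_coboundaries_def cohor_in cohor_cohor differential_cohor)
  have res0: "bres q (K (Suc 0)) (restr_at 0 q F) - restr_at (Suc 0) q (cohor 0 F) \<in> bcoboundaries q (K (Suc 0))"
    if "F \<in> E 0 q" "\<delta> 0 q F = 0" for F
    using restr_cohor[of 0, OF _ that] by simp
  show ?thesis
    unfolding bcohomology_iso_def
  proof (intro conjI ballI impI)
    fix f assume f: "f \<in> bcocycles q (K 0)" "bres q (K (Suc 0)) f \<in> bcoboundaries q (K (Suc 0))"
    obtain F where F: "F \<in> E 0 q" "\<delta> 0 q F = 0" "restr_at 0 q F = f"
      using coshapiro_surjective_at[of 0, OF _ f(1)] by auto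
    have "restr_at (Suc 0) q (cohor 0 F) \<in> bcoboundaries q (K (Suc 0))"
      using bcoboundaries_diff[OF f(2) res0[OF F(1,2)]] F(3) by simp
    moreover have "\<delta> (Suc 0) q (cohor 0 F) = 0"
      using differential_cohor[of 0 q F] F(2) cohor_diff[of 0 0 0] by simp
    ultimately have "cohor 0 F \<in> eq_coboundaries G (Y (Suc 0)) (act (Suc 0)) q"
      using cohor_in[OF F(1)] by (intro coshapiro_injective_at) simp_all
    then have "F \<in> eq_coboundaries G (Y 0) (act 0) q" using injective[OF F(1)] by simp
    then show "f \<in> bcoboundaries q (K 0)" using fixed_point_gset.restr_coboundary[OF fixed_point[of 0]] F(3) by blast
  next
    fix f assume f: "f \<in> bcocycles q (K (Suc 0))"
    obtain F where F: "F \<in> E (Suc 0) q" "\<delta> (Suc 0) q F = 0" "restr_at (Suc 0) q F = f"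
      using coshapiro_surjective_at[of "Suc 0", OF _ f] by auto
    obtain c where c: "c \<in> E 0 q" "\<delta> 0 q c = 0"
      "F - cohor 0 c \<in> eq_coboundaries G (Y (Suc 0)) (act (Suc 0)) q"
      using surjective[OF F(1,2)] by blast
    have "restr_at (Suc 0) q (F - cohor 0 c) - (bres q (K (Suc 0)) (restr_at 0 q c) - restr_at (Suc 0) q (cohor 0 c))
        \<in> bcoboundaries q (K (Suc 0))"
      using fixed_point_gset.restr_coboundary[OF fixed_point[of "Suc 0"] c(3)] by (intro bcoboundaries_diff res0[OF c(1,2)]) simp
    then have "f - bres q (K (Suc 0)) (restr_at 0 q c) \<in> bcoboundaries q (K (Suc 0))"
      using F(3) by (simp add: restr_diff)
    then show "\<exists>f' \<in> bcocycles q (K 0). f - bres q (K (Suc 0)) f' \<in> bcoboundaries q (K (Suc 0))"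
      using fixed_point_gset.restr_cocycle[OF fixed_point[of 0] c(1,2)] by auto
  qed
qed

end

section \<open>The augmented complex of a compatible action\<close>

text \<open>The value \<open>None\<close> is the only simplex of dimension \<open>-1\<close>. Every degree is shifted by one.\<close>

definition aug_simplices :: "'x semisimplicial \<Rightarrow> nat \<Rightarrow> 'x option set" where
  "aug_simplices X P = (case P of 0 \<Rightarrow> {None} | Suc p \<Rightarrow> Some ` simplices X p)"

definition aug_face :: "'x semisimplicial \<Rightarrow> nat \<Rightarrow> nat \<Rightarrow> 'x option \<Rightarrow> 'x option" where
  "aug_face X P i = (case P of 0 \<Rightarrow> (\<lambda>_. None) | Suc p \<Rightarrow> map_option (face X p i))"

definition aug_action :: "(nat \<Rightarrow> 'g \<Rightarrow> 'x \<Rightarrow> 'x) \<Rightarrow> nat \<Rightarrow> 'g \<Rightarrow> 'x option \<Rightarrow> 'x option" where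
  "aug_action \<phi> P g = (case P of 0 \<Rightarrow> id | Suc p \<Rightarrow> map_option (\<phi> p g))"

definition aug_ob :: "(nat \<Rightarrow> 'x) \<Rightarrow> nat \<Rightarrow> 'x option" where
  "aug_ob ob P = (case P of 0 \<Rightarrow> None | Suc p \<Rightarrow> Some (ob p))"

lemmas aug_simps = aug_simplices_def aug_face_def aug_action_def aug_ob_def

lemma group_action_gset:
  assumes "group G" "group_action G S \<phi>"
  shows "gset G S \<phi>"
proof -
  interpret group G by fact
  interpret A: group_action G S \<phi> by fact
  show ?thesis
  proof
    fix g y assume "g \<in> carrier G" "y \<in> S"
    then show "\<phi> g y \<in> S" using A.element_image by blast
  next
    fix y assume "y \<in> S"
    then show "\<phi> \<one>\<^bsub>G\<^esub> y = y" using A.id_eq_one by (metis restrict_apply')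
  next
    fix g h y assume "g \<in> carrier G" "h \<in> carrier G" "y \<in> S"
    then show "\<phi> (g \<otimes>\<^bsub>G\<^esub> h) y = \<phi> g (\<phi> h y)" using A.composition_rule by blast
  qed
qed

lemma aug_gset:
  assumes "group G" "simplicial_action G X \<phi>"
  shows "gset G (aug_simplices X P) (aug_action \<phi> P)"
proof (cases P)
  case 0
  interpret group G by fact
  show ?thesis using 0 by unfold_locales (auto simp: aug_simps)
next
  case (Suc p)
  interpret gset G "simplices X p" "\<phi> p"
    using assms by (intro group_action_gset) (auto simp: simplicial_action_def)
  show ?thesis using Suc by unfold_locales (auto simp: aug_simps act_in act_one act_mult)
qed

lemma single_orbit_transitive:
  assumes A: "gset G S \<phi>" and card: "card (orbits G S \<phi>) = 1" and x: "x \<in> S" and y: "y \<in> S"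
  shows "\<exists>g \<in> carrier G. \<phi> g x = y"
proof -
  interpret gset G S \<phi> by fact
  obtain R where R: "orbits G S \<phi> = {R}" using card by (auto simp: card_1_singleton_iff)
  have "orbit G \<phi> x = R" "orbit G \<phi> y = R" using R x y unfolding orbits_def by blast+
  moreover have "y \<in> orbit G \<phi> y" using act_one[OF y] unfolding orbit_def by force
  ultimately have "y \<in> orbit G \<phi> x" by simp
  then show ?thesis unfolding orbit_def by blast
qed

lemma group_tower_subgroup_of:
  assumes "group_tower G" "m \<le> n"
  shows "subgroup_of (G m) (G n)"
  using assms(2)
proof (induction n rule: dec_induct)
  case base
  then show ?case using assms(1) by (auto simp: subgroup_of_def group_tower_def)
next
  case (step n)
  have "id \<in> mon (G n) (G (Suc n))" using assms(1) by (simp add: group_tower_def)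
  then have "carrier (G n) \<subseteq> carrier (G (Suc n))"
    "\<And>x y. x \<in> carrier (G n) \<Longrightarrow> y \<in> carrier (G n) \<Longrightarrow> x \<otimes>\<^bsub>G n\<^esub> y = x \<otimes>\<^bsub>G (Suc n)\<^esub> y"
    by (auto simp: mon_def hom_def)
  then show ?case using step.IH by (auto simp: subgroup_of_def)
qed

text \<open>The compatibility data, reindexed from dimensions \<open>p \<ge> -1\<close> to columns \<open>P = p + 1\<close>. The bound
  \<open>q + 3 \<le> r\<close> keeps all indices \<open>r - P\<close> nonnegative, so that no stabilizer in the range is one of the
  trivial groups of negative index.\<close>

lemma aug_complex_of_compatible:
  assumes tower: "group_tower G" and X: "delta_complex (X r)" and A: "simplicial_action (G r) (X r) (\<phi> r)"
    and trans: "transitive_upto (\<tau> r) (G r) (X r) (\<phi> r)" and compat: "compatible_stabilizers G X \<phi> \<tau>"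
    and r: "q + 3 \<le> r" and \<tau>: "Fin (q + 2) \<le> \<tau> r"
  shows "\<exists>ob w. aug_complex (G r) (aug_simplices (X r)) (aug_action (\<phi> r)) (aug_face (X r)) ob
            (\<lambda>P. G (r - P)) w q"
proof -
  have G: "group (G r)" using tower by (simp add: group_tower_def)
  interpret group "G r" by fact
  obtain ob w where
    ob: "\<And>p. Fin p \<le> \<tau> r \<Longrightarrow> ob p \<in> simplices (X r) p"
    and st: "\<And>p. - 1 \<le> p \<Longrightarrow> Fin p \<le> map_extended int (\<tau> r) \<Longrightarrow>
        stab_at (G r) (\<phi> r) ob p = tower_at G (int r - p - 1)"
    and w: "\<And>p i. - 1 \<le> p \<Longrightarrow> Fin (p + 1) \<le> map_extended int (\<tau> r) \<Longrightarrow> int i \<le> p + 1 \<Longrightarrow>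
        w p i \<in> carrier (G r) \<and>
        (0 \<le> p \<longrightarrow> face (X r) (nat p) i (ob (Suc (nat p))) = \<phi> r (nat p) (inv\<^bsub>G r\<^esub> w p i) (ob (nat p))) \<and>
        (\<forall>h \<in> stab_at (G r) (\<phi> r) ob (p + 1). w p i \<otimes>\<^bsub>G r\<^esub> h \<otimes>\<^bsub>G r\<^esub> inv\<^bsub>G r\<^esub> w p i = h)"
    using compat[unfolded compatible_stabilizers_def, rule_format, of r] by metis
  have \<tau>': "Fin p \<le> \<tau> r" if "p \<le> q + 2" for p
    using \<tau> that by (cases "\<tau> r") auto
  have \<tau>i: "Fin (int p) \<le> map_extended int (\<tau> r)" if "p \<le> q + 2" for p
    using \<tau>'[OF that] by (cases "\<tau> r") auto
  have stab: "carrier (G (r - Suc p)) = {g \<in> carrier (G r). \<phi> r p g (ob p) = ob p}" if "p \<le> q + 2" for p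
  proof -
    have "nat (int r - int p - 1) = r - Suc p" "\<not> int r - int p - 1 < 0" using r that by auto
    then show ?thesis
      using st[of "int p"] \<tau>i[OF that] by (simp add: stab_at_def tower_at_def stabilizer_def)
  qed
  have w': "w (int P - 1) i \<in> carrier (G r)"
    "\<And>p. P = Suc p \<Longrightarrow> face (X r) p i (ob P) = \<phi> r p (inv\<^bsub>G r\<^esub> w (int P - 1) i) (ob p)"
    "\<And>h. h \<in> carrier (G (r - Suc P)) \<Longrightarrow>
        w (int P - 1) i \<otimes>\<^bsub>G r\<^esub> h \<otimes>\<^bsub>G r\<^esub> inv\<^bsub>G r\<^esub> w (int P - 1) i = h"
    if P: "P \<le> q + 2" and i: "i \<le> P" for P i
  proof -
    have *: "stab_at (G r) (\<phi> r) ob (int P - 1 + 1) = carrier (G (r - Suc P))"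
      by (simp add: stab_at_def stabilizer_def stab[OF P])
    have "- 1 \<le> int P - 1" "Fin (int P - 1 + 1) \<le> map_extended int (\<tau> r)" "int i \<le> int P - 1 + 1"
      using \<tau>i[OF P] i by auto
    note W = w[OF this, unfolded *]
    show "w (int P - 1) i \<in> carrier (G r)" using W by blast
    show "face (X r) p i (ob P) = \<phi> r p (inv\<^bsub>G r\<^esub> w (int P - 1) i) (ob p)" if "P = Suc p" for p
      using W that by simp
    show "w (int P - 1) i \<otimes>\<^bsub>G r\<^esub> h \<otimes>\<^bsub>G r\<^esub> inv\<^bsub>G r\<^esub> w (int P - 1) i = h"
      if "h \<in> carrier (G (r - Suc P))" for h
      using W that by blast
  qed
  have "aug_complex (G r) (aug_simplices (X r)) (aug_action (\<phi> r)) (aug_face (X r)) (aug_ob ob)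
            (\<lambda>P. G (r - P)) (\<lambda>P i. w (int P - 1) i) q"
  proof (rule aug_complex.intro[OF G], rule aug_complex_axioms.intro)
    fix P show "gset (G r) (aug_simplices (X r) P) (aug_action (\<phi> r) P)" by (rule aug_gset[OF G A])
  next
    fix i P y assume "i \<le> P" "y \<in> aug_simplices (X r) (Suc P)"
    then show "aug_face (X r) P i y \<in> aug_simplices (X r) P"
      using X by (cases P) (auto simp: aug_simps delta_complex_def Pi_iff)
  next
    fix i j P y assume "i < j" "j \<le> Suc P" "y \<in> aug_simplices (X r) (Suc (Suc P))"
    then show "aug_face (X r) P i (aug_face (X r) (Suc P) j y) = aug_face (X r) P (j - 1) (aug_face (X r) (Suc P) i y)"
      using X by (cases P) (auto simp: aug_simps delta_complex_def)
  next
    fix i P g y assume "i \<le> P" "g \<in> carrier (G r)" "y \<in> aug_simplices (X r) (Suc P)"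
    then show "aug_face (X r) P i (aug_action (\<phi> r) (Suc P) g y) = aug_action (\<phi> r) P g (aug_face (X r) P i y)"
      using A by (cases P) (auto simp: aug_simps simplicial_action_def)
  next
    fix P assume P: "P \<le> q + 3"
    interpret Y: gset "G r" "aug_simplices (X r) P" "aug_action (\<phi> r) P" by (rule aug_gset[OF G A])
    show "transitive_gset (G r) (aug_simplices (X r) P) (aug_action (\<phi> r) P) (G (r - P)) (aug_ob ob P)"
    proof
      show "subgroup_of (G (r - P)) (G r)" by (rule group_tower_subgroup_of[OF tower]) simp
      show "aug_ob ob P \<in> aug_simplices (X r) P"
        using ob \<tau>' P by (cases P) (auto simp: aug_simps)
      have "carrier (G (r - P)) = {g \<in> carrier (G r). aug_action (\<phi> r) P g (aug_ob ob P) = aug_ob ob P}"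
        using stab[of "P - 1"] P by (cases P) (auto simp: aug_simps)
      then show "\<And>h. h \<in> carrier (G (r - P)) \<Longrightarrow> aug_action (\<phi> r) P h (aug_ob ob P) = aug_ob ob P"
        "\<And>g. g \<in> carrier (G r) \<Longrightarrow> aug_action (\<phi> r) P g (aug_ob ob P) = aug_ob ob P \<Longrightarrow> g \<in> carrier (G (r - P))"
        by auto
      fix y assume y: "y \<in> aug_simplices (X r) P"
      show "\<exists>g \<in> carrier (G r). aug_action (\<phi> r) P g (aug_ob ob P) = y"
      proof (cases P)
        case 0
        then show ?thesis using y by (auto simp: aug_simps)
      next
        case (Suc p)
        have p: "Fin p \<le> \<tau> r" using \<tau>' P Suc by simp
        have "gset (G r) (simplices (X r) p) (\<phi> r p)"
          using A by (intro group_action_gset G) (auto simp: simplicial_action_def)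
        moreover have "card (orbits (G r) (simplices (X r) p) (\<phi> r p)) = 1"
          using trans p by (simp add: transitive_upto_def)
        ultimately show ?thesis
          using single_orbit_transitive[OF _ _ ob[OF p]] y Suc by (fastforce simp: aug_simps)
      qed
    qed
  next
    fix P assume "P \<le> q + 2"
    have "subgroup_of (G (r - Suc P)) (G (r - P))" by (rule group_tower_subgroup_of[OF tower]) simp
    then show "carrier (G (r - Suc P)) \<subseteq> carrier (G (r - P))" by (simp add: subgroup_of_def)
  next
    fix P i assume P: "P \<le> q + 2" "i \<le> P"
    show "w (int P - 1) i \<in> carrier (G r)" using w'[OF P] by blast
    show "aug_face (X r) P i (aug_ob ob (Suc P)) = aug_action (\<phi> r) P (inv\<^bsub>G r\<^esub> w (int P - 1) i) (aug_ob ob P)"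
      using w'(2)[OF P] by (cases P) (auto simp: aug_simps)
    fix h assume h: "h \<in> carrier (G (r - Suc P))"
    then have "h \<in> carrier (G r)" using stab[OF P(1)] by auto
    then show "w (int P - 1) i \<otimes>\<^bsub>G r\<^esub> h = h \<otimes>\<^bsub>G r\<^esub> w (int P - 1) i"
      using w'(1,3)[OF P] h by (metis inv_solve_right' m_closed)
  qed
  then show ?thesis by blast
qed

section \<open>Exactness of the rows\<close>

definition push_Some :: "('x \<Rightarrow>\<^sub>0 int) \<Rightarrow> ('x option \<Rightarrow>\<^sub>0 int)" where
  "push_Some = frag_extend (\<lambda>x. frag_of (Some x))"

definition pull_Some :: "('x option \<Rightarrow>\<^sub>0 int) \<Rightarrow> ('x \<Rightarrow>\<^sub>0 int)" where
  "pull_Some = frag_extend (\<lambda>y. frag_of (the y))"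

lemma pull_push: "pull_Some (push_Some b) = b"
proof -
  have "b \<in> frags UNIV" by (simp add: frags_def)
  then show ?thesis
    by (induction b rule: frags_induct) (auto simp: push_Some_def pull_Some_def frag_extend_diff)
qed

lemma push_pull: "c \<in> frags (Some ` S) \<Longrightarrow> push_Some (pull_Some c) = c"
  by (induction c rule: frags_induct) (auto simp: push_Some_def pull_Some_def frag_extend_diff)

lemma trivial_quotient:
  assumes "trivial_group (A Mod D)" "\<one>\<^bsub>A\<^esub> \<in> D" "c \<in> carrier A" "\<one>\<^bsub>A\<^esub> \<otimes>\<^bsub>A\<^esub> c = c"
  shows "c \<in> D"
proof -
  have "D #>\<^bsub>A\<^esub> c \<in> carrier (A Mod D)"
    using assms(3) by (auto simp: FactGroup_def RCOSETS_def)
  then have "D #>\<^bsub>A\<^esub> c = D" using assms(1) by (simp add: trivial_group_def FactGroup_def)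
  moreover
  have "\<one>\<^bsub>A\<^esub> \<otimes>\<^bsub>A\<^esub> c \<in> D #>\<^bsub>A\<^esub> c" using assms(2) unfolding r_coset_def by blast
  then have "c \<in> D #>\<^bsub>A\<^esub> c" by (simp only: assms(4))
  ultimately show ?thesis by simp
qed

lemma augmentation_diff: "augmentation (a - b) = augmentation a - (augmentation b :: int)"
proof -
  have "augmentation c = (\<Sum>x\<in>S. Poly_Mapping.lookup c x)"
    if "finite S" "Poly_Mapping.keys c \<subseteq> S" for c :: "'a \<Rightarrow>\<^sub>0 int" and S
    unfolding augmentation_def using that by (intro sum.mono_neutral_left) (auto simp: in_keys_iff)
  from this[of "Poly_Mapping.keys a \<union> Poly_Mapping.keys b" "a - b"]
    this[of "Poly_Mapping.keys a \<union> Poly_Mapping.keys b" a]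
    this[of "Poly_Mapping.keys a \<union> Poly_Mapping.keys b" b]
  show ?thesis using keys_diff[of a b] by (simp add: lookup_minus sum_subtractf)
qed

context aug_complex
begin

lemma ydelta_diff: "ydelta P (a - b) = ydelta P a - ydelta P b"
  by (simp add: ydelta_def frag_extend_diff)

end

lemma ydelta_push_Some:
  fixes X :: "'x semisimplicial"
  assumes "aug_complex G (aug_simplices X) act (aug_face X) ob K w q"
  shows "aug_complex.ydelta (aug_face X) (Suc P) (push_Some b) = push_Some (boundary X P b)"
    and "aug_complex.ydelta (aug_face X) 0 (push_Some b) = frag_cmul (augmentation b) (frag_of None)"
proof -
  interpret aug_complex G "aug_simplices X" act "aug_face X" ob K w q by fact
  interpret p: additive "push_Some :: ('x \<Rightarrow>\<^sub>0 int) \<Rightarrow> _"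
    unfolding push_Some_def by (rule additive_frag_extend)
  have b: "b \<in> frags UNIV" by (simp add: frags_def)
  then show "ydelta (Suc P) (push_Some b) = push_Some (boundary X P b)"
  proof (induction b rule: frags_induct)
    case (generator x)
    have "push_Some (boundary X P (frag_of x)) = alt_sum (Suc P) (\<lambda>i. push_Some (frag_of (face X P i x)))"
      by (simp add: boundary_eq_frag_extend p.alt_sum)
    then show ?case by (simp add: push_Some_def ydelta_def) (simp add: aug_face_def)
  qed (auto simp: p.diff ydelta_diff boundary_diff p.zero, simp add: ydelta_def)
  show "ydelta 0 (push_Some b) = frag_cmul (augmentation b) (frag_of None)"
    using b
  proof (induction b rule: frags_induct)
    case (generator x)
    then show ?case
      by (simp add: push_Some_def ydelta_def alt_sum_def signed_def augmentation_def) (simp add: aug_face_def)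
  next
    case (diff a b)
    then show ?case by (simp add: p.diff ydelta_diff augmentation_diff frag_cmul_diff_distrib)
  qed (simp add: p.zero ydelta_def augmentation_def)
qed

text \<open>Up to the shift by one, the rows are the augmented chain complex of \<open>X\<close>, so that acyclicity up to degree
  \<open>q + 1\<close> gives exactness in the columns up to \<open>q + 2\<close>.\<close>

lemma aug_rows_exact:
  fixes X :: "'x semisimplicial"
  assumes aug: "aug_complex G (aug_simplices X) act (aug_face X) ob K w q"
    and acyc: "acyclic_upto n X" and n: "Fin (Suc q) \<le> n"
  shows "c \<in> frags (aug_simplices X 0) \<Longrightarrow>
      \<exists>e \<in> frags (aug_simplices X (Suc 0)). aug_complex.ydelta (aug_face X) 0 e = c"
    and "P \<le> Suc q \<Longrightarrow> c \<in> frags (aug_simplices X (Suc P)) \<Longrightarrow> aug_complex.ydelta (aug_face X) P c = 0 \<Longrightarrow>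
      \<exists>e \<in> frags (aug_simplices X (Suc (Suc P))). aug_complex.ydelta (aug_face X) (Suc P) e = c"
proof -
  interpret aug_complex G "aug_simplices X" act "aug_face X" ob K w q by fact
  have push_in: "push_Some b \<in> frags (aug_simplices X (Suc k))" if "b \<in> chains X k" for b k
    using that unfolding chains_eq_frags push_Some_def
    by (rule frag_extend_in_frags) (auto simp: aug_simplices_def)
  show "\<exists>e \<in> frags (aug_simplices X (Suc 0)). ydelta 0 e = c" if c: "c \<in> frags (aug_simplices X 0)" for c
  proof -
    define m where "m = Poly_Mapping.lookup c None"
    have c_eq: "c = frag_cmul m (frag_of None)"
      using c by (intro poly_mapping_eqI) (auto simp: m_def frags_def aug_simplices_def in_keys_iff)
    have "trivial_group (integer_group Mod ((augmentation :: ('x \<Rightarrow>\<^sub>0 int) \<Rightarrow> int) ` chains X 0))"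
      using acyc n by (auto simp: acyclic_upto_def reduced_homology_group_minus1_def)
    moreover have "0 \<in> (augmentation :: ('x \<Rightarrow>\<^sub>0 int) \<Rightarrow> int) ` chains X 0"
      by (rule image_eqI[of _ _ 0]) (auto simp: augmentation_def chains_def)
    ultimately have "m \<in> (augmentation :: ('x \<Rightarrow>\<^sub>0 int) \<Rightarrow> int) ` chains X 0"
      using trivial_quotient[of integer_group "augmentation ` (chains X 0 :: ('x \<Rightarrow>\<^sub>0 int) set)" m]
      by (simp add: integer_group_def)
    then obtain b :: "'x \<Rightarrow>\<^sub>0 int" where "b \<in> chains X 0" "augmentation b = m" by auto
    then show ?thesis using push_in ydelta_push_Some(2)[OF aug, of b] c_eq by (intro bexI[of _ "push_Some b"]) auto
  qed
  show "\<exists>e \<in> frags (aug_simplices X (Suc (Suc P))). ydelta (Suc P) e = c"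
    if P: "P \<le> Suc q" and c: "c \<in> frags (aug_simplices X (Suc P))" "ydelta P c = 0" for P c
  proof -
    define b where "b = pull_Some c"
    have c_eq: "c = push_Some b"
      using c(1) push_pull[of c "simplices X P"] by (simp add: b_def aug_simplices_def)
    have b_in: "b \<in> chains X P"
      using c(1) unfolding b_def pull_Some_def chains_eq_frags
      by (rule frag_extend_in_frags) (auto simp: aug_simplices_def)
    have "b \<in> reduced_cycles X P"
    proof (cases P)
      case 0
      have "frag_cmul (augmentation b) (frag_of (None :: 'x option)) = 0"
        using c(2) 0 ydelta_push_Some(2)[OF aug, of b] c_eq by simp
      then have "augmentation b = 0" by simp
      then show ?thesis using b_in 0 by (simp add: reduced_cycles_def)
    next
      case (Suc k)
      have "push_Some (boundary X k b) = 0" using c(2) Suc ydelta_push_Some(1)[OF aug, of k b] c_eq by simp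
      then have "boundary X k b = 0" using pull_push[of "boundary X k b"] by (simp add: pull_Some_def)
      then show ?thesis using b_in Suc by (simp add: reduced_cycles_def)
    qed
    moreover have "Fin P \<le> n" using n P by (cases n) auto
    then have "trivial_group (additive_group (reduced_cycles X P) Mod boundaries X P)"
      using acyc by (simp add: acyclic_upto_def reduced_homology_group_def)
    moreover have "0 \<in> boundaries X P"
      unfolding boundaries_def by (rule image_eqI[of _ _ 0]) (auto simp: chains_def)
    ultimately have "b \<in> boundaries X P"
      using trivial_quotient[of "additive_group (reduced_cycles X P)" "boundaries X P" b]
      by (simp add: additive_group_def)
    then obtain b' where "b' \<in> chains X (Suc P)" "b = boundary X P b'" by (auto simp: boundaries_def)
    then show ?thesis
      using push_in ydelta_push_Some(1)[OF aug, of P b'] c_eq by (intro bexI[of _ "push_Some b'"]) auto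
  qed
qed

section \<open>Bounded exactness of the rows\<close>

definition pairing :: "('x \<Rightarrow> real) \<Rightarrow> ('x \<Rightarrow>\<^sub>0 rat) \<Rightarrow> real" where
  "pairing f c = (\<Sum>x\<in>Poly_Mapping.keys c. of_rat (Poly_Mapping.lookup c x) * f x)"

lemma pairing_superset:
  assumes "finite S" "Poly_Mapping.keys c \<subseteq> S"
  shows "pairing f c = (\<Sum>x\<in>S. of_rat (Poly_Mapping.lookup c x) * f x)"
  unfolding pairing_def using assms by (intro sum.mono_neutral_left) (auto simp: in_keys_iff)

lemma pairing_add: "pairing f (a + b) = pairing f a + pairing f b"
proof -
  let ?S = "Poly_Mapping.keys a \<union> Poly_Mapping.keys b"
  have "pairing f (a + b) = (\<Sum>x\<in>?S. of_rat (Poly_Mapping.lookup (a + b) x) * f x)"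
    using keys_add[of a b] by (intro pairing_superset) auto
  also have "\<dots> = (\<Sum>x\<in>?S. of_rat (Poly_Mapping.lookup a x) * f x) + (\<Sum>x\<in>?S. of_rat (Poly_Mapping.lookup b x) * f x)"
    by (simp add: lookup_add of_rat_add distrib_right sum.distrib)
  also have "\<dots> = pairing f a + pairing f b"
    by (intro arg_cong2[where f = "(+)"] pairing_superset[symmetric]) auto
  finally show ?thesis .
qed

lemma additive_pairing: "additive (pairing f)"
  by unfold_locales (rule pairing_add)

lemma pairing_single [simp]: "pairing f (Poly_Mapping.single x a) = of_rat a * f x"
  by (cases "a = 0") (simp_all add: pairing_def)

lemma lookup_scale_chain: "Poly_Mapping.lookup (scale_chain a c) x = a * Poly_Mapping.lookup c x"
  by (simp add: scale_chain_def Poly_Mapping.map.rep_eq when_def)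

lemma pairing_scale: "pairing f (scale_chain a c) = of_rat a * pairing f c"
proof -
  have "Poly_Mapping.keys (scale_chain a c) \<subseteq> Poly_Mapping.keys c"
    by (auto simp: in_keys_iff lookup_scale_chain)
  then have "pairing f (scale_chain a c)
      = (\<Sum>x\<in>Poly_Mapping.keys c. of_rat (Poly_Mapping.lookup (scale_chain a c) x) * f x)"
    by (intro pairing_superset) auto
  then show ?thesis by (simp add: lookup_scale_chain of_rat_mult pairing_def sum_distrib_left mult.assoc)
qed

lemma pairing_cong:
  assumes "c \<in> chains X k" "\<And>x. x \<in> simplices X k \<Longrightarrow> f x = g x"
  shows "pairing f c = pairing g c"
  unfolding pairing_def using assms by (intro sum.cong) (auto simp: chains_def)

lemma pairing_bound:
  assumes "c \<in> chains X k" "\<And>x. x \<in> simplices X k \<Longrightarrow> \<bar>f x\<bar> \<le> B"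
  shows "\<bar>pairing f c\<bar> \<le> l1_norm c * B"
proof -
  have "\<bar>pairing f c\<bar> \<le> (\<Sum>x\<in>Poly_Mapping.keys c. \<bar>of_rat (Poly_Mapping.lookup c x) * f x\<bar>)"
    unfolding pairing_def by (rule sum_abs)
  also have "\<dots> \<le> (\<Sum>x\<in>Poly_Mapping.keys c. \<bar>of_rat (Poly_Mapping.lookup c x)\<bar> * B)"
    using assms by (intro sum_mono) (auto simp: abs_mult chains_def intro!: mult_left_mono)
  finally show ?thesis by (simp add: l1_norm_def sum_distrib_right)
qed

lemma of_rat_minus_one_power: "of_rat ((- 1) ^ i) * (a::real) = signed i a"
  by (simp add: signed_def of_rat_power)

lemma pairing_boundary:
  "pairing f (boundary X k c) = pairing (\<lambda>x. alt_sum (Suc k) (\<lambda>i. f (face X k i x))) c"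
proof -
  have "pairing f (boundary X k c) =
      (\<Sum>x\<in>Poly_Mapping.keys c. \<Sum>i\<le>Suc k. of_rat ((- 1) ^ i * Poly_Mapping.lookup c x) * f (face X k i x))"
    unfolding boundary_def additive.sum[OF additive_pairing] by (simp only: pairing_single)
  also have "\<dots> = (\<Sum>x\<in>Poly_Mapping.keys c. of_rat (Poly_Mapping.lookup c x) * alt_sum (Suc k) (\<lambda>i. f (face X k i x)))"
    unfolding alt_sum_def sum_distrib_left
    by (intro sum.cong HOL.refl) (auto simp: signed_def of_rat_mult of_rat_power)
  finally show ?thesis by (simp add: pairing_def)
qed

lemma chains_add: "a \<in> chains X k \<Longrightarrow> b \<in> chains X k \<Longrightarrow> a + b \<in> chains X k"
  using keys_add[of a b] by (auto simp: chains_def)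

text \<open>The homotopy is only known to be linear on chains, so the boundary is first written as a signed sum
  of simplices.\<close>

lemma pairing_homotopy_boundary:
  assumes X: "delta_complex X" and lin: "rat_linear_on scale_chain scale_chain (chains X j) (h :: ('x \<Rightarrow>\<^sub>0 rat) \<Rightarrow> ('x \<Rightarrow>\<^sub>0 rat))"
    and x: "x \<in> simplices X (Suc j)"
  shows "pairing f (h (boundary X j (Poly_Mapping.single x 1)))
       = alt_sum (Suc j) (\<lambda>i. pairing f (h (Poly_Mapping.single (face X j i x) 1)))"
proof -
  define g :: "nat \<Rightarrow> 'x \<Rightarrow>\<^sub>0 rat" where "g i = Poly_Mapping.single (face X j i x) ((- 1) ^ i)" for i
  have face: "face X j i x \<in> simplices X j" if "i \<le> Suc j" for i
    using X x that by (auto simp: delta_complex_def)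
  have zero: "(0 :: 'x \<Rightarrow>\<^sub>0 rat) \<in> chains X j" by (simp add: chains_def)
  have h0: "h 0 = 0"
    using lin zero unfolding rat_linear_on_def by (metis add_cancel_right_right)
  have sum: "(\<Sum>i\<in>I. g i) \<in> chains X j \<and> pairing f (h (\<Sum>i\<in>I. g i)) = (\<Sum>i\<in>I. pairing f (h (g i)))"
    if "finite I" "I \<subseteq> {..Suc j}" for I
    using that
  proof (induction I)
    case empty
    show ?case by (simp add: zero h0 pairing_def)
  next
    case (insert i I)
    have "g i \<in> chains X j" using face insert.prems by (auto simp: g_def chains_def)
    moreover have "h (g i + (\<Sum>i\<in>I. g i)) = h (g i) + h (\<Sum>i\<in>I. g i)"
      using lin insert calculation unfolding rat_linear_on_def by auto
    ultimately show ?case using insert by (simp add: pairing_add chains_add)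
  qed
  have "boundary X j (Poly_Mapping.single x (1::rat)) = (\<Sum>i\<le>Suc j. g i)"
    unfolding boundary_def g_def by (simp del: sum.atMost_Suc)
  moreover have "pairing f (h (g i)) = signed i (pairing f (h (Poly_Mapping.single (face X j i x) 1)))" if "i \<le> Suc j" for i
  proof -
    have "g i = scale_chain ((- 1) ^ i) (Poly_Mapping.single (face X j i x) 1)"
      by (rule poly_mapping_eqI) (simp add: g_def lookup_scale_chain lookup_single when_def)
    moreover have "Poly_Mapping.single (face X j i x) (1::rat) \<in> chains X j"
      using face[OF that] by (simp add: chains_def)
    ultimately have "h (g i) = scale_chain ((- 1) ^ i) (h (Poly_Mapping.single (face X j i x) 1))"
      using lin unfolding rat_linear_on_def by simp
    then show ?thesis by (simp only: pairing_scale of_rat_minus_one_power)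
  qed
  ultimately show ?thesis using sum[of "{..Suc j}"] by (simp add: alt_sum_def del: sum.atMost_Suc)
qed

text \<open>If \<open>\<delta> f = 0\<close>, then pairing \<open>f\<close> with \<open>\<partial> h y + h \<partial> y = y\<close> gives \<open>f y = \<langle>f, h \<partial> y\<rangle>\<close>. Hence
  \<open>e \<sigma> = \<langle>f, h \<sigma>\<rangle>\<close> is a primitive of \<open>f\<close>, and its norm is bounded by the norm of \<open>h\<close> times that of \<open>f\<close>.\<close>

lemma aug_rows_bounded_exact:
  fixes X :: "'x semisimplicial"
  assumes aug: "aug_complex G (aug_simplices X) act (aug_face X) ob K w q"
    and X: "delta_complex X" and l1: "l1_homotopy n X ha h" and n: "Fin q \<le> n" and P: "P \<le> q"
  shows "aug_complex.row_exact (aug_simplices X) (aug_face X) P"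
proof -
  interpret aug_complex G "aug_simplices X" act "aug_face X" ob K w q by fact
  have contr: "contracting_homotopy n X ha h" using l1 by (simp add: l1_homotopy_def)
  have Pn: "Fin j \<le> n" if "j \<le> P" for j using n P that by (cases n) auto
  have htpy: "boundary X P (h P c) + (case P of 0 \<Rightarrow> ha (augmentation c) | Suc j \<Rightarrow> h j (boundary X j c)) = c"
    "h P c \<in> chains X (Suc P)" if "c \<in> chains X P" for c
    using contr Pn[of P] that unfolding contracting_homotopy_def by blast+
  have vanish: "pairing f (boundary X P c) = 0"
    if c: "c \<in> chains X (Suc P)" and f: "\<And>x. x \<in> simplices X (Suc P) \<Longrightarrow> alt_sum (Suc P) (\<lambda>i. f (face X P i x)) = 0"
    for c :: "'x \<Rightarrow>\<^sub>0 rat" and f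
    unfolding pairing_boundary using pairing_cong[OF c, of _ "\<lambda>_. 0"] f by (simp add: pairing_def)
  have single: "Poly_Mapping.single x (1::rat) \<in> chains X k" if "x \<in> simplices X k" for x k
    using that by (simp add: chains_def)
  show ?thesis
  proof (cases P)
    case 0
    have ha: "ha 1 \<in> chains X 0" using contr Pn[of 0] unfolding contracting_homotopy_def by auto
    show ?thesis
      unfolding row_exact_def
    proof (intro exI[of _ "l1_norm (ha 1)"] allI impI)
      fix B :: real and f :: "'x option \<Rightarrow> real"
      assume B0: "0 \<le> B" and B: "\<forall>y \<in> aug_simplices X (Suc P). \<bar>f y\<bar> \<le> B"
        and f: "\<forall>z \<in> aug_simplices X (Suc (Suc P)). alt_sum (Suc P) (\<lambda>i. f (aug_face X (Suc P) i z)) = 0"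
      define e where "e = (\<lambda>y :: 'x option. pairing (\<lambda>x. f (Some x)) (ha 1))"
      have "\<bar>e y\<bar> \<le> l1_norm (ha 1) * B" for y
        unfolding e_def using B 0 by (intro pairing_bound[OF ha]) (auto simp: aug_simplices_def)
      moreover have "alt_sum P (\<lambda>i. e (aug_face X P i y)) = f y" if y: "y \<in> aug_simplices X (Suc P)" for y
      proof -
        obtain x where x: "y = Some x" "x \<in> simplices X P" using y by (auto simp: aug_simplices_def)
        have "boundary X P (h P (Poly_Mapping.single x 1)) + ha 1 = Poly_Mapping.single x 1"
          using htpy(1)[OF single[OF x(2)]] 0 by (simp add: augmentation_def)
        then have "pairing (\<lambda>x. f (Some x)) (boundary X P (h P (Poly_Mapping.single x 1)))
            + pairing (\<lambda>x. f (Some x)) (ha 1) = f y"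
          unfolding pairing_add[symmetric] by (simp add: x)
        moreover have "pairing (\<lambda>x. f (Some x)) (boundary X P (h P (Poly_Mapping.single x 1))) = 0"
          using f by (intro vanish htpy(2) single x) (auto simp: aug_simplices_def aug_face_def)
        ultimately show ?thesis using 0 by (simp add: e_def alt_sum_def signed_def)
      qed
      ultimately show "\<exists>e. (\<forall>y \<in> aug_simplices X P. \<bar>e y\<bar> \<le> l1_norm (ha 1) * B) \<and>
          (\<forall>y \<in> aug_simplices X (Suc P). alt_sum P (\<lambda>i. e (aug_face X P i y)) = f y)"
        by blast
    qed
  next
    case (Suc p)
    obtain c where c: "\<And>\<sigma>. \<sigma> \<in> simplices X p \<Longrightarrow> l1_norm (h p (Poly_Mapping.single \<sigma> 1)) \<le> c"
      using l1[unfolded l1_homotopy_def] Pn[of p] Suc by (meson le_SucI order_refl)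
    have lin: "rat_linear_on scale_chain scale_chain (chains X p) (h p)" "h p ` chains X p \<subseteq> chains X (Suc p)"
      using contr Pn[of p] Suc unfolding contracting_homotopy_def by auto
    show ?thesis
      unfolding row_exact_def
    proof (intro exI[of _ c] allI impI)
      fix B :: real and f :: "'x option \<Rightarrow> real"
      assume B0: "0 \<le> B" and B: "\<forall>y \<in> aug_simplices X (Suc P). \<bar>f y\<bar> \<le> B"
        and f: "\<forall>z \<in> aug_simplices X (Suc (Suc P)). alt_sum (Suc P) (\<lambda>i. f (aug_face X (Suc P) i z)) = 0"
      define e where "e = (\<lambda>y. pairing (\<lambda>x. f (Some x)) (h p (Poly_Mapping.single (the y) 1)))"
      have "\<bar>e y\<bar> \<le> c * B" if y: "y \<in> aug_simplices X P" for y
      proof -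
        obtain \<sigma> where \<sigma>: "y = Some \<sigma>" "\<sigma> \<in> simplices X p" using y Suc by (auto simp: aug_simplices_def)
        have hp: "h p (Poly_Mapping.single \<sigma> 1) \<in> chains X (Suc p)" using lin(2) single[OF \<sigma>(2)] by blast
        have "\<bar>e y\<bar> \<le> l1_norm (h p (Poly_Mapping.single \<sigma> 1)) * B"
          unfolding e_def \<sigma>(1) option.sel using B Suc
          by (intro pairing_bound[OF hp]) (auto simp: aug_simplices_def)
        also have "\<dots> \<le> c * B" using c[OF \<sigma>(2)] B0 by (rule mult_right_mono)
        finally show ?thesis .
      qed
      moreover have "alt_sum P (\<lambda>i. e (aug_face X P i y)) = f y" if y: "y \<in> aug_simplices X (Suc P)" for y
      proof -
        obtain x where x: "y = Some x" "x \<in> simplices X P" using y by (auto simp: aug_simplices_def)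
        have "boundary X P (h P (Poly_Mapping.single x 1)) + h p (boundary X p (Poly_Mapping.single x 1)) = Poly_Mapping.single x 1"
          using htpy(1)[OF single[OF x(2)]] Suc by simp
        then have "pairing (\<lambda>x. f (Some x)) (boundary X P (h P (Poly_Mapping.single x 1)))
            + pairing (\<lambda>x. f (Some x)) (h p (boundary X p (Poly_Mapping.single x 1))) = f y"
          unfolding pairing_add[symmetric] by (simp add: x)
        moreover have "pairing (\<lambda>x. f (Some x)) (boundary X P (h P (Poly_Mapping.single x 1))) = 0"
          using f by (intro vanish htpy(2) single x) (auto simp: aug_simplices_def aug_face_def)
        moreover have "pairing (\<lambda>x. f (Some x)) (h p (boundary X p (Poly_Mapping.single x 1)))
            = alt_sum P (\<lambda>i. e (aug_face X P i y))"
          using pairing_homotopy_boundary[OF X lin(1), of x "\<lambda>x. f (Some x)"] x Suc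
          by (simp add: e_def aug_face_def)
        ultimately show ?thesis by simp
      qed
      ultimately show "\<exists>e. (\<forall>y \<in> aug_simplices X P. \<bar>e y\<bar> \<le> c * B) \<and>
          (\<forall>y \<in> aug_simplices X (Suc P). alt_sum P (\<lambda>i. e (aug_face X P i y)) = f y)"
        by blast
    qed
  qed
qed

section \<open>From chain-level comparison to isomorphisms\<close>

definition subtraction_closed :: "'a::ab_group_add set \<Rightarrow> bool" where
  "subtraction_closed C \<longleftrightarrow> 0 \<in> C \<and> (\<forall>a \<in> C. \<forall>b \<in> C. a - b \<in> C)"

lemma subtraction_closed_add:
  assumes "subtraction_closed C" "a \<in> C" "b \<in> C"
  shows "a + b \<in> C"
proof -
  have "a - (0 - b) \<in> C" using assms unfolding subtraction_closed_def by blast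
  then show ?thesis by simp
qed

text \<open>In an additive group the coset of \<open>a\<close> is the set of all \<open>x\<close> with \<open>x - a\<close> in the subgroup; with
  this description, the induced map and its bijectivity can be read off.\<close>

lemma quotient_map_iso:
  fixes C D :: "'a::ab_group_add set" and C' D' :: "'b::ab_group_add set"
  assumes C: "subtraction_closed C" and D: "subtraction_closed D" "D \<subseteq> C"
    and C': "subtraction_closed C'" and D': "subtraction_closed D'" "D' \<subseteq> C'"
    and f: "\<And>a. a \<in> C \<Longrightarrow> f a \<in> C'" "\<And>a b. f (a - b) = f a - f b"
    and inj: "\<And>a. a \<in> C \<Longrightarrow> f a \<in> D' \<longleftrightarrow> a \<in> D"
    and surj: "\<And>b. b \<in> C' \<Longrightarrow> \<exists>a \<in> C. b - f a \<in> D'"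
  shows "quotient_map (additive_group C') D' f \<in> iso (additive_group C Mod D) (additive_group C' Mod D')"
proof -
  have coset: "E #>\<^bsub>additive_group S\<^esub> a = {x. x - a \<in> E}" for E S :: "'c::ab_group_add set" and a
    by (force simp: r_coset_def additive_group_def algebra_simps)
  have f_add: "f (a + b) = f a + f b" for a b
  proof -
    have "f 0 = 0" using f(2)[of 0 0] by simp
    then have "f (- b) = - f b" using f(2)[of 0 b] by simp
    then show ?thesis using f(2)[of a "- b"] by simp
  qed
  have mult: "{x. x - a \<in> E} <#>\<^bsub>additive_group S\<^esub> {x. x - b \<in> E} = {x. x - (a + b) \<in> E}"
    if E: "subtraction_closed E" for E S :: "'c::ab_group_add set" and a b
  proof (intro Set.set_eqI iffI)
    fix x assume "x \<in> {x. x - a \<in> E} <#>\<^bsub>additive_group S\<^esub> {x. x - b \<in> E}"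
    then obtain u v where "x = u + v" "u - a \<in> E" "v - b \<in> E"
      by (auto simp: set_mult_def additive_group_def)
    then show "x \<in> {x. x - (a + b) \<in> E}"
      using subtraction_closed_add[OF E, of "u - a" "v - b"] by (simp add: algebra_simps)
  next
    fix x assume "x \<in> {x. x - (a + b) \<in> E}"
    then have "x - b \<in> {x. x - a \<in> E}" "b \<in> {x. x - b \<in> E}" "x = (x - b) + b"
      using E by (auto simp: subtraction_closed_def algebra_simps)
    then show "x \<in> {x. x - a \<in> E} <#>\<^bsub>additive_group S\<^esub> {x. x - b \<in> E}"
      unfolding set_mult_def additive_group_def by force
  qed
  have carr: "carrier (additive_group S Mod E) = (\<lambda>a. {x. x - a \<in> E}) ` S" for S E :: "'c::ab_group_add set"
    by (auto simp: FactGroup_def RCOSETS_def coset) (auto simp: additive_group_def)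
  have Q: "quotient_map (additive_group C') D' f {x. x - a \<in> D} = {x. x - f a \<in> D'}" if a: "a \<in> C" for a
  proof (intro Set.set_eqI iffI)
    fix x assume "x \<in> quotient_map (additive_group C') D' f {x. x - a \<in> D}"
    then obtain n y where x: "n \<in> D'" "y - a \<in> D" "x = n + f y"
      by (auto simp: quotient_map_def set_mult_def additive_group_def)
    have "f (y - a) \<in> D'" using inj[of "y - a"] x(2) D(2) by auto
    from subtraction_closed_add[OF D'(1) x(1) this]
    show "x \<in> {x. x - f a \<in> D'}" by (simp add: x(3) f(2) algebra_simps)
  next
    fix x assume "x \<in> {x. x - f a \<in> D'}"
    moreover have "x = (x - f a) + f a" by simp
    ultimately show "x \<in> quotient_map (additive_group C') D' f {x. x - a \<in> D}"
      unfolding quotient_map_def set_mult_def additive_group_def using D(1) by (force simp: subtraction_closed_def)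
  qed
  have eq: "{x. x - a \<in> E} = {x. x - b \<in> E} \<longleftrightarrow> a - b \<in> E"
    if E: "subtraction_closed E" for E :: "'c::ab_group_add set" and a b
  proof
    assume "{x. x - a \<in> E} = {x. x - b \<in> E}"
    moreover have "a \<in> {x. x - a \<in> E}" using E by (simp add: subtraction_closed_def)
    ultimately show "a - b \<in> E" by blast
  next
    assume ab: "a - b \<in> E"
    have "0 - (a - b) \<in> E" using E ab unfolding subtraction_closed_def by blast
    then have "x - a \<in> E \<longleftrightarrow> x - b \<in> E" for x
      using subtraction_closed_add[OF E, of "x - a" "a - b"] subtraction_closed_add[OF E, of "x - b" "b - a"] ab by auto
    then show "{x. x - a \<in> E} = {x. x - b \<in> E}" by blast
  qed
  have mult_Mod: "X \<otimes>\<^bsub>additive_group S Mod E\<^esub> Z = X <#>\<^bsub>additive_group S\<^esub> Z"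
    for S E :: "'c::ab_group_add set" and X Z
    by (simp add: FactGroup_def)
  show ?thesis
    unfolding iso_def
  proof (intro CollectI conjI homI)
    fix X assume "X \<in> carrier (additive_group C Mod D)"
    then show "quotient_map (additive_group C') D' f X \<in> carrier (additive_group C' Mod D')"
      unfolding carr using Q f(1) by auto
  next
    fix X Z assume "X \<in> carrier (additive_group C Mod D)" "Z \<in> carrier (additive_group C Mod D)"
    then obtain a b where ab: "a \<in> C" "b \<in> C" "X = {x. x - a \<in> D}" "Z = {x. x - b \<in> D}"
      unfolding carr by auto
    have "a + b \<in> C" using subtraction_closed_add[OF C ab(1,2)] .
    then show "quotient_map (additive_group C') D' f (X \<otimes>\<^bsub>additive_group C Mod D\<^esub> Z)
        = quotient_map (additive_group C') D' f X \<otimes>\<^bsub>additive_group C' Mod D'\<^esub> quotient_map (additive_group C') D' f Z"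
      by (simp only: mult_Mod ab(3,4) mult[OF D(1)] Q ab(1,2) mult[OF D'(1)] f_add)
  next
    show "bij_betw (quotient_map (additive_group C') D' f) (carrier (additive_group C Mod D)) (carrier (additive_group C' Mod D'))"
      unfolding bij_betw_def carr
    proof
      show "inj_on (quotient_map (additive_group C') D' f) ((\<lambda>a. {x. x - a \<in> D}) ` C)"
      proof (rule inj_onI, elim imageE, goal_cases)
        case (1 X Z a b)
        then have "f a - f b \<in> D'" using eq[OF D'(1)] Q by simp
        then have "a - b \<in> D" using inj[of "a - b"] C 1 f(2) by (simp add: subtraction_closed_def)
        then show ?case using eq[OF D(1)] 1 by simp
      qed
      show "quotient_map (additive_group C') D' f ` (\<lambda>a. {x. x - a \<in> D}) ` C = (\<lambda>a. {x. x - a \<in> D'}) ` C'"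
      proof
        show "quotient_map (additive_group C') D' f ` (\<lambda>a. {x. x - a \<in> D}) ` C \<subseteq> (\<lambda>a. {x. x - a \<in> D'}) ` C'"
          using Q f(1) by auto
        show "(\<lambda>a. {x. x - a \<in> D'}) ` C' \<subseteq> quotient_map (additive_group C') D' f ` (\<lambda>a. {x. x - a \<in> D}) ` C"
        proof (rule image_subsetI)
          fix b assume b: "b \<in> C'"
          then obtain a where a: "a \<in> C" "b - f a \<in> D'" using surj by blast
          have "{x. x - b \<in> D'} = quotient_map (additive_group C') D' f {x. x - a \<in> D}"
            using eq[OF D'(1), of b "f a"] a Q by simp
          then show "{x. x - b \<in> D'} \<in> quotient_map (additive_group C') D' f ` (\<lambda>a. {x. x - a \<in> D}) ` C"
            using a(1) by blast
        qed
      qed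
    qed
  qed
qed

lemma nerve_boundary_in:
  fixes c :: "'g list \<Rightarrow>\<^sub>0 int"
  assumes K: "group K" and "c \<in> chains (nerve K) (Suc k)"
  shows "boundary (nerve K) k c \<in> chains (nerve K) k"
  using assms
proof (induction c rule: nerve_chains_induct)
  case (symbol x)
  show ?case
    unfolding chains_nerve nerve_boundary_quotients[OF K symbol]
    by (rule omission_sum_in[OF frags_0 frags_diff])
      (simp_all add: group_quotients_in_tuples[OF K tuples_omit[OF symbol]])
qed (auto simp: chains_nerve boundary_diff frags_diff)

lemma nerve_boundary_boundary:
  fixes c :: "'g list \<Rightarrow>\<^sub>0 int"
  assumes K: "group K" and "c \<in> chains (nerve K) (Suc (Suc k))"
  shows "boundary (nerve K) k (boundary (nerve K) (Suc k) c) = 0"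
  using assms
proof (induction c rule: nerve_chains_induct)
  case (symbol x)
  interpret B: additive "boundary (nerve K) k :: ('g list \<Rightarrow>\<^sub>0 int) \<Rightarrow> _"
    unfolding boundary_eq_frag_extend by (rule additive_frag_extend)
  have "boundary (nerve K) k (boundary (nerve K) (Suc k) (frag_of (quotients K x)))
      = omission_sum (\<lambda>t. boundary (nerve K) k (frag_of (quotients K t))) x"
    by (simp add: nerve_boundary_quotients[OF K symbol] B.omission_sum)
  also have "\<dots> = omission_sum (omission_sum (\<lambda>t. frag_of (quotients K t))) x"
    by (rule omission_sum_cong) (simp add: nerve_boundary_quotients[OF K tuples_omit[OF symbol]])
  finally show ?case by (simp add: omission_sum_omission_sum)
qed (auto simp: boundary_diff)

lemma boundaries_subset_cycles: "group K \<Longrightarrow> boundaries (nerve K) j \<subseteq> cycles (nerve K) j"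
  using nerve_boundary_in[of K _ j] nerve_boundary_boundary[of K]
  by (cases j) (auto simp: boundaries_def cycles_def)

lemma subtraction_closed_cycles: "subtraction_closed (cycles X j)"
  by (cases j) (auto simp: subtraction_closed_def cycles_def chains_eq_frags frags_diff boundary_diff)

lemma subtraction_closed_boundaries: "subtraction_closed (boundaries X j)"
  unfolding subtraction_closed_def
proof (intro conjI ballI)
  show "0 \<in> boundaries X j"
    unfolding boundaries_def by (rule image_eqI[of _ _ 0]) (auto simp: chains_def)
  fix a b assume "a \<in> boundaries X j" "b \<in> boundaries X j"
  then obtain a' b' where "a' \<in> chains X (Suc j)" "a = boundary X j a'"
    "b' \<in> chains X (Suc j)" "b = boundary X j b'"
    by (auto simp: boundaries_def)
  then have "a - b = boundary X j (a' - b')" "a' - b' \<in> chains X (Suc j)"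
    by (auto simp: boundary_diff chains_eq_frags frags_diff)
  then show "a - b \<in> boundaries X j" by (auto simp: boundaries_def)
qed

lemma homology_iso_imp_iso:
  assumes AB: "subgroup_of A B" and B: "group B" and h: "homology_iso j A B"
  shows "group_homology_incl j B \<in> iso (group_homology j A) (group_homology j B)"
  unfolding group_homology_incl_def group_homology_def homology_group_def
proof (rule quotient_map_iso)
  show "boundaries (nerve A) j \<subseteq> cycles (nerve A) j" "boundaries (nerve B) j \<subseteq> cycles (nerve B) j"
    using AB B boundaries_subset_cycles by (auto simp: subgroup_of_def)
  have sub: "chains (nerve A) n \<subseteq> (chains (nerve B) n :: ('a list \<Rightarrow>\<^sub>0 int) set)" for n
    unfolding chains_nerve by (rule frags_mono) (use subgroup_of_tuples[OF AB] in blast)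
  have "cycles (nerve A) j \<subseteq> cycles (nerve B) j"
    using sub by (cases j) (auto simp: cycles_Suc_subgroup_of[OF AB], auto simp: cycles_def)
  then show "\<And>a. a \<in> cycles (nerve A) j \<Longrightarrow> id a \<in> cycles (nerve B) j" by auto
  have "boundaries (nerve A) j \<subseteq> boundaries (nerve B) j"
    using sub by (auto simp: boundaries_subgroup_of[OF AB]) (auto simp: boundaries_def)
  then show "\<And>a. a \<in> cycles (nerve A) j \<Longrightarrow> (id a \<in> boundaries (nerve B) j) = (a \<in> boundaries (nerve A) j)"
    using h by (auto simp: homology_iso_def)
  show "\<And>b. b \<in> cycles (nerve B) j \<Longrightarrow> \<exists>a \<in> cycles (nerve A) j. b - id a \<in> boundaries (nerve B) j"
    using h by (auto simp: homology_iso_def)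
qed (simp_all add: subtraction_closed_cycles subtraction_closed_boundaries)

lemma gset_point:
  assumes "group (K :: 'g monoid)"
  shows "gset K {()} (\<lambda>_ y. y)"
proof -
  interpret group K by fact
  show ?thesis by unfold_locales auto
qed

lemma bdifferential_in_bcocycles:
  assumes K: "group (K :: 'g monoid)" and f: "f \<in> bcochains j K"
  shows "bdifferential j K f \<in> bcocycles (Suc j) K"
proof -
  interpret gset K "{()}" "\<lambda>_ y. y" by (rule gset_point[OF K])
  have "bdifferential j K f \<in> bcochains (Suc j) K"
    using eq_differential_in f by (simp add: bcochains_iff_eq_cochains bdifferential_eq_eq_differential)
  moreover have "(\<lambda>s (_::unit). bdifferential (Suc j) K (bdifferential j K f) s) = 0"
    by (simp add: bdifferential_eq_eq_differential eq_differential_differential)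
  ultimately show ?thesis by (simp add: bcocycles_def fun_eq_iff)
qed

lemma bcoboundaries_subset_bcocycles:
  assumes K: "group K"
  shows "bcoboundaries j K \<subseteq> bcocycles j K"
proof (cases j)
  case 0
  have "bdifferential 0 K 0 = 0" by (rule bdifferential_0)
  then have "0 \<in> bcocycles 0 K" using bcochains_0 by (simp add: bcocycles_def)
  then show ?thesis using 0 by (simp add: bcoboundaries_def zero_fun_def)
next
  case (Suc i)
  then show ?thesis using bdifferential_in_bcocycles[OF K] by (auto simp: bcoboundaries_def)
qed

lemma bcocycle_group_eq: "bcocycle_group j K = additive_group (bcocycles j K)"
  by (simp add: bcocycle_group_def additive_group_def fun_eq_iff)

lemma fixed_point_gset_point:
  assumes AB: "subgroup_of A B" and B: "group (B :: 'g monoid)"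
  shows "fixed_point_gset B {()} (\<lambda>_ y. y) A ()"
proof -
  interpret gset B "{()}" "\<lambda>_ y. y" by (rule gset_point[OF B])
  show ?thesis using AB by unfold_locales auto
qed

lemma bres_eq_restr: "bres j A f = restr A () j (\<lambda>s _. f s)"
  by (simp add: bres_def restr_def)

lemma bres_in:
  assumes "subgroup_of A B" "group B" "f \<in> bcochains j B"
  shows "bres j A f \<in> bcochains j A"
  using fixed_point_gset.restr_in[OF fixed_point_gset_point[OF assms(1,2)]] assms(3)
  by (simp add: bres_eq_restr bcochains_iff_eq_cochains)

lemma bres_bdifferential:
  assumes "subgroup_of A B" "group B"
  shows "bdifferential j A (bres j A f) = bres (Suc j) A (bdifferential j B f)"
  using fixed_point_gset.restr_differential[OF fixed_point_gset_point[OF assms], of j "\<lambda>s _. f s"]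
  by (simp add: bres_eq_restr bdifferential_eq_eq_differential)

lemma bcocycles_alt: "bcocycles j K = {f \<in> bcochains j K. bdifferential j K f = 0}"
  by (auto simp: bcocycles_def fun_eq_iff)

lemma bcohomology_iso_imp_iso:
  assumes AB: "subgroup_of A B" and B: "group B" and h: "bcohomology_iso j A B"
  shows "bounded_cohomology_res j A \<in> iso (bounded_cohomology j B) (bounded_cohomology j A)"
  unfolding bounded_cohomology_res_def bounded_cohomology_def bcocycle_group_eq bres_def[symmetric]
proof (rule quotient_map_iso)
  note in_bres = bres_in[OF AB B] and bres_d = bres_bdifferential[OF AB B]
  have bres_0: "bres j A 0 = 0" for j by (simp add: bres_def fun_eq_iff)
  show "subtraction_closed (bcocycles j A)" "subtraction_closed (bcocycles j B)"
    by (auto simp: subtraction_closed_def bcocycles_alt bcochains_0 bdifferential_0 bcochains_diff bdifferential_diff)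
  show "subtraction_closed (bcoboundaries j A)" "subtraction_closed (bcoboundaries j B)"
    by (simp_all add: subtraction_closed_def bcoboundaries_0 bcoboundaries_diff)
  show "bcoboundaries j A \<subseteq> bcocycles j A" "bcoboundaries j B \<subseteq> bcocycles j B"
    using AB B bcoboundaries_subset_bcocycles by (auto simp: subgroup_of_def)
  show "\<And>a. a \<in> bcocycles j B \<Longrightarrow> bres j A a \<in> bcocycles j A"
    by (simp add: bcocycles_alt in_bres bres_d bres_0)
  show "\<And>a b. bres j A (a - b) = bres j A a - bres j A b"
    by (simp add: bres_def fun_eq_iff)
  have "bres j A f \<in> bcoboundaries j A" if f: "f \<in> bcoboundaries j B" for f
  proof (cases j)
    case 0
    then show ?thesis using f by (auto simp: bcoboundaries_def bres_def)
  next
    case (Suc i)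
    then obtain e where e: "e \<in> bcochains i B" "f = bdifferential i B e" using f by (auto simp: bcoboundaries_def)
    then have "bres j A f = bdifferential i A (bres i A e)" using Suc bres_d[of i e] by simp
    then show ?thesis using in_bres[OF e(1)] Suc by (simp add: bcoboundaries_def)
  qed
  then show "\<And>a. a \<in> bcocycles j B \<Longrightarrow> (bres j A a \<in> bcoboundaries j A) = (a \<in> bcoboundaries j B)"
    using h by (auto simp: bcohomology_iso_def)
  show "\<And>b. b \<in> bcocycles j A \<Longrightarrow> \<exists>a \<in> bcocycles j B. b - bres j A a \<in> bcoboundaries j A"
    using h by (auto simp: bcohomology_iso_def)
qed

section \<open>Stability\<close>

text \<open>The claim in degree \<open>q\<close> at \<open>r - 1\<close> depends on finitely many lower degrees, at indices not below
  \<open>r - q - 3\<close>. Hence a bound for degree \<open>q\<close> results from the maximum of the bounds for lower degrees.\<close>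

lemma stable_by_induction:
  fixes S :: "nat \<Rightarrow> nat \<Rightarrow> bool"
  assumes step: "\<And>q r. R q \<le> r \<Longrightarrow> (\<And>j P. j < q \<Longrightarrow> 1 \<le> P \<Longrightarrow> P \<le> q + 2 \<Longrightarrow> S j (r - Suc P)) \<Longrightarrow> S q (r - 1)"
  shows "\<exists>\<rho>. \<forall>q. \<forall>n \<ge> \<rho> q. S q n"
proof -
  have "\<exists>N. \<forall>n \<ge> N. S q n" for q
  proof (induction q rule: less_induct)
    case (less q)
    then obtain N where N: "\<And>j n. j < q \<Longrightarrow> N j \<le> n \<Longrightarrow> S j n" by metis
    define M where "M = Max (insert 0 (N ` {..<q}))"
    have M: "N j \<le> M" if "j < q" for j using that by (auto simp: M_def intro!: Max_ge)
    show ?case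
    proof (intro exI[of _ "M + q + 3 + R q"] allI impI)
      fix n assume n: "M + q + 3 + R q \<le> n"
      have "S q (Suc n - 1)"
      proof (rule step)
        show "R q \<le> Suc n" using n by simp
        fix j P assume "j < q" "1 \<le> P" "P \<le> q + 2"
        then show "S j (Suc n - Suc P)" using N[of j "Suc n - Suc P"] M[of j] n by simp
      qed
      then show "S q n" by simp
    qed
  qed
  then show ?thesis by metis
qed

lemma stable_by_aug_complexes:
  fixes S :: "nat \<Rightarrow> 'g monoid \<Rightarrow> 'g monoid \<Rightarrow> bool"
  assumes tower: "group_tower G" and proper: "proper_fun \<gamma>" "proper_fun \<tau>"
    and X: "\<And>r. delta_complex (X r)" and act: "\<And>r. simplicial_action (G r) (X r) (\<phi> r)"
    and trans: "\<And>r. transitive_upto (\<tau> r) (G r) (X r) (\<phi> r)" and compat: "compatible_stabilizers G X \<phi> \<tau>"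
    and step: "\<And>q r ob w. aug_complex (G r) (aug_simplices (X r)) (aug_action (\<phi> r)) (aug_face (X r)) ob
              (\<lambda>P. G (r - P)) w q \<Longrightarrow> Fin (Suc q) \<le> \<gamma> r \<Longrightarrow>
            (\<And>j P. j < q \<Longrightarrow> 1 \<le> P \<Longrightarrow> P \<le> q + 2 \<Longrightarrow> S j (G (r - Suc P)) (G (r - P))) \<Longrightarrow>
            S q (G (r - Suc 0)) (G (r - 0))"
  shows "\<exists>\<rho>. \<forall>q. \<forall>n \<ge> \<rho> q. S q (G n) (G (Suc n))"
proof -
  obtain R1 R2 where R: "\<And>K r. R1 K \<le> r \<Longrightarrow> Fin K \<le> \<gamma> r" "\<And>K r. R2 K \<le> r \<Longrightarrow> Fin K \<le> \<tau> r"
    using proper unfolding proper_fun_def by metis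
  show ?thesis
  proof (rule stable_by_induction[where R = "\<lambda>q. q + 3 + R1 (Suc q) + R2 (q + 2)"])
    fix q r assume r: "q + 3 + R1 (Suc q) + R2 (q + 2) \<le> r"
      and IH: "\<And>j P. j < q \<Longrightarrow> 1 \<le> P \<Longrightarrow> P \<le> q + 2 \<Longrightarrow> S j (G (r - Suc P)) (G (Suc (r - Suc P)))"
    have bounds: "q + 3 \<le> r" "Fin (Suc q) \<le> \<gamma> r" "Fin (q + 2) \<le> \<tau> r" using r R by auto
    obtain ob w where "aug_complex (G r) (aug_simplices (X r)) (aug_action (\<phi> r)) (aug_face (X r)) ob
          (\<lambda>P. G (r - P)) w q"
      using aug_complex_of_compatible[OF tower X act trans compat bounds(1,3)] by blast
    from step[OF this bounds(2)] have "S q (G (r - Suc 0)) (G (r - 0))"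
      using IH bounds(1) by (simp add: Suc_diff_Suc)
    then show "S q (G (r - 1)) (G (Suc (r - 1)))" using bounds(1) by simp
  qed
qed

theorem corollary3:
  fixes G :: "nat \<Rightarrow> 'g monoid"
    and \<gamma> \<tau> :: "nat \<Rightarrow> nat extended"
    and X :: "nat \<Rightarrow> 'x semisimplicial"
    and \<phi> :: "nat \<Rightarrow> nat \<Rightarrow> 'g \<Rightarrow> 'x \<Rightarrow> 'x"
  assumes "group_tower G"
    and "\<And>r. delta_complex (X r)"
    and "\<And>r. acyclic_upto (\<gamma> r) (X r)"
    and "\<And>r. simplicial_action (G r) (X r) (\<phi> r)"
    and "\<And>r. transitive_upto (\<tau> r) (G r) (X r) (\<phi> r)"
    and "compatible_stabilizers G X \<phi> \<tau>"
  shows "(proper_fun \<gamma> \<and> proper_fun \<tau> \<longrightarrow> homologically_stable G) \<and>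
         (proper_fun \<gamma> \<and> proper_fun \<tau> \<and> (\<forall>r. \<exists>ha h. l1_homotopy (\<gamma> r) (X r) ha h)
            \<longrightarrow> bc_stable G)"
proof -
  have groups: "group (G (Suc n))" "subgroup_of (G n) (G (Suc n))" for n
    using assms(1) group_tower_subgroup_of[OF assms(1), of n "Suc n"] by (simp_all add: group_tower_def)
  note stable = stable_by_aug_complexes[OF assms(1) _ _ assms(2,4,5,6)]
  show ?thesis
  proof (intro conjI impI)
    assume proper: "proper_fun \<gamma> \<and> proper_fun \<tau>"
    have "\<exists>\<rho>. \<forall>q. \<forall>n \<ge> \<rho> q. homology_iso q (G n) (G (Suc n))"
    proof (rule stable)
      fix q r ob w
      assume aug: "aug_complex (G r) (aug_simplices (X r)) (aug_action (\<phi> r)) (aug_face (X r)) ob (\<lambda>P. G (r - P)) w q"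
        and \<gamma>: "Fin (Suc q) \<le> \<gamma> r"
        and IH: "\<And>j P. j < q \<Longrightarrow> 1 \<le> P \<Longrightarrow> P \<le> q + 2 \<Longrightarrow> homology_iso j (G (r - Suc P)) (G (r - P))"
      show "homology_iso q (G (r - Suc 0)) (G (r - 0))"
        by (rule aug_complex.homology_iso_step[OF aug aug_rows_exact[OF aug assms(3) \<gamma>] IH])
    qed (use proper in auto)
    then show "homologically_stable G"
      unfolding homologically_stable_def using homology_iso_imp_iso[OF groups(2,1)] by meson
  next
    assume *: "proper_fun \<gamma> \<and> proper_fun \<tau> \<and> (\<forall>r. \<exists>ha h. l1_homotopy (\<gamma> r) (X r) ha h)"
    have "\<exists>\<rho>. \<forall>q. \<forall>n \<ge> \<rho> q. bcohomology_iso q (G n) (G (Suc n))"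
    proof (rule stable)
      fix q r ob w
      assume aug: "aug_complex (G r) (aug_simplices (X r)) (aug_action (\<phi> r)) (aug_face (X r)) ob (\<lambda>P. G (r - P)) w q"
        and \<gamma>: "Fin (Suc q) \<le> \<gamma> r"
        and IH: "\<And>j P. j < q \<Longrightarrow> 1 \<le> P \<Longrightarrow> P \<le> q + 2 \<Longrightarrow> bcohomology_iso j (G (r - Suc P)) (G (r - P))"
      obtain ha h where l1: "l1_homotopy (\<gamma> r) (X r) ha h" using * by blast
      have "Fin q \<le> \<gamma> r" using \<gamma> by (cases "\<gamma> r") auto
      then show "bcohomology_iso q (G (r - Suc 0)) (G (r - 0))"
        by (intro aug_complex.bcohomology_iso_step[OF aug _ IH] aug_rows_bounded_exact[OF aug assms(2) l1])
    qed (use * in auto)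
    then show "bc_stable G"
      unfolding bc_stable_def using bcohomology_iso_imp_iso[OF groups(2,1)] by meson
  qed
qed

end
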